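(* Let $X$ be a Riemann surface, $\mathcal{E}$ a holomorphic vector bundle of rank $r$ on $X$ with trivialized determinant, $\varphi:\mathcal{E}\to\mathcal{E}\otimes\Omega^1_X$ a Higgs field with $\mathrm{Tr}(\varphi)=0$ and reduced spectral curve $\Sigma$, with associated multivalued form $\phi=(\phi_1,\dots,\phi_r)$, $\nabla_0$ a connection on $\mathcal{E}$ with trivial determinant, and $\nabla_t=\nabla_0+t\varphi$ for $t\in\mathbb{R}_{\ge0}$. Fix a Hermitian metric on $\mathcal{E}$ and let $h_t:\widetilde X\to SL_r(\mathbb{C})/SU_r$ be the associated equivariant maps. Let $\gamma:[0,1]\to\widetilde X^{*}$ be a noncritical path, i.e. $\gamma^*\mathrm{Re}\,\phi_1,\dots,\gamma^*\mathrm{Re}\,\phi_r$ are pairwise distinct at every point of $[0,1]$, numbered so that $$\gamma^*\mathrm{Re}\,\phi_1>\gamma^*\mathrm{Re}\,\phi_2>\dots>\gamma^*\mathrm{Re}\,\phi_r .$$ Then, for this complex (Riemann–Hilbert) WKB problem, $$\lim_{t\to\infty}\frac1t\,\vec d\big(h_t(\gamma(0)),h_t(\gamma(1))\big)=(\alpha_1,\dots,\alpha_r),\qquad \alpha_i=\int_0^1\gamma^*\mathrm{Re}\,\phi_i .$$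
   Context: $\widetilde X$ is the universal cover of $X$. $\phi_1,\dots,\phi_r$ are the locally defined holomorphic eigen-$1$-forms of $\varphi$ (so $\sum\phi_i=0$); $X^*\subset X$ is the complement of the branch points of $\Sigma\to X$, and $\widetilde X^*$ is its preimage in $\widetilde X$. Real $1$-forms on $[0,1]$ are compared through their coefficients of the standard form on $[0,1]$. The Hermitian metric $h$ on $\mathcal{E}$ is normalized to induce the standard metric on the trivial determinant. Fix a base point $x_0$ of $\widetilde X$; identify $SL_r(\mathbb{C})/SU_r$ with the space of Hermitian metrics on $\mathcal{E}_{x_0}$ inducing the standard metric on the determinant; $h_t(Q)$ is the metric on $\mathcal{E}_{x_0}$ obtained by pulling back $h_Q$ under the transport $T_{x_0Q}(t):\mathcal{E}_{x_0}\to\mathcal{E}_Q$ of $\nabla_t$. Sign convention: transported sections $s$ satisfy $\nabla_0s=t\varphi s$. Vector distance on $SL_r(\mathbb{C})/SU_r$: for two metrics $h,k$ on the same space choose a basis $e_i$ orthogonal for both; $\vec d(h,k)=(a_1,\dots,a_r)$ with $\|e_i\|_k=e^{a_i}\|e_i\|_h$, ordered so that $a_1\ge\dots\ge a_r$. *)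

theory Defs
  imports "HOL-Complex_Analysis.Complex_Analysis"
begin

text \<open>
  A Riemann surface is a Hausdorff type \<open>'a\<close> with an indexed atlas of charts
  \<open>z i : U i \<rightarrow> \<complex>\<close>. Vector bundles are given by transition matrices relative to the same
  cover; this loses no generality, because any atlas and any trivializing cover have a common
  refinement, and the same chart may occur under several indices, with different frames.

  A 1-form is given by its coefficients with respect to the \<open>dz i\<close>; the components of a section
  are taken with respect to the frame over \<open>U i\<close>.
\<close>

type_synonym ('i, 'a) cover = "'i \<Rightarrow> 'a set"
type_synonym ('i, 'a) coords = "'i \<Rightarrow> 'a \<Rightarrow> complex"
type_synonym ('i, 'a, 'r) matrices = "'i \<Rightarrow> 'a \<Rightarrow> complex^'r^'r"
type_synonym ('i, 'a, 'r) transitions = "'i \<Rightarrow> 'i \<Rightarrow> 'a \<Rightarrow> complex^'r^'r"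


section \<open>Riemann surfaces\<close>

definition in_chart ::
  "('i, 'a) cover \<Rightarrow> ('i, 'a) coords \<Rightarrow> 'i \<Rightarrow> ('a \<Rightarrow> 'c) \<Rightarrow> complex \<Rightarrow> 'c" where
  "in_chart U z i f = f \<circ> the_inv_into (U i) (z i)"

definition riemann_surface ::
  "('i, 'a::t2_space) cover \<Rightarrow> ('i, 'a) coords \<Rightarrow> bool" where
  "riemann_surface U z \<longleftrightarrow>
     connected (UNIV :: 'a set) \<and>
     (\<Union>i. U i) = UNIV \<and>
     (\<forall>i. open (U i) \<and> open (z i ` U i) \<and> (\<exists>y. homeomorphism (U i) (z i ` U i) (z i) y)) \<and>
     (\<forall>i j. in_chart U z j (z i) holomorphic_on z j ` (U i \<inter> U j))"

definition chart_holomorphic_on ::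
  "('i, 'a) cover \<Rightarrow> ('i, 'a) coords \<Rightarrow> 'i \<Rightarrow> 'a set \<Rightarrow> ('a \<Rightarrow> complex) \<Rightarrow> bool" where
  "chart_holomorphic_on U z i W f \<longleftrightarrow> in_chart U z i f holomorphic_on z i ` (W \<inter> U i)"

text \<open>The coefficient of \<open>df\<close> with respect to \<open>dz i\<close>.\<close>

definition chart_deriv ::
  "('i, 'a) cover \<Rightarrow> ('i, 'a) coords \<Rightarrow> 'i \<Rightarrow> ('a \<Rightarrow> complex) \<Rightarrow> 'a \<Rightarrow> complex" where
  "chart_deriv U z i f x = deriv (in_chart U z i f) (z i x)"


section \<open>Holomorphic bundles, Higgs fields and connections\<close>

text \<open>The components of a section satisfy \<open>s i = g i j *v s j\<close>.\<close>

definition holomorphic_bundle ::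
  "('i, 'a) cover \<Rightarrow> ('i, 'a) coords \<Rightarrow> ('i, 'a, 'r::finite) transitions \<Rightarrow> bool" where
  "holomorphic_bundle U z g \<longleftrightarrow>
     (\<forall>i j k l. chart_holomorphic_on U z j (U i \<inter> U j) (\<lambda>x. g i j x $ k $ l)) \<and>
     (\<forall>i. \<forall>x \<in> U i. g i i x = mat 1) \<and>
     (\<forall>i j k. \<forall>x \<in> U i \<inter> U j \<inter> U k. g i j x ** g j k x = g i k x)"

text \<open>
  The isomorphism from the determinant bundle to the trivial bundle maps the exterior product of
  the vectors of the frame over \<open>U i\<close> to the function \<open>\<delta> i\<close>.
\<close>

definition det_trivialization ::
  "('i, 'a) cover \<Rightarrow> ('i, 'a) coords \<Rightarrow> ('i, 'a, 'r::finite) transitions \<Rightarrow> ('i \<Rightarrow> 'a \<Rightarrow> complex) \<Rightarrow> bool" where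
  "det_trivialization U z g \<delta> \<longleftrightarrow>
     (\<forall>i. chart_holomorphic_on U z i (U i) (\<delta> i) \<and> (\<forall>x \<in> U i. \<delta> i x \<noteq> 0)) \<and>
     (\<forall>i j. \<forall>x \<in> U i \<inter> U j. \<delta> i x * det (g i j x) = \<delta> j x)"

definition higgs_field ::
  "('i, 'a) cover \<Rightarrow> ('i, 'a) coords \<Rightarrow> ('i, 'a, 'r::finite) transitions \<Rightarrow> ('i, 'a, 'r) matrices \<Rightarrow> bool" where
  "higgs_field U z g \<Phi> \<longleftrightarrow>
     (\<forall>i k l. chart_holomorphic_on U z i (U i) (\<lambda>x. \<Phi> i x $ k $ l)) \<and>
     (\<forall>i j. \<forall>x \<in> U i \<inter> U j.
        mat (chart_deriv U z j (z i) x) ** \<Phi> i x ** g i j x = g i j x ** \<Phi> j x)"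

text \<open>
  A (holomorphic) connection is \<open>s \<mapsto> (ds i / dz i + A i *v s i) dz i\<close> in the frame over \<open>U i\<close>.
\<close>

definition holomorphic_connection ::
  "('i, 'a) cover \<Rightarrow> ('i, 'a) coords \<Rightarrow> ('i, 'a, 'r::finite) transitions \<Rightarrow> ('i, 'a, 'r) matrices \<Rightarrow> bool" where
  "holomorphic_connection U z g A \<longleftrightarrow>
     (\<forall>i k l. chart_holomorphic_on U z i (U i) (\<lambda>x. A i x $ k $ l)) \<and>
     (\<forall>i j. \<forall>x \<in> U i \<inter> U j.
        (\<chi> k l. chart_deriv U z j (\<lambda>y. g i j y $ k $ l) x)
          + mat (chart_deriv U z j (z i) x) ** A i x ** g i j x = g i j x ** A j x)"

text \<open>
  The connection induced on the determinant has the form \<open>trace (A i)\<close>; it is to correspond to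
  \<open>d\<close> under the trivialization \<open>\<delta>\<close>.
\<close>

definition trivial_det_connection ::
  "('i, 'a) cover \<Rightarrow> ('i, 'a) coords \<Rightarrow> ('i \<Rightarrow> 'a \<Rightarrow> complex) \<Rightarrow> ('i, 'a, 'r::finite) matrices \<Rightarrow> bool" where
  "trivial_det_connection U z \<delta> A \<longleftrightarrow>
     (\<forall>i. \<forall>x \<in> U i. chart_deriv U z i (\<delta> i) x = trace (A i x) * \<delta> i x)"


section \<open>The spectral curve\<close>

text \<open>The equation of the spectral curve at the cotangent vector \<open>l dz i\<close> over \<open>x\<close>.\<close>

definition char_fun :: "('i, 'a, 'r::finite) matrices \<Rightarrow> 'i \<Rightarrow> 'a \<Rightarrow> complex \<Rightarrow> complex" where
  "char_fun \<Phi> i x l = det (mat l - \<Phi> i x)"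

definition holomorphic2_on :: "(complex \<times> complex \<Rightarrow> complex) \<Rightarrow> (complex \<times> complex) set \<Rightarrow> bool" where
  "holomorphic2_on f S \<longleftrightarrow>
     (\<forall>q \<in> S. \<exists>a b. (f has_derivative (\<lambda>(u, v). a * u + b * v)) (at q))"

text \<open>
  The analytic space cut out by \<open>P\<close> in an open subset \<open>D\<close> of \<open>\<complex>\<^sup>2\<close> is reduced: the local rings of
  germs modulo \<open>P\<close> have no nilpotents, i.e. a germ one of whose powers is divisible by \<open>P\<close> is
  itself divisible by \<open>P\<close>.
\<close>

definition reduced_zero_locus ::
  "(complex \<times> complex) set \<Rightarrow> (complex \<times> complex \<Rightarrow> complex) \<Rightarrow> bool" where
  "reduced_zero_locus D P \<longleftrightarrow>
     (\<forall>q \<in> D. \<forall>S f h n.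
        open S \<and> q \<in> S \<and> S \<subseteq> D \<and> holomorphic2_on f S \<and> holomorphic2_on h S \<and>
        (\<forall>y \<in> S. f y ^ n = h y * P y) \<longrightarrow>
        (\<exists>T m. open T \<and> q \<in> T \<and> T \<subseteq> S \<and> holomorphic2_on m T \<and> (\<forall>y \<in> T. f y = m y * P y)))"

definition reduced_spectral_curve ::
  "('i, 'a) cover \<Rightarrow> ('i, 'a) coords \<Rightarrow> ('i, 'a, 'r::finite) matrices \<Rightarrow> bool" where
  "reduced_spectral_curve U z \<Phi> \<longleftrightarrow>
     (\<forall>i. reduced_zero_locus (z i ` U i \<times> UNIV)
            (\<lambda>(w, l). char_fun \<Phi> i (the_inv_into (U i) (z i) w) l))"

text \<open>
  The complement of the branch points: the points over which the spectral curve, which has degree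
  \<open>CARD('r)\<close> over the surface, has \<open>CARD('r)\<close> different points.
\<close>

definition unbranched :: "('i, 'a) cover \<Rightarrow> ('i, 'a, 'r::finite) matrices \<Rightarrow> 'a set" where
  "unbranched U \<Phi> = {x. \<forall>i. x \<in> U i \<longrightarrow> card {l. char_fun \<Phi> i x l = 0} = CARD('r)}"

text \<open>
  \<open>\<omega> k i\<close> is the coefficient of the \<open>k\<close>-th form with respect to \<open>dz i\<close>; the forms are the \<open>CARD('r)\<close>
  different eigenforms of the Higgs field on \<open>W\<close>.
\<close>

definition eigenforms_on ::
  "('i, 'a::topological_space) cover \<Rightarrow> ('i, 'a) coords \<Rightarrow> ('i, 'a, 'r::finite) matrices \<Rightarrow>
     'a set \<Rightarrow> ('r \<Rightarrow> 'i \<Rightarrow> 'a \<Rightarrow> complex) \<Rightarrow> bool" where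
  "eigenforms_on U z \<Phi> W \<omega> \<longleftrightarrow>
     open W \<and> W \<subseteq> unbranched U \<Phi> \<and>
     (\<forall>k i. chart_holomorphic_on U z i W (\<omega> k i)) \<and>
     (\<forall>k i j. \<forall>x \<in> W \<inter> U i \<inter> U j. chart_deriv U z j (z i) x * \<omega> k i x = \<omega> k j x) \<and>
     (\<forall>k i. \<forall>x \<in> W \<inter> U i. \<exists>v. v \<noteq> 0 \<and> \<Phi> i x *v v = \<omega> k i x *s v) \<and>
     (\<forall>i. \<forall>x \<in> W \<inter> U i. inj (\<lambda>k. \<omega> k i x))"


section \<open>Paths\<close>

definition C1_path ::
  "('i, 'a::topological_space) cover \<Rightarrow> ('i, 'a) coords \<Rightarrow> (real \<Rightarrow> 'a) \<Rightarrow> bool" where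
  "C1_path U z c \<longleftrightarrow> path c \<and>
     (\<forall>i. \<exists>D. continuous_on {u \<in> {0..1}. c u \<in> U i} D \<and>
        (\<forall>u \<in> {0..1}. c u \<in> U i \<longrightarrow>
           ((z i \<circ> c) has_vector_derivative D u) (at u within {0..1})))"

text \<open>
  \<open>\<beta> k\<close> is the coefficient, with respect to the standard form on \<open>[0,1]\<close>, of the pullback by \<open>c\<close> of
  the \<open>k\<close>-th branch of the multivalued eigenform, the branches being continued along \<open>c\<close>. The
  numbering belongs to the path: at a self-intersection of \<open>c\<close> it may differ between the two
  passages.
\<close>

definition pullback_eigenforms ::
  "('i, 'a::topological_space) cover \<Rightarrow> ('i, 'a) coords \<Rightarrow> ('i, 'a, 'r::finite) matrices \<Rightarrow>
     (real \<Rightarrow> 'a) \<Rightarrow> ('r \<Rightarrow> real \<Rightarrow> complex) \<Rightarrow> bool" where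
  "pullback_eigenforms U z \<Phi> c \<beta> \<longleftrightarrow>
     (\<forall>u \<in> {0..1}. \<exists>W \<omega> N. eigenforms_on U z \<Phi> W \<omega> \<and> open N \<and> u \<in> N \<and>
        (\<forall>u' \<in> N \<inter> {0..1}. c u' \<in> W \<and>
           (\<forall>k i. c u' \<in> U i \<longrightarrow>
              \<beta> k u' = \<omega> k i (c u') * vector_derivative (z i \<circ> c) (at u' within {0..1}))))"


section \<open>Hermitian metrics and the vector distance\<close>

definition herm :: "complex^'r^'r \<Rightarrow> complex^'r::finite \<Rightarrow> complex^'r \<Rightarrow> complex" where
  "herm M v w = (\<Sum>k\<in>UNIV. \<Sum>l\<in>UNIV. v $ k * M $ k $ l * cnj (w $ l))"

text \<open>\<open>n\<close> times continuously differentiable, as a function of two real variables.\<close>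

primrec C_k_on :: "nat \<Rightarrow> complex set \<Rightarrow> (complex \<Rightarrow> complex) \<Rightarrow> bool" where
  "C_k_on 0 S f \<longleftrightarrow> continuous_on S f"
| "C_k_on (Suc n) S f \<longleftrightarrow>
     (\<exists>fx fy. C_k_on n S fx \<and> C_k_on n S fy \<and>
        (\<forall>w \<in> S. (f has_derivative (\<lambda>h. Re h *\<^sub>R fx w + Im h *\<^sub>R fy w)) (at w)))"

text \<open>\<open>H i x\<close> is the Gram matrix at \<open>x\<close> of the frame over \<open>U i\<close>.\<close>

definition hermitian_metric ::
  "('i, 'a) cover \<Rightarrow> ('i, 'a) coords \<Rightarrow> ('i, 'a, 'r::finite) transitions \<Rightarrow> ('i, 'a, 'r) matrices \<Rightarrow> bool" where
  "hermitian_metric U z g H \<longleftrightarrow>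
     (\<forall>i k l n. C_k_on n (z i ` U i) (in_chart U z i (\<lambda>x. H i x $ k $ l))) \<and>
     (\<forall>i. \<forall>x \<in> U i. (\<forall>v w. herm (H i x) w v = cnj (herm (H i x) v w)) \<and>
        (\<forall>v. v \<noteq> 0 \<longrightarrow> Re (herm (H i x) v v) > 0)) \<and>
     (\<forall>i j. \<forall>x \<in> U i \<inter> U j. \<forall>v w.
        herm (H i x) (g i j x *v v) (g i j x *v w) = herm (H j x) v w)"

text \<open>
  The squared norm of the exterior product of the frame is its Gram determinant.
\<close>

definition standard_on_det ::
  "('i, 'a) cover \<Rightarrow> ('i \<Rightarrow> 'a \<Rightarrow> complex) \<Rightarrow> ('i, 'a, 'r::finite) matrices \<Rightarrow> bool" where
  "standard_on_det U \<delta> H \<longleftrightarrow>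
     (\<forall>i. \<forall>x \<in> U i. det (H i x) = of_real ((cmod (\<delta> i x))\<^sup>2))"

definition metric_norm :: "('v \<Rightarrow> 'v \<Rightarrow> complex) \<Rightarrow> 'v \<Rightarrow> real" where
  "metric_norm h v = sqrt (Re (h v v))"

definition orthogonal_basis ::
  "(complex^'r \<Rightarrow> complex^'r \<Rightarrow> complex) \<Rightarrow> ('r::finite \<Rightarrow> complex^'r) \<Rightarrow> bool" where
  "orthogonal_basis h e \<longleftrightarrow>
     inj e \<and> vec.independent (range e) \<and> vec.span (range e) = UNIV \<and>
     (\<forall>k l. k \<noteq> l \<longrightarrow> h (e k) (e l) = 0)"

definition vector_distance ::
  "(complex^('r::{finite,linorder}) \<Rightarrow> complex^('r::{finite,linorder}) \<Rightarrow> complex) \<Rightarrow>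
     (complex^('r::{finite,linorder}) \<Rightarrow> complex^('r::{finite,linorder}) \<Rightarrow> complex) \<Rightarrow> real^('r::{finite,linorder})" where
  "vector_distance h k = (THE a.
     (\<exists>e. orthogonal_basis h e \<and> orthogonal_basis k e \<and>
        (\<forall>m. metric_norm k (e m) = exp (a $ m) * metric_norm h (e m))) \<and>
     (\<forall>m n. m \<le> n \<longrightarrow> a $ m \<ge> a $ n))"


section \<open>Transport on the universal cover\<close>

text \<open>
  Let \<open>p\<close> be a covering map onto the surface. \<open>s\<close> is a global section of the pullback of the bundle
  by \<open>p\<close> (\<open>s Q i\<close> being its components at \<open>Q\<close> in the frame over \<open>U i\<close>, meaningful only for
  \<open>p Q \<in> U i\<close>) that is transported by \<open>\<nabla>\<^sub>t = \<nabla>\<^sub>0 + t \<phi>\<close>. The sign convention is that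
  transported sections satisfy \<open>\<nabla>\<^sub>0 s = t \<phi> s\<close> (and not \<open>\<nabla>\<^sub>0 s = - t \<phi> s\<close>). Derivatives on the cover are taken in the coordinates \<open>z i \<circ> p\<close>
  on open sets that \<open>p\<close> maps injectively into \<open>U i\<close>.
\<close>

definition transported_section ::
  "('i, 'a) cover \<Rightarrow> ('i, 'a) coords \<Rightarrow> ('i, 'a, 'r::finite) transitions \<Rightarrow> ('i, 'a, 'r) matrices \<Rightarrow>
     ('i, 'a, 'r) matrices \<Rightarrow> ('b::topological_space \<Rightarrow> 'a) \<Rightarrow> real \<Rightarrow> ('b \<Rightarrow> 'i \<Rightarrow> complex^'r) \<Rightarrow> bool" where
  "transported_section U z g A \<Phi> p t s \<longleftrightarrow>
     (\<forall>Q i j. p Q \<in> U i \<inter> U j \<longrightarrow> s Q i = g i j (p Q) *v s Q j) \<and>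
     (\<forall>i V. open V \<and> inj_on p V \<and> p ` V \<subseteq> U i \<longrightarrow>
        (\<forall>Q \<in> V. \<exists>s'.
           (\<forall>k. ((\<lambda>w. s (the_inv_into V (z i \<circ> p) w) i $ k) has_field_derivative s' $ k)
                  (at (z i (p Q)))) \<and>
           s' + A i (p Q) *v s Q i = of_real t *s (\<Phi> i (p Q) *v s Q i)))"

text \<open>
  The transport from \<open>x0\<close> to \<open>Q\<close>, with respect to the frames over \<open>U i0\<close> and \<open>U j\<close>. The cover being
  simply connected, a transported section with a given value at \<open>x0\<close> exists and is unique.
\<close>

definition transport ::
  "('i, 'a) cover \<Rightarrow> ('i, 'a) coords \<Rightarrow> ('i, 'a, 'r::finite) transitions \<Rightarrow> ('i, 'a, 'r) matrices \<Rightarrow>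
     ('i, 'a, 'r) matrices \<Rightarrow> ('b::topological_space \<Rightarrow> 'a) \<Rightarrow> 'b \<Rightarrow> 'i \<Rightarrow>
     real \<Rightarrow> 'b \<Rightarrow> 'i \<Rightarrow> complex^'r \<Rightarrow> complex^'r" where
  "transport U z g A \<Phi> p x0 i0 t Q j v =
     (THE w. \<exists>s. transported_section U z g A \<Phi> p t s \<and> s x0 i0 = v \<and> s Q j = w)"

text \<open>
  The metric \<open>h\<^sub>t(Q)\<close> on the fibre over \<open>x0\<close>, which is identified with \<open>\<complex>\<^sup>r\<close> by the frame over
  \<open>U i0\<close>. The frame over \<open>U j\<close> used at \<open>Q\<close> does not matter.
\<close>

definition pulled_back_metric ::
  "('i, 'a) cover \<Rightarrow> ('i, 'a) coords \<Rightarrow> ('i, 'a, 'r::finite) transitions \<Rightarrow> ('i, 'a, 'r) matrices \<Rightarrow>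
     ('i, 'a, 'r) matrices \<Rightarrow> ('i, 'a, 'r) matrices \<Rightarrow> ('b::topological_space \<Rightarrow> 'a) \<Rightarrow> 'b \<Rightarrow> 'i \<Rightarrow>
     real \<Rightarrow> 'b \<Rightarrow> complex^'r \<Rightarrow> complex^'r \<Rightarrow> complex" where
  "pulled_back_metric U z g A \<Phi> H p x0 i0 t Q v w =
     (let j = (SOME j. p Q \<in> U j); T = transport U z g A \<Phi> p x0 i0 t Q j
      in herm (H j (p Q)) (T v) (T w))"

end

theory Submission
  imports Defs
begin

text \<open>
  Let \<open>\<Pi> k\<close> be the projection of the bundle onto the \<open>k\<close>-th eigenline of the Higgs field along the
  path, and for a transported section \<open>s\<close> let \<open>N k\<close> be the squared norm of \<open>\<Pi> k s\<close>. Since \<open>\<Pi> k\<close> is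
  defined by the eigenvalue alone, \<open>N k\<close> does not depend on frames, so the eigenlines need not be
  glued along the path, and \<open>\<bar>N k' - 2 t (Re \<beta> k) N k\<bar> \<le> C (\<Sum>l. N l)\<close> with \<open>C\<close> independent of \<open>t\<close>
  and \<open>s\<close>. By the gap between the \<open>Re \<beta> k\<close>, for large \<open>t\<close> the signed sum
  \<open>D = (\<Sum>l\<le>k. N l) - (\<Sum>l>k. N l)\<close> satisfies \<open>D' \<ge> (2 t Re \<beta> k - C') D\<close>. Hence sections
  starting in the span of the first \<open>k\<close> eigenlines grow at least like \<open>exp (t \<alpha> k)\<close>, and dually
  sections ending in the span of the eigenlines from the \<open>k\<close>-th on grow at most like
  \<open>exp (t \<alpha> k)\<close>. By the minimax principle the components of the vector distance are
  \<open>t \<alpha> k + O(1)\<close>.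

  The transport on the universal cover is defined by global sections, so their existence has to
  be shown: locally by Picard iteration, globally by monodromy.
\<close>

section \<open>Monodromy of local systems\<close>

text \<open>The error constant is free of t because each projection commutes with the Higgs field:
  in the derivative of the k-th component, the part carrying t is exactly t times
  \<open>\<beta> k\<close> times that component. The derivative of the projection, the connection
  form and the derivative of the metric leave a t-free quadratic expression in the section, which
  compactness of the interval bounds by a multiple of the sum of all components. The path is only
  C1, so the pulled-back Higgs matrix need not be differentiable. The projections are, since a
  common scalar factor of matrix and eigenvalues cancels and leaves a holomorphic function of the
  chart. Lower bounds prescribe the section at time 0, upper bounds at time 1. Both conditions are
  carried by the transport to subspaces of the one fibre over \<open>x0\<close>; keeping their
  dimensions requires the transport to be a linear isomorphism, hence the existence and uniqueness
  of global sections. The minimax principle also justifies the definite description of the vector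
  distance. Monodromy is carried out for an abstract notion of flat section, without a total
  space.\<close>

locale local_system =
  fixes flat :: "'x::topological_space set \<Rightarrow> ('x \<Rightarrow> 'v) \<Rightarrow> bool"
    and Fib :: "'x \<Rightarrow> 'v set"
  assumes flat_open: "flat V s \<Longrightarrow> open V"
    and flat_fib: "flat V s \<Longrightarrow> x \<in> V \<Longrightarrow> s x \<in> Fib x"
    and flat_sep: "flat V s \<Longrightarrow> flat V' s' \<Longrightarrow> x \<in> V \<Longrightarrow> x \<in> V' \<Longrightarrow>
       \<exists>N. open N \<and> x \<in> N \<and> ((\<forall>y\<in>N. s y = s' y) \<or> (\<forall>y\<in>N. s y \<noteq> s' y))"
    and flat_ex: "\<exists>V. open V \<and> x \<in> V \<and> path_connected V \<and>
       (\<forall>q\<in>V. \<forall>v\<in>Fib q. \<exists>s. flat V s \<and> s q = v)"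
begin

text \<open>A lift is locally f followed by a flat section. It stands for a lift of f to the etale
  space of the local system, which is never built. Everything is relative to K, so that closed
  intervals and rectangles are admissible domains.\<close>

definition lift_at :: "('y::topological_space \<Rightarrow> 'x) \<Rightarrow> 'y set \<Rightarrow> ('y \<Rightarrow> 'v) \<Rightarrow> 'y \<Rightarrow> bool" where
  "lift_at f K \<sigma> y \<longleftrightarrow> (\<exists>N V s. open N \<and> y \<in> N \<and> flat V s \<and> f y \<in> V \<and>
     (\<forall>y'\<in>N \<inter> K. f y' \<in> V \<and> \<sigma> y' = s (f y')))"

text \<open>The value may be prescribed at any point of K: when pieces are glued, the second one
  starts from a point of the overlap.\<close>

definition liftable :: "('y::topological_space \<Rightarrow> 'x) \<Rightarrow> 'y set \<Rightarrow> bool" where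
  "liftable f K \<longleftrightarrow> (\<forall>q\<in>K. \<forall>v\<in>Fib (f q). \<exists>\<sigma>. (\<forall>y\<in>K. lift_at f K \<sigma> y) \<and> \<sigma> q = v)"

lemma lift_atE:
  assumes "lift_at f K \<sigma> y"
  obtains N V s where "open N" "y \<in> N" "flat V s" "f y \<in> V"
    "\<forall>y'\<in>N \<inter> K. f y' \<in> V \<and> \<sigma> y' = s (f y')"
  using assms unfolding lift_at_def by (elim exE conjE) (rule that)

lemma lift_at_fib: "lift_at f K \<sigma> y \<Longrightarrow> y \<in> K \<Longrightarrow> \<sigma> y \<in> Fib (f y)"
  unfolding lift_at_def using flat_fib by fastforce

lemma lift_at_mono: "lift_at f K \<sigma> y \<Longrightarrow> K' \<subseteq> K \<Longrightarrow> lift_at f K' \<sigma> y"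
  unfolding lift_at_def by blast

lemma liftable_mono:
  assumes "liftable f K" "K' \<subseteq> K"
  shows "liftable f K'"
  unfolding liftable_def
proof (intro ballI)
  fix q v assume "q \<in> K'" "v \<in> Fib (f q)"
  then obtain \<sigma> where "\<forall>y\<in>K. lift_at f K \<sigma> y" "\<sigma> q = v"
    using assms unfolding liftable_def by blast
  then show "\<exists>\<sigma>. (\<forall>y\<in>K'. lift_at f K' \<sigma> y) \<and> \<sigma> q = v"
    using assms(2) lift_at_mono by blast
qed

lemma lift_at_compose:
  assumes "lift_at f K \<sigma> (g y)" "continuous_on K' g" "g ` K' \<subseteq> K" "y \<in> K'"
  shows "lift_at (\<lambda>y. f (g y)) K' (\<lambda>y. \<sigma> (g y)) y"
proof -
  obtain N V s where *: "open N" "g y \<in> N" "flat V s" "f (g y) \<in> V"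
    "\<forall>y'\<in>N \<inter> K. f y' \<in> V \<and> \<sigma> y' = s (f y')"
    using assms(1) unfolding lift_at_def by blast
  obtain M where M: "open M" "M \<inter> K' = g -` N \<inter> K'"
    using assms(2) *(1) continuous_on_open_invariant by metis
  have MK: "g y' \<in> N \<inter> K" if "y' \<in> M \<inter> K'" for y' using M(2) that assms(3) by blast
  have "y \<in> M" using M(2) *(2) assms(4) by blast
  then show ?thesis unfolding lift_at_def
    by (intro exI[of _ M] exI[of _ V] exI[of _ s]) (use *(3-5) M(1) MK in auto)
qed

lemma lift_at_section:
  assumes "flat V s" "continuous_on K f" "f ` K \<subseteq> V" "y \<in> K"
  shows "lift_at f K (\<lambda>y. s (f y)) y"
  unfolding lift_at_def by (rule exI[of _ UNIV], rule exI[of _ V], rule exI[of _ s]) (use assms in auto)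

text \<open>Near a common point two flat sections agree everywhere or nowhere
  (\<open>flat_sep\<close>), so the set where the lifts agree and the set where they differ are both
  open in the connected set K.\<close>

lemma lift_unique:
  assumes "connected K" "continuous_on K f" "\<forall>y\<in>K. lift_at f K \<sigma> y" "\<forall>y\<in>K. lift_at f K \<tau> y"
    and "y0 \<in> K" "\<sigma> y0 = \<tau> y0" "y \<in> K"
  shows "\<sigma> y = \<tau> y"
proof (rule connected_induction_simple[OF assms(1) assms(5) assms(7), where P = "\<lambda>y. \<sigma> y = \<tau> y"])
  show "\<sigma> y0 = \<tau> y0" by fact
  fix a assume a: "a \<in> K"
  obtain N V s where 1: "open N" "a \<in> N" "flat V s" "f a \<in> V"
    "\<forall>y'\<in>N \<inter> K. f y' \<in> V \<and> \<sigma> y' = s (f y')"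
    by (rule lift_atE[OF bspec[OF assms(3) a]])
  obtain N' V' s' where 2: "open N'" "a \<in> N'" "flat V' s'" "f a \<in> V'"
    "\<forall>y'\<in>N' \<inter> K. f y' \<in> V' \<and> \<tau> y' = s' (f y')"
    by (rule lift_atE[OF bspec[OF assms(4) a]])
  obtain S where S: "open S" "f a \<in> S" "(\<forall>y\<in>S. s y = s' y) \<or> (\<forall>y\<in>S. s y \<noteq> s' y)"
    using flat_sep[OF 1(3) 2(3) 1(4) 2(4)] by (elim exE conjE) (rule that)
  obtain M where M: "open M" "M \<inter> K = f -` S \<inter> K"
    using assms(2) S(1) continuous_on_open_invariant by metis
  show "\<exists>T. openin (top_of_set K) T \<and> a \<in> T \<and> (\<forall>x\<in>T. \<forall>y\<in>T. \<sigma> x = \<tau> x \<longrightarrow> \<sigma> y = \<tau> y)"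
  proof (rule exI[of _ "K \<inter> (N \<inter> N' \<inter> M)"], intro conjI)
    show "openin (top_of_set K) (K \<inter> (N \<inter> N' \<inter> M))"
      using 1(1) 2(1) M(1) by (intro openin_open_Int open_Int)
    show "a \<in> K \<inter> (N \<inter> N' \<inter> M)" using a 1(2) 2(2) M(2) S(2) by blast
    have fS: "f y \<in> S" if "y \<in> K \<inter> (N \<inter> N' \<inter> M)" for y using M(2) that by blast
    have st: "\<sigma> y = s (f y)" "\<tau> y = s' (f y)" if "y \<in> K \<inter> (N \<inter> N' \<inter> M)" for y
      using bspec[OF 1(5), of y] bspec[OF 2(5), of y] that by simp_all
    have "(\<forall>y\<in>K \<inter> (N \<inter> N' \<inter> M). \<sigma> y = \<tau> y) \<or> (\<forall>y\<in>K \<inter> (N \<inter> N' \<inter> M). \<sigma> y \<noteq> \<tau> y)"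
      using S(3)
    proof (rule disjE)
      assume e: "\<forall>y\<in>S. s y = s' y"
      have "\<sigma> y = \<tau> y" if y: "y \<in> K \<inter> (N \<inter> N' \<inter> M)" for y
        using st[OF y] e fS[OF y] by simp
      then show ?thesis by simp
    next
      assume e: "\<forall>y\<in>S. s y \<noteq> s' y"
      have "\<sigma> y \<noteq> \<tau> y" if y: "y \<in> K \<inter> (N \<inter> N' \<inter> M)" for y
        using st[OF y] e fS[OF y] by simp
      then show ?thesis by simp
    qed
    then show "\<forall>x\<in>K \<inter> (N \<inter> N' \<inter> M). \<forall>y\<in>K \<inter> (N \<inter> N' \<inter> M). \<sigma> x = \<tau> x \<longrightarrow> \<sigma> y = \<tau> y"
      by (elim disjE) simp_all
  qed
qed

text \<open>The lift over K1 is continued over K2 from its value at one point of the overlap.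
  Connectedness of the overlap makes both agree on all of it; closedness gives each point off the
  overlap a neighbourhood meeting only one piece. The case of q in K2 follows by symmetry.\<close>

lemma liftable_Un_aux:
  assumes t: "liftable f K1" "liftable f K2" and cl: "closed K1" "closed K2"
    and cont: "continuous_on (K1 \<union> K2) f" and con: "connected (K1 \<inter> K2)" "K1 \<inter> K2 \<noteq> {}"
    and q: "q \<in> K1" "v \<in> Fib (f q)"
  shows "\<exists>\<sigma>. (\<forall>y\<in>K1 \<union> K2. lift_at f (K1 \<union> K2) \<sigma> y) \<and> \<sigma> q = v"
proof -
  obtain \<sigma>1 where s1: "\<forall>y\<in>K1. lift_at f K1 \<sigma>1 y" "\<sigma>1 q = v"
    using t(1) q unfolding liftable_def by blast
  obtain r where r: "r \<in> K1" "r \<in> K2" using con by auto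
  have "\<sigma>1 r \<in> Fib (f r)" using s1 r lift_at_fib by blast
  then obtain \<sigma>2 where s2: "\<forall>y\<in>K2. lift_at f K2 \<sigma>2 y" "\<sigma>2 r = \<sigma>1 r"
    using t(2) r unfolding liftable_def by blast
  have eq: "\<sigma>1 y = \<sigma>2 y" if "y \<in> K1 \<inter> K2" for y
  proof -
    have c12: "continuous_on (K1 \<inter> K2) f" by (rule continuous_on_subset[OF cont]) auto
    have l1: "\<forall>y\<in>K1 \<inter> K2. lift_at f (K1 \<inter> K2) \<sigma>1 y" using s1 lift_at_mono by blast
    have l2: "\<forall>y\<in>K1 \<inter> K2. lift_at f (K1 \<inter> K2) \<sigma>2 y" using s2 lift_at_mono by blast
    show ?thesis using lift_unique[OF con(1) c12 l1 l2 _ _ that, of r] r s2 by simp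
  qed
  define \<sigma> where "\<sigma> y = (if y \<in> K1 then \<sigma>1 y else \<sigma>2 y)" for y
  have sK1: "\<sigma> y = \<sigma>1 y" if "y \<in> K1" for y using that by (simp add: \<sigma>_def)
  have sK2: "\<sigma> y = \<sigma>2 y" if "y \<in> K2" for y using that eq by (simp add: \<sigma>_def)
  have "lift_at f (K1 \<union> K2) \<sigma> y" if y: "y \<in> K1 \<union> K2" for y
  proof -
    consider "y \<in> K1 \<inter> K2" | "y \<in> K1 - K2" | "y \<in> K2 - K1" using y by blast
    then show ?thesis
    proof cases
      case 1
      obtain N V s where *: "open N" "y \<in> N" "flat V s" "f y \<in> V"
        "\<forall>y'\<in>N \<inter> K1. f y' \<in> V \<and> \<sigma>1 y' = s (f y')"
        by (rule lift_atE[OF bspec[OF s1(1)]]) (use 1 in auto)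
      obtain N' V' s' where **: "open N'" "y \<in> N'" "flat V' s'" "f y \<in> V'"
        "\<forall>y'\<in>N' \<inter> K2. f y' \<in> V' \<and> \<sigma>2 y' = s' (f y')"
        by (rule lift_atE[OF bspec[OF s2(1)]]) (use 1 in auto)
      obtain S where S: "open S" "f y \<in> S" "(\<forall>y\<in>S. s y = s' y) \<or> (\<forall>y\<in>S. s y \<noteq> s' y)"
        using flat_sep[OF *(3) **(3) *(4) **(4)] by (elim exE conjE) (rule that)
      \<comment> \<open>The two pieces may use different flat sections here. Since these agree at f
        y, they coincide on S, so that s serves for both.\<close>
      have "s (f y) = s' (f y)" using * ** 1 eq[of y] by auto
      with S have S': "\<forall>y\<in>S. s y = s' y" by blast
      have oV: "open (S \<inter> V)" using S flat_open * by blast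
      obtain M where M: "open M" "M \<inter> (K1 \<union> K2) = f -` (S \<inter> V) \<inter> (K1 \<union> K2)"
        using cont oV continuous_on_open_invariant by metis
      have MM: "f y' \<in> S \<inter> V" if "y' \<in> M" "y' \<in> K1 \<union> K2" for y' using M(2) that by blast
      have "f y \<in> S \<inter> V" using * S by blast
      then have yM: "y \<in> M" using M(2) y by blast
      show ?thesis unfolding lift_at_def
      proof (intro exI conjI ballI)
        show "open (N \<inter> N' \<inter> M)" using * ** M by blast
        show "y \<in> N \<inter> N' \<inter> M" using * ** yM by blast
        show "flat V s" "f y \<in> V" using * by blast+
        fix y' assume y': "y' \<in> N \<inter> N' \<inter> M \<inter> (K1 \<union> K2)"
        then have m: "f y' \<in> S \<inter> V" using MM by blast
        then show "f y' \<in> V" by blast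
        show "\<sigma> y' = s (f y')"
        proof (cases "y' \<in> K1")
          case True then show ?thesis using sK1 *(5) y' by simp
        next
          case False
          then have "y' \<in> K2" using y' by blast
          then show ?thesis using sK2 **(5) y' S' m by simp
        qed
      qed
    next
      case 2
      obtain N V s where *: "open N" "y \<in> N" "flat V s" "f y \<in> V"
        "\<forall>y'\<in>N \<inter> K1. f y' \<in> V \<and> \<sigma>1 y' = s (f y')"
        by (rule lift_atE[OF bspec[OF s1(1)]]) (use 2 in auto)
      then show ?thesis unfolding lift_at_def
        using 2 cl sK1 by (intro exI[of _ "N - K2"] exI[of _ V] exI[of _ s]) auto
    next
      case 3
      obtain N V s where *: "open N" "y \<in> N" "flat V s" "f y \<in> V"
        "\<forall>y'\<in>N \<inter> K2. f y' \<in> V \<and> \<sigma>2 y' = s (f y')"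
        by (rule lift_atE[OF bspec[OF s2(1)]]) (use 3 in auto)
      then show ?thesis unfolding lift_at_def
        using 3 cl sK2 by (intro exI[of _ "N - K1"] exI[of _ V] exI[of _ s]) auto
    qed
  qed
  moreover have "\<sigma> q = v" using s1 q sK1 by auto
  ultimately show ?thesis by blast
qed

lemma liftable_Un:
  assumes "liftable f K1" "liftable f K2" "closed K1" "closed K2"
    "continuous_on (K1 \<union> K2) f" "connected (K1 \<inter> K2)" "K1 \<inter> K2 \<noteq> {}"
  shows "liftable f (K1 \<union> K2)"
  unfolding liftable_def
proof (intro ballI)
  fix q v assume "q \<in> K1 \<union> K2" "v \<in> Fib (f q)"
  then show "\<exists>\<sigma>. (\<forall>y\<in>K1 \<union> K2. lift_at f (K1 \<union> K2) \<sigma> y) \<and> \<sigma> q = v"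
    using liftable_Un_aux[of f K1 K2 q v] liftable_Un_aux[of f K2 K1 q v] assms
    by (auto simp: Un_commute Int_commute)
qed

lemma liftable_local:
  assumes "continuous_on K f" "y \<in> K"
  shows "\<exists>M. open M \<and> y \<in> M \<and> liftable f (M \<inter> K)"
proof -
  obtain V where V: "open V" "f y \<in> V" "\<forall>q\<in>V. \<forall>v\<in>Fib q. \<exists>s. flat V s \<and> s q = v"
    using flat_ex by blast
  obtain M where M: "open M" "M \<inter> K = f -` V \<inter> K"
    using assms(1) V(1) continuous_on_open_invariant by metis
  have MV: "f ` (M \<inter> K) \<subseteq> V" using M(2) by blast
  have "liftable f (M \<inter> K)" unfolding liftable_def
  proof (intro ballI)
    fix q v assume q: "q \<in> M \<inter> K" "v \<in> Fib (f q)"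
    then obtain s where s: "flat V s" "s (f q) = v" using V(3) MV by blast
    have "continuous_on (M \<inter> K) f" using assms(1) continuous_on_subset by blast
    then show "\<exists>\<sigma>. (\<forall>y\<in>M \<inter> K. lift_at f (M \<inter> K) \<sigma> y) \<and> \<sigma> q = v"
      using s MV by (intro exI[of _ "\<lambda>y. s (f y)"]) (auto intro!: lift_at_section)
  qed
  moreover have "y \<in> M" using M(2) V(2) assms(2) by blast
  ultimately show ?thesis using M(1) by blast
qed

text \<open>Bisection twice: in the second coordinate, to lift over a thin strip around each s, then
  in the first coordinate, to join the strips. Adjacent rectangles meet in a segment, which is
  connected, so \<open>liftable_Un\<close> applies each time.\<close>

lemma liftable_square:
  fixes f :: "real \<times> real \<Rightarrow> 'x"
  assumes c: "continuous_on ({0..1} \<times> {0..1}) f"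
  shows "liftable f ({0..1} \<times> {0..1})"
proof -
  let ?Q = "{0..1::real} \<times> {0..1::real}"
  have strip: "\<exists>e>0. liftable f (({s-e..s+e} \<times> {0..1}) \<inter> ?Q)" if s: "0 \<le> s" "s \<le> 1" for s
  proof -
    have "0 \<le> (0::real) \<and> (1::real) \<le> 1 \<longrightarrow> (\<exists>e>0. liftable f (({s-e..s+e} \<times> {0..1}) \<inter> ?Q))"
    proof (rule Bolzano[where P = "\<lambda>a b. 0 \<le> a \<and> b \<le> 1 \<longrightarrow>
          (\<exists>e>0. liftable f (({s-e..s+e} \<times> {a..b}) \<inter> ?Q))"])
      fix a b d :: real
      assume *: "0 \<le> a \<and> b \<le> 1 \<longrightarrow> (\<exists>e>0. liftable f (({s-e..s+e} \<times> {a..b}) \<inter> ?Q))"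
        "0 \<le> b \<and> d \<le> 1 \<longrightarrow> (\<exists>e>0. liftable f (({s-e..s+e} \<times> {b..d}) \<inter> ?Q))"
        "a \<le> b" "b \<le> d"
      show "0 \<le> a \<and> d \<le> 1 \<longrightarrow> (\<exists>e>0. liftable f (({s-e..s+e} \<times> {a..d}) \<inter> ?Q))"
      proof
        assume a: "0 \<le> a \<and> d \<le> 1"
        then obtain e1 e2 where e: "e1 > 0" "e2 > 0"
          "liftable f (({s-e1..s+e1} \<times> {a..b}) \<inter> ?Q)" "liftable f (({s-e2..s+e2} \<times> {b..d}) \<inter> ?Q)"
          using * by auto
        define e where "e = min e1 e2"
        let ?A = "({s-e..s+e} \<times> {a..b}) \<inter> ?Q" and ?B = "({s-e..s+e} \<times> {b..d}) \<inter> ?Q"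
        have u: "?A \<union> ?B = ({s-e..s+e} \<times> {a..d}) \<inter> ?Q" using * by auto
        have i: "?A \<inter> ?B = (({s-e..s+e} \<inter> {0..1}) \<times> {b})" using * a by auto
        have "liftable f (?A \<union> ?B)"
        proof (rule liftable_Un)
          show "liftable f ?A" by (rule liftable_mono[OF e(3)]) (auto simp: e_def)
          show "liftable f ?B" by (rule liftable_mono[OF e(4)]) (auto simp: e_def)
          show "closed ?A" "closed ?B" by (intro closed_Int closed_Times closed_atLeastAtMost)+
          show "continuous_on (?A \<union> ?B) f" using c by (rule continuous_on_subset) auto
          show "connected (?A \<inter> ?B)" unfolding i
            by (intro convex_connected convex_Times convex_Int) auto
          have "(s, b) \<in> ?A \<inter> ?B" unfolding i using s e by (auto simp: e_def)
          then show "?A \<inter> ?B \<noteq> {}" by blast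
        qed
        then have "liftable f (({s-e..s+e} \<times> {a..d}) \<inter> ?Q)" using u by simp
        moreover have "e > 0" using e by (auto simp: e_def)
        ultimately show "\<exists>e>0. liftable f (({s-e..s+e} \<times> {a..d}) \<inter> ?Q)" by blast
      qed
    next
      fix x :: real assume x: "0 \<le> x" "x \<le> 1"
      obtain M where M: "open M" "(s, x) \<in> M" "liftable f (M \<inter> ?Q)"
        using liftable_local[OF c, of "(s, x)"] x s by auto
      obtain A B where AB: "open A" "open B" "(s, x) \<in> A \<times> B" "A \<times> B \<subseteq> M"
        by (rule open_prod_elim[OF M(1,2)])
      obtain e where e: "e > 0" "\<forall>y. dist y s < e \<longrightarrow> y \<in> A"
        using AB(1,3) unfolding open_dist by auto
      obtain d where d: "d > 0" "\<forall>y. dist y x < d \<longrightarrow> y \<in> B"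
        using AB(2,3) unfolding open_dist by auto
      have "liftable f (({s-e/2..s+e/2} \<times> {a..b}) \<inter> ?Q)" if "a \<le> x" "x \<le> b" "b - a < d" for a b
      proof (rule liftable_mono[OF M(3)])
        have "{s-e/2..s+e/2} \<subseteq> A" using e by (auto simp: dist_real_def)
        moreover have "{a..b} \<subseteq> B" using d that by (auto simp: dist_real_def)
        ultimately show "{s-e/2..s+e/2} \<times> {a..b} \<inter> ?Q \<subseteq> M \<inter> ?Q" using AB(4) by blast
      qed
      moreover have "e/2 > 0" using e by simp
      ultimately show "\<exists>d>0. \<forall>a b. a \<le> x \<and> x \<le> b \<and> b - a < d \<longrightarrow> (0 \<le> a \<and> b \<le> 1 \<longrightarrow>
          (\<exists>e>0. liftable f (({s-e..s+e} \<times> {a..b}) \<inter> ?Q)))"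
        using d(1) by blast
    qed auto
    then show ?thesis by simp
  qed
  have "0 \<le> (0::real) \<and> (1::real) \<le> 1 \<longrightarrow> liftable f ({0..1} \<times> {0..1})"
  proof (rule Bolzano[where P = "\<lambda>a b. 0 \<le> a \<and> b \<le> 1 \<longrightarrow> liftable f ({a..b} \<times> {0..1})"])
    fix a b d :: real
    assume *: "0 \<le> a \<and> b \<le> 1 \<longrightarrow> liftable f ({a..b} \<times> {0..1})"
      "0 \<le> b \<and> d \<le> 1 \<longrightarrow> liftable f ({b..d} \<times> {0..1})" "a \<le> b" "b \<le> d"
    show "0 \<le> a \<and> d \<le> 1 \<longrightarrow> liftable f ({a..d} \<times> {0..1})"
    proof
      assume a: "0 \<le> a \<and> d \<le> 1"
      let ?A = "{a..b} \<times> {0..1::real}" and ?B = "{b..d} \<times> {0..1::real}"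
      have u: "?A \<union> ?B = {a..d} \<times> {0..1}" using * by auto
      have i: "?A \<inter> ?B = {b} \<times> {0..1}" using * a by auto
      have "liftable f (?A \<union> ?B)"
      proof (rule liftable_Un)
        show "closed ?A" "closed ?B" by (intro closed_Times closed_atLeastAtMost)+
        show "continuous_on (?A \<union> ?B) f" using c by (rule continuous_on_subset) (use a * in auto)
        show "connected (?A \<inter> ?B)" unfolding i by (intro convex_connected convex_Times) auto
        show "?A \<inter> ?B \<noteq> {}" unfolding i by simp
      qed (use a * in auto)
      then show "liftable f ({a..d} \<times> {0..1})" using u by simp
    qed
  next
    fix x :: real assume x: "0 \<le> x" "x \<le> 1"
    obtain e where e: "e > 0" "liftable f (({x-e..x+e} \<times> {0..1}) \<inter> ?Q)" using strip x by blast
    have "liftable f ({a..b} \<times> {0..1})" if "a \<le> x" "x \<le> b" "b - a < e" "0 \<le> a" "b \<le> 1" for a b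
      by (rule liftable_mono[OF e(2)]) (use that in auto)
    then show "\<exists>d>0. \<forall>a b. a \<le> x \<and> x \<le> b \<and> b - a < d \<longrightarrow>
        (0 \<le> a \<and> b \<le> 1 \<longrightarrow> liftable f ({a..b} \<times> {0..1}))"
      using e(1) by blast
  qed auto
  then show ?thesis by simp
qed

text \<open>An interval is an edge of the square, over which f extends as a constant
  homotopy.\<close>

lemma liftable_interval:
  fixes f :: "real \<Rightarrow> 'x"
  assumes c: "continuous_on {0..1} f"
  shows "liftable f {0..1}"
  unfolding liftable_def
proof (intro ballI)
  fix q v assume q: "q \<in> {0..1}" "v \<in> Fib (f q)"
  let ?Q = "{0..1::real} \<times> {0..1::real}"
  have "continuous_on ?Q (\<lambda>y. f (snd y))"
    by (rule continuous_on_compose2[OF c]) (auto intro!: continuous_intros)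
  from bspec[OF liftable_square[OF this, unfolded liftable_def], of "(0, q)"] q
  obtain \<sigma> where \<sigma>: "\<forall>y\<in>?Q. lift_at (\<lambda>y. f (snd y)) ?Q \<sigma> y" "\<sigma> (0, q) = v" by auto
  have "lift_at (\<lambda>u. f (snd (0::real, u))) {0..1} (\<lambda>u. \<sigma> (0, u)) u" if u: "u \<in> {0..1}" for u
  proof (rule lift_at_compose[where K = ?Q])
    show "lift_at (\<lambda>y. f (snd y)) ?Q \<sigma> (0, u)" by (rule bspec[OF \<sigma>(1)]) (use u in simp)
  qed (use u in \<open>auto intro!: continuous_intros\<close>)
  then show "\<exists>\<sigma>. (\<forall>y\<in>{0..1}. lift_at f {0..1} \<sigma> y) \<and> \<sigma> q = v"
    using \<sigma>(2) by (intro exI[of _ "\<lambda>u. \<sigma> (0, u)"]) simp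
qed

section \<open>Lifts along paths, and monodromy on simply connected spaces\<close>

abbreviation path_lift :: "(real \<Rightarrow> 'x) \<Rightarrow> (real \<Rightarrow> 'v) \<Rightarrow> bool" where
  "path_lift c L \<equiv> \<forall>u\<in>{0..1}. lift_at c {0..1} L u"

lemma path_lift_cong:
  assumes "path_lift c L" "\<forall>u\<in>{0..1}. c u = c' u"
  shows "path_lift c' L"
  using assms unfolding lift_at_def by (metis (no_types, lifting) Int_iff)

lemma path_lift_compose:
  assumes "\<forall>y\<in>K. lift_at f K \<sigma> y" "continuous_on {0..1} g" "g ` {0..1} \<subseteq> K"
  shows "path_lift (\<lambda>u. f (g u)) (\<lambda>u. \<sigma> (g u))"
proof
  fix u :: real assume "u \<in> {0..1}"
  then have "lift_at f K \<sigma> (g u)" using assms(1,3) by blast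
  from lift_at_compose[OF this assms(2,3) \<open>u \<in> {0..1}\<close>]
  show "lift_at (\<lambda>u. f (g u)) {0..1} (\<lambda>u. \<sigma> (g u)) u" .
qed

lemma path_lift_unique:
  assumes "path c" "path_lift c L" "path_lift c M" "L a = M a" "a \<in> {0..1}" "b \<in> {0..1}"
  shows "L b = M b"
  using lift_unique[of "{0..1}" c L M a b] assms by (simp add: path_def)

lemma path_lift_join1:
  assumes "path_lift (c +++ d) L" "path_lift c L1" "L 0 = L1 0" "path c"
  shows "L (1/2) = L1 1"
proof -
  have "path_lift (\<lambda>u. (c +++ d) (u/2)) (\<lambda>u. L (u/2))"
    by (rule path_lift_compose[OF assms(1)]) (auto intro!: continuous_intros)
  then have "path_lift c (\<lambda>u. L (u/2))" by (rule path_lift_cong) (auto simp: joinpaths_def)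
  from path_lift_unique[OF assms(4) this assms(2), of 0 1] show ?thesis using assms(3) by simp
qed

lemma path_lift_second_half:
  assumes "path_lift (c +++ d) L" "c 1 = d 0"
  shows "path_lift d (\<lambda>u. L ((1 + u)/2))"
proof -
  have "path_lift (\<lambda>u. (c +++ d) ((1 + u)/2)) (\<lambda>u. L ((1 + u)/2))"
    by (rule path_lift_compose[OF assms(1)]) (auto intro!: continuous_intros)
  then show ?thesis by (rule path_lift_cong) (use assms(2) in \<open>auto simp: joinpaths_def field_simps\<close>)
qed

lemma path_lift_join2:
  assumes "path_lift (c +++ d) L" "path_lift d L2" "L (1/2) = L2 0" "path d" "c 1 = d 0"
  shows "L 1 = L2 1"
  using path_lift_unique[OF assms(4) path_lift_second_half[OF assms(1,5)] assms(2), of 0 1] assms(3)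
  by simp

text \<open>The whole null-homotopy is lifted. Its far edge is constant, so the lift is constant
  there. The two lateral edges are the same path, because the homotopy runs through loops; their
  lifts agree at the far end, hence also at the near end.\<close>

lemma loop_lift_closed:
  assumes h: "homotopic_loops UNIV f (\<lambda>_. a)" and L: "path_lift f L"
  shows "L 1 = L 0"
proof -
  obtain h where h: "continuous_on ({0..1} \<times> {0..1}) h" "\<forall>x\<in>{0..1::real}. h (0::real, x) = f x"
      "\<forall>x\<in>{0..1::real}. h (1, x) = a"
      "\<forall>t\<in>{0..1::real}. pathfinish (h \<circ> Pair t) = pathstart (h \<circ> Pair t)"
    using assms(1) unfolding homotopic_loops by auto
  have h01: "h (t, 1) = h (t, 0)" if "t \<in> {0..1}" for t
    using h(4) that by (auto simp: pathfinish_def pathstart_def)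
  have "L 0 \<in> Fib (h (0, 0))" using lift_at_fib[OF bspec[OF L, of 0]] h(2) by simp
  then obtain \<sigma> where \<sigma>: "\<forall>y\<in>{0..1} \<times> {0..1}. lift_at h ({0..1} \<times> {0..1}) \<sigma> y" "\<sigma> (0, 0) = L 0"
    using bspec[OF liftable_square[OF h(1), unfolded liftable_def], of "(0, 0)"] by auto
  note comp = path_lift_compose[OF \<sigma>(1)]
  have l0: "path_lift (\<lambda>u. h (0, u)) (\<lambda>u. \<sigma> (0, u))"
    by (rule comp) (auto intro!: continuous_intros)
  have l1: "path_lift (\<lambda>u. h (1, u)) (\<lambda>u. \<sigma> (1, u))"
    by (rule comp) (auto intro!: continuous_intros)
  have r0: "path_lift (\<lambda>u. h (u, 0)) (\<lambda>u. \<sigma> (u, 0))"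
    by (rule comp) (auto intro!: continuous_intros)
  have r1: "path_lift (\<lambda>u. h (u, 1)) (\<lambda>u. \<sigma> (u, 1))"
    by (rule comp) (auto intro!: continuous_intros)
  \<comment> \<open>The constant lift over the constant far edge; by uniqueness
    \<open>\<sigma> (1, u)\<close> must equal it.\<close>
  have k: "path_lift (\<lambda>u. h (1, 0)) (\<lambda>u. \<sigma> (1, 0))"
    by (rule comp) (auto intro!: continuous_intros)
  have p: "path (\<lambda>u. h (g u))"
    if "continuous_on {0..1} g" "g ` {0..1} \<subseteq> {0..1} \<times> {0..1}" for g :: "real \<Rightarrow> real \<times> real"
    using continuous_on_compose2[OF h(1) that] unfolding path_def .
  have p0: "path (\<lambda>u. h (0, u))" by (rule p) (auto intro!: continuous_intros)
  have p1: "path (\<lambda>u. h (1, u))" by (rule p) (auto intro!: continuous_intros)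
  have q0: "path (\<lambda>u. h (u, 0))" by (rule p) (auto intro!: continuous_intros)
  have L': "path_lift (\<lambda>u. h (0, u)) L" by (rule path_lift_cong[OF L]) (use h(2) in auto)
  have k': "path_lift (\<lambda>u. h (1, u)) (\<lambda>u. \<sigma> (1, 0))" by (rule path_lift_cong[OF k]) (use h(3) in auto)
  have r1': "path_lift (\<lambda>u. h (u, 0)) (\<lambda>u. \<sigma> (u, 1))" by (rule path_lift_cong[OF r1]) (use h01 in auto)
  have "\<sigma> (0, 1) = L 1" using path_lift_unique[OF p0 l0 L', of 0 1] \<sigma>(2) by simp
  moreover have top: "\<sigma> (1, 1) = \<sigma> (1, 0)" using path_lift_unique[OF p1 l1 k', of 0 1] by simp
  moreover have "\<sigma> (0, 1) = \<sigma> (0, 0)" using path_lift_unique[OF q0 r1' r0, of 1 0] top by simp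
  ultimately show ?thesis using \<sigma>(2) by simp
qed

text \<open>All loops are freely homotopic, constant loops included; a homotopy between two constant
  loops traces a path between their points.\<close>

lemma simply_connected_paths:
  assumes "simply_connected (UNIV :: 'x set)"
  shows "\<exists>c. path c \<and> c 0 = a \<and> c 1 = (b :: 'x)"
proof -
  have "homotopic_loops UNIV (\<lambda>_. a) (\<lambda>_. b)"
    using assms unfolding simply_connected_def by (auto simp: path_def pathfinish_def pathstart_def)
  then obtain h where h: "continuous_on ({0..1} \<times> {0..1}) h" "\<forall>x\<in>{0..1::real}. h (0::real, x) = a"
    "\<forall>x\<in>{0..1::real}. h (1, x) = b" unfolding homotopic_loops by auto
  have "continuous_on {0..1} (\<lambda>u. h (u, 0))"
    by (rule continuous_on_compose2[OF h(1)]) (auto intro!: continuous_intros)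
  then show ?thesis using h by (intro exI[of _ "\<lambda>u. h (u, 0)"]) (auto simp: path_def)
qed

lemma global_section_unique:
  assumes sc: "simply_connected (UNIV :: 'x set)" and s: "flat UNIV s" "flat UNIV s'" "s x0 = s' x0"
  shows "s x = s' x"
proof -
  obtain c where c: "path c" "c 0 = x0" "c 1 = x" using simply_connected_paths[OF sc] by blast
  have "path_lift c (\<lambda>u. s (c u))" "path_lift c (\<lambda>u. s' (c u))"
    using c(1) s by (auto simp: path_def intro!: lift_at_section)
  from path_lift_unique[OF c(1) this, of 0 1] show ?thesis using c s by simp
qed

text \<open>The value at x is the end value of the lift along any path from \<open>x0\<close> to x.
  Two such paths form a loop, whose lift closes up, so the choice does not matter.\<close>

theorem global_section:
  assumes sc: "simply_connected (UNIV :: 'x set)" and v: "v \<in> Fib x0"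
  shows "\<exists>s. s x0 = v \<and> (\<forall>x. \<exists>V s'. x \<in> V \<and> flat V s' \<and> (\<forall>y\<in>V. s y = s' y))"
proof -
  have loops: "homotopic_loops UNIV f (\<lambda>_. a)" if "path f" "pathfinish f = pathstart f" for f and a :: 'x
    using sc that unfolding simply_connected_def
    by (auto simp: path_def pathfinish_def pathstart_def)
  note pc = simply_connected_paths[OF sc]
  have lift: "\<exists>L. path_lift c L \<and> L 0 = v" if "path c" "c 0 = x0" for c
    using liftable_interval[of c] that v unfolding liftable_def path_def by auto
  have indep: "L 1 = L' 1"
    if c: "path c" "c 0 = x0" "path_lift c L" "L 0 = v"
      and c': "path c'" "c' 0 = x0" "path_lift c' L'" "L' 0 = v" and eq: "c 1 = c' 1"
    for c c' L L'
  proof -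
    \<comment> \<open>The lift M of this loop returns to v. Its first half ends in L 1; its second
      half, run backwards, is a lift of c' from M 1 = v to M (1/2).\<close>
    let ?l = "c +++ reversepath c'"
    have p: "path ?l" using c(1) c'(1) eq
      by (intro path_join_imp path_reversepath[THEN iffD2])
         (simp_all add: pathfinish_def pathstart_def reversepath_def)
    have l: "pathfinish ?l = pathstart ?l" using c(2) c'(2) by (simp add: pathfinish_def pathstart_def joinpaths_def reversepath_def)
    have l0: "?l 0 = x0" using c by (simp add: joinpaths_def)
    obtain M where M: "path_lift ?l M" "M 0 = v"
      using lift[OF p l0] by blast
    have M1: "M 1 = M 0" by (rule loop_lift_closed[OF loops[OF p l] M(1)])
    have m: "M (1/2) = L 1" using path_lift_join1[OF M(1) c(3)] M c by simp
    have "c 1 = reversepath c' 0" using eq by (simp add: reversepath_def)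
    from path_lift_second_half[OF M(1) this]
    have "path_lift (\<lambda>u. reversepath c' (1 - u)) (\<lambda>u. M ((1 + (1 - u))/2))"
      by (rule path_lift_compose) (auto intro!: continuous_intros)
    then have "path_lift c' (\<lambda>u. M ((1 + (1 - u))/2))"
      by (rule path_lift_cong) (auto simp: reversepath_def)
    from path_lift_unique[OF c'(1) this c'(3), of 0 1] show ?thesis using m M M1 c' by simp
  qed
  define R where "R x w \<longleftrightarrow> (\<exists>c L. path c \<and> c 0 = x0 \<and> c 1 = x \<and>
      path_lift c L \<and> L 0 = v \<and> L 1 = w)" for x w
  have R_ex: "\<exists>w. R x w" for x using pc[of x0 x] lift unfolding R_def by blast
  have R_un: "w = w'" if "R x w" "R x w'" for x w w'
    using that indep unfolding R_def by blast
  define s where "s x = (SOME w. R x w)" for x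
  have sR: "R x (s x)" for x unfolding s_def using R_ex someI_ex by metis
  have s_eq: "s x = w" if "R x w" for x w using R_un sR that by blast
  have "s x0 = v"
  proof (rule s_eq)
    have p: "path (\<lambda>_. x0)" by (simp add: path_def)
    obtain L where L: "path_lift (\<lambda>_. x0) L" "L 0 = v"
      using lift[OF p] by auto
    have "path_lift (\<lambda>_. x0) (\<lambda>_. L 0)"
      by (rule path_lift_compose[OF L(1), of "\<lambda>_. 0"]) auto
    then show "R x0 v" unfolding R_def
      by (intro exI[of _ "\<lambda>_. x0"] exI[of _ "\<lambda>_. L 0"]) (use L p in auto)
  qed
  moreover have "\<exists>V s'. x \<in> V \<and> flat V s' \<and> (\<forall>y\<in>V. s y = s' y)" for x
  proof -
    obtain c L where c: "path c" "c 0 = x0" "c 1 = x" "path_lift c L"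
      "L 0 = v" "L 1 = s x" using sR[of x] unfolding R_def by blast
    have fx: "s x \<in> Fib x" using lift_at_fib[of c "{0..1}" L 1] c by auto
    \<comment> \<open>Flatness near x: a fixed path to x is prolonged inside V, and along the
      prolongation the lift is given by s'. Path connectedness of V reaches every point of V in this
      way.\<close>
    obtain V where V: "open V" "x \<in> V" "path_connected V" "\<forall>q\<in>V. \<forall>v\<in>Fib q. \<exists>s. flat V s \<and> s q = v"
      using flat_ex by blast
    then obtain s' where s': "flat V s'" "s' x = s x" using fx by blast
    have "s y = s' y" if y: "y \<in> V" for y
    proof (rule s_eq)
      obtain d where d: "path d" "path_image d \<subseteq> V" "d 0 = x" "d 1 = y"
        using V(2,3) y unfolding path_connected_def pathstart_def pathfinish_def by blast
      have p: "path (c +++ d)" using c d by (simp add: pathfinish_def pathstart_def)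
      have p0: "(c +++ d) 0 = x0" using c by (simp add: joinpaths_def)
      obtain M where M: "path_lift (c +++ d) M" "M 0 = v"
        using lift[OF p p0] by blast
      have m: "M (1/2) = s x" using path_lift_join1[OF M(1) c(4)] M c by simp
      have ds: "path_lift d (\<lambda>u. s' (d u))"
        using d by (intro ballI lift_at_section[OF s'(1)]) (auto simp: path_def path_image_def)
      have "M 1 = s' y" using path_lift_join2[OF M(1) ds] m s' c d by simp
      then show "R y (s' y)" unfolding R_def
        by (intro exI[of _ "c +++ d"] exI[of _ M]) (use p p0 M c d in \<open>auto simp: joinpaths_def\<close>)
    qed
    then show ?thesis using V s' by blast
  qed
  ultimately show ?thesis by blast
qed

end

section \<open>Holomorphic linear differential equations\<close>

text \<open>Stated by components because \<open>has_field_derivative\<close> concerns functions with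
  values in the field.\<close>

definition linear_ode_on :: "(complex \<Rightarrow> complex^'n^'n) \<Rightarrow> complex set \<Rightarrow> (complex \<Rightarrow> complex^'n::finite) \<Rightarrow> bool" where
  "linear_ode_on B S y \<longleftrightarrow>
     (\<forall>w\<in>S. \<forall>k. ((\<lambda>w. y w $ k) has_field_derivative (B w *v y w) $ k) (at w))"

lemma norm_vec_le_sum: "norm (x :: complex^'n::finite) \<le> (\<Sum>k\<in>UNIV. norm (x $ k))"
  unfolding norm_vec_def by (rule L2_set_le_sum) simp

lemma norm_mult_vec_le:
  fixes B :: "complex^'n^'n::finite"
  assumes "\<And>k l. norm (B $ k $ l) \<le> M"
  shows "norm ((B *v x) $ k) \<le> real CARD('n) * M * norm x"
proof -
  have "norm ((B *v x) $ k) \<le> (\<Sum>l\<in>UNIV. norm (B $ k $ l * x $ l))"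
    unfolding matrix_vector_mult_def by (simp add: norm_sum)
  also have "\<dots> \<le> (\<Sum>l\<in>(UNIV::'n set). M * norm x)"
    unfolding norm_mult by (intro sum_mono mult_mono assms Finite_Cartesian_Product.norm_nth_le)
      (use assms norm_ge_zero order_trans in \<open>blast+\<close>)
  finally show ?thesis by simp
qed

text \<open>The scalar estimate is applied to each component; \<open>CARD('n)\<close> comes from
  bounding the norm by the sum of the components.\<close>

lemma deriv_bound_vec:
  fixes y y' :: "complex \<Rightarrow> complex^'n::finite"
  assumes "convex S"
    and "\<And>w k. w \<in> S \<Longrightarrow> ((\<lambda>w. y w $ k) has_field_derivative y' w $ k) (at w within S)"
    and "\<And>w k. w \<in> S \<Longrightarrow> norm (y' w $ k) \<le> C"
    and "a \<in> S" "b \<in> S"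
  shows "norm (y b - y a) \<le> real CARD('n) * C * norm (b - a)"
proof -
  have "norm (y b - y a) \<le> (\<Sum>k\<in>UNIV. norm ((y b - y a) $ k))" by (rule norm_vec_le_sum)
  also have "\<dots> \<le> (\<Sum>k\<in>(UNIV::'n set). C * norm (b - a))"
  proof (rule sum_mono)
    fix k :: 'n
    show "norm ((y b - y a) $ k) \<le> C * norm (b - a)"
      using field_differentiable_bound[OF assms(1), of "\<lambda>w. y w $ k" "\<lambda>w. y' w $ k" C b a] assms
      by simp
  qed
  finally show ?thesis by simp
qed

lemma continuous_matrix_bounded:
  fixes B :: "complex \<Rightarrow> complex^'n^'n::finite"
  assumes K: "compact K" and B: "\<And>k l. continuous_on K (\<lambda>w. B w $ k $ l)"
  obtains M where "M > 0" "\<forall>w\<in>K. \<forall>k l. norm (B w $ k $ l) \<le> M"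
proof -
  define N where "N w = (\<Sum>k\<in>UNIV. \<Sum>l\<in>UNIV. norm (B w $ k $ l))" for w
  have "continuous_on K N" unfolding N_def by (intro continuous_intros B)
  then have "bounded (N ` K)" using K compact_continuous_image compact_imp_bounded by blast
  then obtain M where M: "M > 0" "\<And>w. w \<in> K \<Longrightarrow> norm (N w) \<le> M"
    unfolding bounded_pos by auto
  have "norm (B w $ k $ l) \<le> M" if "w \<in> K" for w k l
  proof -
    have "norm (B w $ k $ l) \<le> (\<Sum>l\<in>UNIV. norm (B w $ k $ l))" by (rule member_le_sum) auto
    also have "\<dots> \<le> N w" unfolding N_def
      by (rule member_le_sum[where f = "\<lambda>k. \<Sum>l\<in>UNIV. norm (B w $ k $ l)"]) (auto intro: sum_nonneg)
    finally show ?thesis using M(2)[OF that] by auto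
  qed
  then have "\<forall>w\<in>K. \<forall>k l. norm (B w $ k $ l) \<le> M" by blast
  with M(1) show thesis by (rule that)
qed

lemma linear_ode_continuous:
  assumes "linear_ode_on B S y" shows "continuous_on S y"
proof -
  have "continuous_on S (\<lambda>w. y w $ k)" for k
    using assms unfolding linear_ode_on_def
    by (meson DERIV_isCont continuous_at_imp_continuous_on)
  then have "continuous_on S (\<lambda>w. \<chi> k. y w $ k)" by (rule continuous_on_vec_lambda)
  then show ?thesis by simp
qed

text \<open>On a small disc the maximum of the norm of y is at most half of itself, because y is
  controlled by its derivative and the derivative by y.\<close>

lemma linear_ode_zero_local:
  fixes y :: "complex \<Rightarrow> complex^'n::finite" and B :: "complex \<Rightarrow> complex^'n^'n"
  assumes S: "open S" and B: "\<And>k l. continuous_on S (\<lambda>w. B w $ k $ l)"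
    and y: "linear_ode_on B S y" and w0: "w0 \<in> S" "y w0 = 0"
  shows "\<exists>r>0. ball w0 r \<subseteq> S \<and> (\<forall>w\<in>ball w0 r. y w = 0)"
proof -
  obtain R where R: "R > 0" "cball w0 R \<subseteq> S" using S w0(1) open_contains_cball by blast
  obtain M where M: "M > 0" and Bkl: "\<forall>w\<in>cball w0 R. \<forall>k l. norm (B w $ k $ l) \<le> M"
    by (rule continuous_matrix_bounded[OF compact_cball continuous_on_subset[OF B R(2)]])
  define n where "n = real CARD('n)"
  have n: "n > 0" by (simp add: n_def)
  \<comment> \<open>One factor n comes from \<open>norm_mult_vec_le\<close>, the other from
    \<open>deriv_bound_vec\<close>; r makes the resulting constant at most 1/2.\<close>
  define r where "r = min R (1 / (2 * n * n * M))"
  have r: "r > 0" "r \<le> R" "n * n * M * r \<le> 1/2"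
  proof -
    show "r > 0" using R(1) M n by (simp add: r_def)
    show "r \<le> R" by (simp add: r_def)
    have "n * n * M * r \<le> n * n * M * (1 / (2 * n * n * M))"
      using n M by (intro mult_left_mono) (auto simp: r_def)
    also have "\<dots> = 1/2" using n M by (simp add: field_simps)
    finally show "n * n * M * r \<le> 1/2" .
  qed
  have sub: "cball w0 r \<subseteq> S" "cball w0 r \<subseteq> cball w0 R" using R(2) r(2) by auto
  have yc: "continuous_on (cball w0 r) (\<lambda>w. norm (y w))"
    by (intro continuous_on_norm continuous_on_subset[OF linear_ode_continuous[OF y] sub(1)])
  obtain w1 where w1: "w1 \<in> cball w0 r" "\<And>w. w \<in> cball w0 r \<Longrightarrow> norm (y w) \<le> norm (y w1)"
    using continuous_attains_sup[OF compact_cball _ yc] r(1) by fastforce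
  have "norm (y w1 - y w0) \<le> n * (n * M * norm (y w1)) * norm (w1 - w0)" unfolding n_def
  proof (rule deriv_bound_vec[where S = "cball w0 r" and y' = "\<lambda>w. B w *v y w"])
    fix w k assume w: "w \<in> cball w0 r"
    show "((\<lambda>w. y w $ k) has_field_derivative (B w *v y w) $ k) (at w within cball w0 r)"
      using y w sub(1) unfolding linear_ode_on_def by (meson has_field_derivative_at_within subset_iff)
    have "norm ((B w *v y w) $ k) \<le> real CARD('n) * M * norm (y w)"
      by (rule norm_mult_vec_le) (use Bkl w sub in blast)
    also have "\<dots> \<le> real CARD('n) * M * norm (y w1)"
      using w1(2)[OF w] M by (intro mult_left_mono) auto
    finally show "norm ((B w *v y w) $ k) \<le> real CARD('n) * M * norm (y w1)" .
  qed (use w1 r in auto)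
  also have "\<dots> \<le> n * (n * M * norm (y w1)) * r"
    using w1(1) n M by (intro mult_left_mono) (auto simp: dist_norm norm_minus_commute)
  also have "\<dots> = (n * n * M * r) * norm (y w1)" by simp
  also have "\<dots> \<le> 1/2 * norm (y w1)" using r(3) by (intro mult_right_mono) auto
  finally have "norm (y w1) \<le> 0" using w0(2) by simp
  then have "\<forall>w\<in>ball w0 r. y w = 0" using w1(2) by (metis ball_subset_cball norm_le_zero_iff order_trans subsetD)
  then show ?thesis using r(1) sub(1) by (intro exI[of _ r]) auto
qed

lemma linear_ode_combination:
  assumes "linear_ode_on B S y" "linear_ode_on B S y'"
  shows "linear_ode_on B S (\<lambda>w. c *s y w + d *s y' w)"
  unfolding linear_ode_on_def
proof (intro ballI allI)
  fix w k assume "w \<in> S"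
  then have "((\<lambda>w. c * y w $ k + d * y' w $ k) has_field_derivative
      c * (B w *v y w) $ k + d * (B w *v y' w) $ k) (at w)"
    using assms unfolding linear_ode_on_def by (intro DERIV_add DERIV_cmult) auto
  then show "((\<lambda>w. (c *s y w + d *s y' w) $ k) has_field_derivative (B w *v (c *s y w + d *s y' w)) $ k) (at w)"
    by (simp add: matrix_vector_right_distrib vec.scale)
qed

text \<open>The zero set of the difference is open by the local lemma, its complement by continuity,
  and S is connected.\<close>

lemma linear_ode_unique:
  fixes y y' :: "complex \<Rightarrow> complex^'n::finite" and B :: "complex \<Rightarrow> complex^'n^'n"
  assumes S: "open S" "connected S" and B: "\<And>k l. continuous_on S (\<lambda>w. B w $ k $ l)"
    and y: "linear_ode_on B S y" "linear_ode_on B S y'" and w0: "w0 \<in> S" "y w0 = y' w0" and w: "w \<in> S"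
  shows "y w = y' w"
proof -
  define D where "D w = 1 *s y w + (-1) *s y' w" for w
  have D: "linear_ode_on B S D" unfolding D_def by (rule linear_ode_combination[OF y])
  have "D w = 0"
  proof (rule connected_induction_simple[OF S(2) w0(1) w, where P = "\<lambda>w. D w = 0"])
    show "D w0 = 0" using w0(2) by (simp add: D_def vec_eq_iff)
    fix a assume a: "a \<in> S"
    show "\<exists>T. openin (top_of_set S) T \<and> a \<in> T \<and> (\<forall>x\<in>T. \<forall>y\<in>T. D x = 0 \<longrightarrow> D y = 0)"
    proof (cases "D a = 0")
      case True
      obtain r where "r > 0" "ball a r \<subseteq> S" "\<forall>w\<in>ball a r. D w = 0"
        using linear_ode_zero_local[OF S(1) B D a True] by blast
      then show ?thesis by (intro exI[of _ "ball a r"]) (auto simp: openin_open_eq S(1))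
    next
      case False
      have "open (S \<inter> D -` (- {0}))"
        by (rule continuous_open_preimage[OF linear_ode_continuous[OF D] S(1)]) auto
      then show ?thesis using a False
        by (intro exI[of _ "S \<inter> D -` (- {0})"]) (auto simp: openin_open_eq S(1))
    qed
  qed
  then have "D w $ k = 0" for k by simp
  then show ?thesis by (simp add: D_def vec_eq_iff)
qed

text \<open>Picard iteration. Integration is available because holomorphic functions on a disc have
  primitives, and the initial point q may be any point of the disc, whence the diameter 2 r in the
  contraction condition.\<close>

lemma linear_ode_exists:
  fixes B :: "complex \<Rightarrow> complex^'n^'n::finite"
  assumes B: "\<And>k l. (\<lambda>w. B w $ k $ l) holomorphic_on ball w0 r"
    and M: "\<And>k l w. w \<in> ball w0 r \<Longrightarrow> norm (B w $ k $ l) \<le> M"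
    and Mr: "real CARD('n) * real CARD('n) * M * (2 * r) \<le> 1/2"
    and q: "q \<in> ball w0 r"
  shows "\<exists>y. linear_ode_on B (ball w0 r) y \<and> y q = v"
proof -
  let ?D = "ball w0 r"
  define n where "n = real CARD('n)"
  have n: "n > 0" by (simp add: n_def)
  have M0: "M \<ge> 0" using M[OF q] norm_ge_zero order_trans by blast
  have r0: "r > 0" using q by (auto intro: order.strict_trans1[OF zero_le_dist])
  define hol where "hol y \<longleftrightarrow> (\<forall>k. (\<lambda>w. y w $ k) holomorphic_on ?D)" for y :: "complex \<Rightarrow> complex^'n"
  \<comment> \<open>\<open>prim f g\<close> makes g the Picard image of f: the primitive of B f with
    value v at q.\<close>
  define prim where "prim f g \<longleftrightarrow> g q = v \<and>
      (\<forall>w\<in>?D. \<forall>k. ((\<lambda>w. g w $ k) has_field_derivative (B w *v f w) $ k) (at w))"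
    for f g :: "complex \<Rightarrow> complex^'n"
  have prim_ex: "\<exists>g. prim f g" if "hol f" for f
  proof -
    have h: "(\<lambda>w. (B w *v f w) $ k) holomorphic_on ?D" for k
      using that B unfolding hol_def matrix_vector_mult_def by (auto intro!: holomorphic_intros)
    have "\<exists>g. \<forall>x\<in>?D. (g has_field_derivative (B x *v f x) $ k) (at x)" for k
    proof (rule holomorphic_convex_primitive'[OF _ _ h[of k]])
      fix g assume "\<And>x. x \<in> ?D \<Longrightarrow> (g has_field_derivative (B x *v f x) $ k) (at x within ?D)"
      then show ?thesis using at_within_open[of _ ?D] by (intro exI[of _ g]) auto
    qed auto
    then obtain G where G: "\<And>k x. x \<in> ?D \<Longrightarrow> (G k has_field_derivative (B x *v f x) $ k) (at x)"
      by metis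
    have "prim f (\<lambda>w. \<chi> k. G k w - G k q + v $ k)"
      unfolding prim_def by (auto simp: vec_eq_iff intro!: derivative_eq_intros G)
    then show ?thesis by blast
  qed
  have prim_hol: "hol g" if "prim f g" for f g
    using that unfolding prim_def hol_def
    by (metis holomorphic_on_open[OF open_ball])
  have prim_diff: "norm (g w - g' w) \<le> C / 2"
    if "prim f g" "prim f' g'" "w \<in> ?D" "\<And>w. w \<in> ?D \<Longrightarrow> norm (f w - f' w) \<le> C" for f f' g g' w C
  proof -
    have C0: "C \<ge> 0" using that(4)[OF q] norm_ge_zero order_trans by blast
    have "norm ((g w - g' w) - (g q - g' q)) \<le> n * (n * M * C) * norm (w - q)" unfolding n_def
    proof (rule deriv_bound_vec[where S = ?D and y = "\<lambda>w. g w - g' w" and y' = "\<lambda>w. B w *v (f w - f' w)"])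
      fix w k assume w: "w \<in> ?D"
      have "((\<lambda>w. g w $ k - g' w $ k) has_field_derivative (B w *v f w) $ k - (B w *v f' w) $ k) (at w)"
        using that(1,2) w unfolding prim_def by (intro DERIV_diff) auto
      then show "((\<lambda>w. (g w - g' w) $ k) has_field_derivative (B w *v (f w - f' w)) $ k) (at w within ?D)"
        by (simp add: matrix_vector_mult_diff_distrib has_field_derivative_at_within)
      have "norm ((B w *v (f w - f' w)) $ k) \<le> real CARD('n) * M * norm (f w - f' w)"
        by (rule norm_mult_vec_le) (rule M[OF w])
      also have "\<dots> \<le> real CARD('n) * M * C" using that(4)[OF w] M0 by (intro mult_left_mono) auto
      finally show "norm ((B w *v (f w - f' w)) $ k) \<le> real CARD('n) * M * C" .
    qed (use q that in auto)
    also have "\<dots> \<le> n * (n * M * C) * (2 * r)"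
    proof (rule mult_left_mono)
      have "dist w q \<le> dist w w0 + dist w0 q" by (rule dist_triangle)
      then show "norm (w - q) \<le> 2 * r" using that(3) q by (simp add: dist_norm norm_minus_commute)
    qed (use n M0 C0 in auto)
    also have "\<dots> = (n * n * M * (2 * r)) * C" by simp
    also have "\<dots> \<le> 1/2 * C" using Mr C0 unfolding n_def by (intro mult_right_mono) auto
    finally show ?thesis using that(1,2) unfolding prim_def by simp
  qed
  define P where "P f = (SOME g. prim f g)" for f
  have P: "prim f (P f)" if "hol f" for f unfolding P_def using someI_ex[OF prim_ex[OF that]] .
  define y where "y m = (P ^^ m) (\<lambda>_. v)" for m
  have ySuc: "y (Suc m) = P (y m)" for m by (simp add: y_def)
  have yhol: "hol (y m)" for m
  proof (induction m)
    case 0 show ?case by (simp add: y_def hol_def)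
  next
    case (Suc m) then show ?case using P prim_hol ySuc by metis
  qed
  have yprim: "prim (y m) (y (Suc m))" for m using P[OF yhol] ySuc by metis
  \<comment> \<open>The constant v is the Picard image of 0, which gives the first increment the
    same contraction estimate as the later ones.\<close>
  have prim0: "prim (\<lambda>_. 0) (\<lambda>_. v)" by (simp add: prim_def)
  have step: "norm (y (Suc m) w - y m w) \<le> norm v * (1/2) ^ Suc m" if "w \<in> ?D" for m w
    using that
  proof (induction m arbitrary: w)
    case 0
    show ?case using prim_diff[OF yprim[of 0] prim0 0, of "norm v"] by (simp add: y_def)
  next
    case (Suc m)
    show ?case using prim_diff[OF yprim[of "Suc m"] yprim[of m] Suc(2) Suc(1)] by simp
  qed
  define L where "L w = v + (\<Sum>m. y (Suc m) w - y m w)" for w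
  have "uniform_limit ?D (\<lambda>m w. \<Sum>i<m. y (Suc i) w - y i w) (\<lambda>w. \<Sum>m. y (Suc m) w - y m w) sequentially"
    by (rule Weierstrass_m_test[where M = "\<lambda>m. norm v * (1/2) ^ Suc m"])
       (use step in \<open>auto intro!: summable_mult summable_geometric summable_Suc_iff[THEN iffD2]\<close>)
  then have "uniform_limit ?D (\<lambda>m w. v + (\<Sum>i<m. y (Suc i) w - y i w)) L sequentially"
    unfolding L_def by (intro uniform_limit_intros)
  moreover have "v + (\<Sum>i<m. y (Suc i) w - y i w) = y m w" for m w
    by (subst sum_lessThan_telescope) (simp add: y_def)
  ultimately have lim: "uniform_limit ?D y L sequentially" by simp
  have Lhol: "hol L" unfolding hol_def
  proof
    fix k
    have u: "uniform_limit ?D (\<lambda>m w. y m w $ k) (\<lambda>w. L w $ k) sequentially"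
      unfolding uniform_limit_iff
    proof (intro allI impI)
      fix e :: real assume "e > 0"
      then have "\<forall>\<^sub>F m in sequentially. \<forall>w\<in>?D. dist (y m w) (L w) < e"
        using lim unfolding uniform_limit_iff by blast
      then show "\<forall>\<^sub>F m in sequentially. \<forall>w\<in>?D. dist (y m w $ k) (L w $ k) < e"
        by eventually_elim (meson dist_vec_nth_le le_less_trans)
    qed
    show "(\<lambda>w. L w $ k) holomorphic_on ?D"
    proof (rule holomorphic_uniform_sequence[OF open_ball])
      show "(\<lambda>w. y m w $ k) holomorphic_on ?D" for m using yhol unfolding hol_def by blast
      fix x assume "x \<in> ?D"
      then obtain d where d: "d > 0" "cball x d \<subseteq> ?D" by (metis open_ball open_contains_cball)
      then show "\<exists>d>0. cball x d \<subseteq> ?D \<and> uniform_limit (cball x d) (\<lambda>m w. y m w $ k) (\<lambda>w. L w $ k) sequentially"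
        using uniform_limit_on_subset[OF u] by blast
    qed
  qed
  define Z where "Z = P L"
  have Z: "prim L Z" unfolding Z_def by (rule P[OF Lhol])
  \<comment> \<open>Z is the Picard image of the limit L. As the iterates converge uniformly to L,
    their Picard images, which are again iterates, converge to Z; so L is a fixed point.\<close>
  have "L w = Z w" if w: "w \<in> ?D" for w
  proof -
    have "norm (L w - Z w) \<le> e" if e: "e > 0" for e
    proof -
      have "\<forall>\<^sub>F m in sequentially. \<forall>w\<in>?D. dist (y m w) (L w) < e/2"
        using lim e unfolding uniform_limit_iff by (meson half_gt_zero)
      then obtain m0 where m0: "\<And>m w. m \<ge> m0 \<Longrightarrow> w \<in> ?D \<Longrightarrow> dist (y m w) (L w) < e/2"
        unfolding eventually_sequentially by blast
      have "norm (y (Suc m0) w - Z w) \<le> (e/2) / 2"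
        by (rule prim_diff[OF yprim Z w]) (use m0[of m0] in \<open>auto simp: dist_norm less_imp_le\<close>)
      moreover have "norm (L w - y (Suc m0) w) < e/2"
        using m0[of "Suc m0" w] w by (simp add: dist_norm norm_minus_commute)
      moreover have "norm (L w - Z w) \<le> norm (L w - y (Suc m0) w) + norm (y (Suc m0) w - Z w)"
        using norm_triangle_ineq[of "L w - y (Suc m0) w" "y (Suc m0) w - Z w"] by simp
      ultimately show ?thesis using e by linarith
    qed
    then have "norm (L w - Z w) \<le> 0" by (rule field_le_epsilon) simp
    then show ?thesis by simp
  qed
  then have "linear_ode_on B ?D Z" using Z unfolding prim_def linear_ode_on_def
    by (auto simp: matrix_vector_mult_def)
  then show ?thesis using Z unfolding prim_def by blast
qed

section \<open>Pairs of Hermitian forms and the vector distance\<close>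

text \<open>Linearity is imposed in the first argument only; conjugate linearity in the second
  follows by Hermitian symmetry.\<close>

definition pd_form :: "(complex^'r::finite \<Rightarrow> complex^'r \<Rightarrow> complex) \<Rightarrow> bool" where
  "pd_form h \<longleftrightarrow> (\<forall>x y z. h (x + y) z = h x z + h y z) \<and> (\<forall>c x y. h (c *s x) y = c * h x y) \<and>
     (\<forall>x y. h y x = cnj (h x y)) \<and> (\<forall>x. x \<noteq> 0 \<longrightarrow> Re (h x x) > 0)"

lemma pd_form_sym: "pd_form h \<Longrightarrow> h y x = cnj (h x y)"
  unfolding pd_form_def by blast

lemma pd_form_pos: "pd_form h \<Longrightarrow> x \<noteq> 0 \<Longrightarrow> Re (h x x) > 0"
  unfolding pd_form_def by blast

lemma pd_form_simps:
  assumes "pd_form h"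
  shows "h (x + y) z = h x z + h y z" "h (c *s x) y = c * h x y"
    "h x (y + z) = h x y + h x z" "h x (c *s y) = cnj c * h x y" "h 0 x = 0" "h x 0 = 0"
proof -
  show 1: "h (x + y) z = h x z + h y z" "h (c *s x) y = c * h x y" for x y z c
    using assms unfolding pd_form_def by blast+
  note 2 = pd_form_sym[OF assms]
  show "h x (y + z) = h x y + h x z"
    unfolding 2[of x "y + z"] 2[of x y] 2[of x z] 1 by simp
  show "h x (c *s y) = cnj c * h x y"
    unfolding 2[of x "c *s y"] 2[of x y] 1 by simp
  show 3: "h 0 x = 0" for x using 1(2)[of 0 0 x] by simp
  show "h x 0 = 0" unfolding 2[of x 0] 3 by simp
qed

lemma pd_form_real: "pd_form h \<Longrightarrow> h x x = of_real (Re (h x x))"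
  using arg_cong[OF pd_form_sym[of h x x], of Im] by (simp add: complex_eq_iff)

lemma pd_form_nonneg: "pd_form h \<Longrightarrow> Re (h x x) \<ge> 0"
  using pd_form_pos[of h x] pd_form_simps(5)[of h x] by (cases "x = 0") (auto intro: less_imp_le)

lemma pd_form_sum:
  assumes "pd_form h" "finite K"
  shows "h (\<Sum>m\<in>K. f m) y = (\<Sum>m\<in>K. h (f m) y)" "h y (\<Sum>m\<in>K. f m) = (\<Sum>m\<in>K. h y (f m))"
  using assms(2) by (induction K rule: finite_induct) (auto simp: pd_form_simps[OF assms(1)])

lemma pd_form_sum2:
  assumes h: "pd_form h" and K: "finite K" and J: "finite J"
  shows "h (\<Sum>m\<in>K. c m *s e m) (\<Sum>n\<in>J. d n *s f n) = (\<Sum>m\<in>K. \<Sum>n\<in>J. c m * (cnj (d n) * h (e m) (f n)))"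
  unfolding pd_form_sum(1)[OF h K]
  by (rule sum.cong[OF refl])
     (simp add: pd_form_simps(2)[OF h] pd_form_sum(2)[OF h J] pd_form_simps(4)[OF h] sum_distrib_left mult.left_commute)

lemma pd_form_continuous:
  assumes h: "pd_form h"
  shows "continuous_on UNIV (\<lambda>x. h x x)"
proof -
  have "h x x = (\<Sum>i\<in>UNIV. \<Sum>j\<in>UNIV. x $ i * (cnj (x $ j) * h (axis i 1) (axis j 1)))" for x
  proof -
    have "h x x = h (\<Sum>i\<in>UNIV. (x $ i) *s axis i 1) (\<Sum>i\<in>UNIV. (x $ i) *s axis i 1)"
      by (simp only: basis_expansion)
    also have "\<dots> = (\<Sum>i\<in>UNIV. \<Sum>j\<in>UNIV. x $ i * (cnj (x $ j) * h (axis i 1) (axis j 1)))"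
      by (rule pd_form_sum2[OF h finite finite])
    finally show ?thesis .
  qed
  then show ?thesis by (simp only:) (intro continuous_intros)
qed

lemma scaleR_eq_scalar: "c *\<^sub>R x = complex_of_real c *s (x :: complex^'r::finite)"
  unfolding vec_eq_iff vector_scaleR_component vector_smult_component by (simp add: scaleR_conv_of_real)

lemma vec_subspace_closed:
  assumes "vec.subspace (S :: (complex^'r::finite) set)"
  shows "closed S"
proof (rule closed_subspace)
  show "subspace S" using assms unfolding subspace_def vec.subspace_def scaleR_eq_scalar by auto
qed

lemma vec_subspaces_meet:
  assumes "vec.subspace S" "vec.subspace T" "vec.dim S + vec.dim T > CARD('r)"
  shows "\<exists>v \<noteq> (0 :: complex^'r::finite). v \<in> S \<inter> T"
proof (rule ccontr)
  assume "\<not> ?thesis"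
  then have "S \<inter> T \<subseteq> {0}" by blast
  then have "vec.dim (S \<inter> T) = 0" using vec.dim_eq_0 by blast
  moreover have "vec.dim {x + y |x y. x \<in> S \<and> y \<in> T} \<le> CARD('r)"
    using vec.dim_subset[OF subset_UNIV] by (simp only: vec_dim_card)
  ultimately show False using vec.dim_sums_Int[OF assms(1,2)] assms(3) by linarith
qed

text \<open>Along the line w + s e the quadratic form is affine in s, since g e e = 0; a nonzero
  slope would make it negative somewhere. This replaces the first-order condition at a maximum of
  the Rayleigh quotient.\<close>

lemma psd_null_vector:
  fixes g :: "complex^'r::finite \<Rightarrow> complex^'r \<Rightarrow> complex"
  assumes add: "\<And>x y z. g (x + y) z = g x z + g y z" and sc: "\<And>c x y. g (c *s x) y = c * g x y"
    and sym: "\<And>x y. g y x = cnj (g x y)" and S: "vec.subspace S"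
    and psd: "\<And>v. v \<in> S \<Longrightarrow> Re (g v v) \<ge> 0" and e: "e \<in> S" "g e e = 0" and w: "w \<in> S"
  shows "g e w = 0"
proof (rule ccontr)
  assume c: "g e w \<noteq> 0"
  \<comment> \<open>Chosen such that the real part of s g(e, w) is -(Re (g w w) + 1) / 2, which
    makes the form equal to -1.\<close>
  define s where "s = - of_real ((Re (g w w) + 1) / (2 * (cmod (g e w))\<^sup>2)) * cnj (g e w)"
  let ?v = "w + s *s e"
  have "?v \<in> S" using S e w unfolding vec.subspace_def by blast
  have add2: "g z (x + y) = g z x + g z y" for x y z by (metis add sym complex_cnj_add)
  have sc2: "g x (c *s y) = cnj c * g x y" for c x y by (metis sc sym complex_cnj_mult)
  have "g ?v ?v = g w w + (s * g e w + cnj (s * g e w))"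
    by (simp add: add add2 sc sc2 e(2) sym[of w e])
  then have "Re (g ?v ?v) = Re (g w w) + 2 * Re (s * g e w)" by simp
  also have "s * g e w = - of_real ((Re (g w w) + 1) / (2 * (cmod (g e w))\<^sup>2) * (cmod (g e w))\<^sup>2)"
    unfolding s_def using complex_norm_square[of "g e w"] by (simp add: mult.commute)
  also have "(Re (g w w) + 1) / (2 * (cmod (g e w))\<^sup>2) * (cmod (g e w))\<^sup>2 = (Re (g w w) + 1) / 2"
    using c by simp
  finally have "Re (g ?v ?v) = -1" by (simp add: field_simps)
  then show False using psd[OF \<open>?v \<in> S\<close>] by simp
qed

text \<open>The quotient is continuous on the compact unit sphere of S and invariant under
  scaling.\<close>

lemma rayleigh_maximizer:
  fixes h k :: "complex^'r::finite \<Rightarrow> complex^'r \<Rightarrow> complex"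
  assumes h: "pd_form h" and k: "pd_form k" and S: "vec.subspace S" and d: "vec.dim S \<noteq> 0"
  shows "\<exists>e\<in>S. e \<noteq> 0 \<and> (\<exists>\<mu>>0. Re (k e e) = \<mu> * Re (h e e) \<and> (\<forall>v\<in>S. Re (k v v) \<le> \<mu> * Re (h v v)))"
proof -
  let ?K = "S \<inter> sphere 0 1"
  have sc_in: "c *\<^sub>R x \<in> S" if "x \<in> S" for c x
    unfolding scaleR_eq_scalar by (rule vec.subspace_scale[OF S that])
  have "\<not> S \<subseteq> {0}" using d unfolding vec.dim_eq_0 .
  then obtain x where x: "x \<in> S" "x \<noteq> 0" by blast
  have "(1 / norm x) *\<^sub>R x \<in> ?K" using x sc_in by auto
  then have ne: "?K \<noteq> {}" by blast
  have cp: "compact ?K" using vec_subspace_closed[OF S] by (simp add: closed_Int_compact)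
  have cont: "continuous_on ?K (\<lambda>v. Re (k v v) / Re (h v v))"
  proof (intro continuous_intros)
    show "continuous_on ?K (\<lambda>x. k x x)" "continuous_on ?K (\<lambda>x. h x x)"
      using continuous_on_subset[OF pd_form_continuous] h k by blast+
    show "\<forall>x\<in>?K. Re (h x x) \<noteq> 0"
    proof
      fix x assume "x \<in> ?K"
      then have "x \<noteq> 0" by auto
      from pd_form_pos[OF h this] show "Re (h x x) \<noteq> 0" by simp
    qed
  qed
  obtain e where e: "e \<in> ?K" "\<And>v. v \<in> ?K \<Longrightarrow> Re (k v v) / Re (h v v) \<le> Re (k e e) / Re (h e e)"
    using continuous_attains_sup[OF cp ne cont] by blast
  define \<mu> where "\<mu> = Re (k e e) / Re (h e e)"
  have e0: "e \<noteq> 0" using e(1) by auto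
  have pos: "Re (h e e) > 0" "Re (k e e) > 0" using pd_form_pos h k e0 by blast+
  have "Re (k v v) \<le> \<mu> * Re (h v v)" if v: "v \<in> S" for v
  proof (cases "v = 0")
    case True then show ?thesis using pd_form_simps(5)[OF h] pd_form_simps(5)[OF k] by simp
  next
    case False
    define c where "c = 1 / norm v"
    have c: "c > 0" using False by (simp add: c_def)
    have u: "c *\<^sub>R v \<in> ?K" using sc_in[OF v] False by (auto simp: c_def)
    have hc: "f (c *\<^sub>R v) (c *\<^sub>R v) = of_real (c * c) * f v v" if "pd_form f" for f
      unfolding scaleR_eq_scalar by (simp add: pd_form_simps[OF that])
    have "Re (k v v) / Re (h v v) \<le> \<mu>"
      using e(2)[OF u] c unfolding \<mu>_def hc[OF h] hc[OF k] by simp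
    then show ?thesis using pd_form_pos[OF h False] by (simp add: field_simps)
  qed
  moreover have "\<mu> > 0" "Re (k e e) = \<mu> * Re (h e e)" using pos by (auto simp: \<mu>_def)
  ultimately show ?thesis using e e0 by blast
qed

text \<open>Successive maximization of the Rayleigh quotient. The induction inserts an index b below
  all earlier ones: b receives the maximum over S, the other indices the h-orthogonal complement of
  the maximizer, so the exponents decrease with the index.\<close>

lemma simultaneous_diagonalization:
  fixes h k :: "complex^'r::{finite,linorder} \<Rightarrow> complex^'r::{finite,linorder} \<Rightarrow> complex" and K :: "'r set"
  assumes h: "pd_form h" and k: "pd_form k" and fin: "finite K"
  shows "vec.subspace S \<Longrightarrow> vec.dim S = card K \<Longrightarrow>
    \<exists>e a. (\<forall>m\<in>K. e m \<in> S \<and> e m \<noteq> 0 \<and> Re (k (e m) (e m)) = exp (2 * a m) * Re (h (e m) (e m))) \<and>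
      (\<forall>m\<in>K. \<forall>n\<in>K. m \<noteq> n \<longrightarrow> h (e m) (e n) = 0 \<and> k (e m) (e n) = 0) \<and>
      (\<forall>m\<in>K. \<forall>n\<in>K. m \<le> n \<longrightarrow> a m \<ge> a n)"
  using fin
proof (induction K arbitrary: S rule: finite_linorder_min_induct)
  case empty then show ?case by simp
next
  case (insert b A)
  have bA: "b \<notin> A" using insert by auto
  have dS: "vec.dim S = card A + 1" using insert bA by simp
  obtain e \<mu> where e: "e \<in> S" "e \<noteq> 0" "\<mu> > 0" "Re (k e e) = \<mu> * Re (h e e)"
    "\<And>v. v \<in> S \<Longrightarrow> Re (k v v) \<le> \<mu> * Re (h v v)"
    using rayleigh_maximizer[OF h k insert(4)] dS by auto
  define S' where "S' = {w \<in> S. h w e = 0}"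
  have S': "vec.subspace S'"
    using insert(4) unfolding S'_def vec.subspace_def by (auto simp: pd_form_simps[OF h])
  have he: "h e e \<noteq> 0" using pd_form_pos[OF h e(2)] by auto
  have enS: "e \<notin> S'" using he by (simp add: S'_def)
  have "vec.span (insert e S') = S"
  proof
    show "vec.span (insert e S') \<subseteq> S"
      using e(1) insert(4) by (intro vec.span_minimal) (auto simp: S'_def)
    show "S \<subseteq> vec.span (insert e S')"
    proof
      fix x assume x: "x \<in> S"
      let ?c = "h x e / h e e"
      have "x + (- ?c) *s e \<in> S" using x e(1) insert(4) unfolding vec.subspace_def by blast
      moreover have "h (x + (- ?c) *s e) e = 0" using he by (simp only: pd_form_simps[OF h]) simp
      ultimately have "x + (- ?c) *s e \<in> S'" by (simp add: S'_def)
      then have "(x + (- ?c) *s e) + ?c *s e \<in> vec.span (insert e S')"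
        by (intro vec.span_add vec.span_scale vec.span_base) auto
      moreover have "(x + (- ?c) *s e) + ?c *s e = x" by (vector algebra_simps)
      ultimately show "x \<in> vec.span (insert e S')" by simp
    qed
  qed
  then have "vec.dim S = vec.dim (insert e S')" using vec.dim_span[of "insert e S'"] by simp
  also have "vec.span S' = S'" using S' by (simp only: vec.span_eq_iff)
  then have "e \<notin> vec.span S'" using enS by (simp only: simp_thms)
  then have "vec.dim (insert e S') = vec.dim S' + 1" by (simp add: vec.dim_insert)
  finally have dS': "vec.dim S' = card A" using dS by simp
  obtain f a where f: "\<forall>m\<in>A. f m \<in> S' \<and> f m \<noteq> 0 \<and> Re (k (f m) (f m)) = exp (2 * a m) * Re (h (f m) (f m))"
    "\<forall>m\<in>A. \<forall>n\<in>A. m \<noteq> n \<longrightarrow> h (f m) (f n) = 0 \<and> k (f m) (f n) = 0"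
    "\<forall>m\<in>A. \<forall>n\<in>A. m \<le> n \<longrightarrow> a m \<ge> a n"
    using insert.IH[OF S' dS'] by (elim exE conjE) (rule that)
  have orth: "h e w = 0 \<and> h w e = 0 \<and> k e w = 0 \<and> k w e = 0" if w: "w \<in> S'" for w
  proof -
    have wS: "w \<in> S" "h w e = 0" using w by (auto simp: S'_def)
    then have 1: "h e w = 0" using pd_form_sym[OF h, of e w] by simp
    \<comment> \<open>This form is nonnegative on S and vanishes at the maximizer e, so e is in its
      kernel; h-orthogonality to e then implies k-orthogonality.\<close>
    let ?g = "\<lambda>x y. of_real \<mu> * h x y - k x y"
    have "?g e w = 0"
    proof (rule psd_null_vector[where S = S])
      show "?g e e = 0" using e(4) pd_form_real[OF h, of e] pd_form_real[OF k, of e]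
        by (metis eq_iff_diff_eq_0 of_real_mult)
      show "?g y x = cnj (?g x y)" for x y
        using pd_form_sym[OF h, of y x] pd_form_sym[OF k, of y x] by simp
    qed (use insert(4) e wS in \<open>auto simp: pd_form_simps(1,2)[OF h] pd_form_simps(1,2)[OF k] algebra_simps\<close>)
    then have 2: "k e w = 0" using 1 by simp
    then have "k w e = 0" using pd_form_sym[OF k, of w e] by simp
    then show ?thesis using 1 2 wS by simp
  qed
  define e' where "e' = f(b := e)"
  \<comment> \<open>The quotient of squared norms is \<mu> = exp (2 a), hence the half.\<close>
  define a' where "a' = a(b := ln \<mu> / 2)"
  have eA: "e' m = f m" "a' m = a m" if "m \<in> A" for m using that bA by (auto simp: e'_def a'_def)
  have eb: "e' b = e" "a' b = ln \<mu> / 2" by (auto simp: e'_def a'_def)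
  have ab: "a m \<le> ln \<mu> / 2" if m: "m \<in> A" for m
  proof -
    have "f m \<in> S" "f m \<noteq> 0" using f(1) m by (auto simp: S'_def)
    then have "exp (2 * a m) * Re (h (f m) (f m)) \<le> \<mu> * Re (h (f m) (f m))"
      using e(5)[of "f m"] f(1) m by auto
    then have "exp (2 * a m) \<le> \<mu>" using pd_form_pos[OF h \<open>f m \<noteq> 0\<close>] by simp
    then have "2 * a m \<le> ln \<mu>" using e(3) by (metis ln_exp exp_gt_zero ln_le_cancel_iff)
    then show ?thesis by simp
  qed
  have 1: "\<forall>m\<in>insert b A. e' m \<in> S \<and> e' m \<noteq> 0 \<and> Re (k (e' m) (e' m)) = exp (2 * a' m) * Re (h (e' m) (e' m))"
    using f(1) e(1-4) by (auto simp: eA eb S'_def)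
  have 2: "\<forall>m\<in>insert b A. \<forall>n\<in>insert b A. m \<noteq> n \<longrightarrow> h (e' m) (e' n) = 0 \<and> k (e' m) (e' n) = 0"
    using f(1,2) orth by (auto simp: eA eb)
  have 3: "\<forall>m\<in>insert b A. \<forall>n\<in>insert b A. m \<le> n \<longrightarrow> a' m \<ge> a' n"
  proof (intro ballI impI)
    fix m n assume mn: "m \<in> insert b A" "n \<in> insert b A" "m \<le> n"
    consider "m = b" "n = b" | "m = b" "n \<in> A" | "m \<in> A" "n \<in> A" using mn insert(2) by fastforce
    then show "a' m \<ge> a' n"
      by cases (use f(3) ab mn in \<open>auto simp: eA eb\<close>)
  qed
  show ?case using 1 2 3 by blast
qed

text \<open>The condition inside the definite description of \<open>vector_distance\<close>, with
  the basis as a parameter.\<close>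

definition adapted_basis ::
  "(complex^'r::{finite,linorder} \<Rightarrow> complex^'r::{finite,linorder} \<Rightarrow> complex) \<Rightarrow>
   (complex^'r::{finite,linorder} \<Rightarrow> complex^'r::{finite,linorder} \<Rightarrow> complex) \<Rightarrow>
   ('r \<Rightarrow> complex^'r::{finite,linorder}) \<Rightarrow> real^'r::{finite,linorder} \<Rightarrow> bool" where
  "adapted_basis h k e a \<longleftrightarrow> orthogonal_basis h e \<and> orthogonal_basis k e \<and>
     (\<forall>m. metric_norm k (e m) = exp (a $ m) * metric_norm h (e m)) \<and> (\<forall>m n. m \<le> n \<longrightarrow> a $ m \<ge> a $ n)"

lemma orthogonal_basisI:
  assumes h: "pd_form h" and nz: "\<And>m. e m \<noteq> 0" and o: "\<And>m n. m \<noteq> n \<Longrightarrow> h (e m) (e n) = 0"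
  shows "orthogonal_basis h e"
proof -
  have inj: "inj e"
  proof (rule injI, rule ccontr)
    fix m n assume "e m = e n" "m \<noteq> n"
    then have "h (e m) (e m) = 0" using o[of m n] by simp
    then show False using pd_form_pos[OF h nz[of m]] by simp
  qed
  have ind: "vec.independent (range e)"
  proof (rule vec.independent_if_scalars_zero)
    fix c x assume s: "(\<Sum>x\<in>range e. c x *s x) = 0" and x: "x \<in> range e"
    then obtain m where m: "x = e m" by blast
    have "0 = h (\<Sum>n\<in>UNIV. c (e n) *s e n) (e m)"
      using s inj by (simp add: sum.reindex pd_form_simps[OF h])
    also have "\<dots> = (\<Sum>n\<in>UNIV. c (e n) * h (e n) (e m))"
      by (simp only: pd_form_sum[OF h finite] pd_form_simps[OF h])
    also have "\<dots> = c (e m) * h (e m) (e m)"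
      using o by (subst sum.remove[of _ m]) (auto intro!: sum.neutral)
    finally show "c x = 0" using pd_form_pos[OF h nz[of m]] m by auto
  qed simp
  have "vec.span (range e) = UNIV"
  proof -
    have "vec.dim (UNIV :: (complex^'a) set) \<le> card (range e)"
      using inj by (simp only: vec_dim_card card_image)
    then show ?thesis using vec.card_ge_dim_independent[OF subset_UNIV ind] by blast
  qed
  then show ?thesis unfolding orthogonal_basis_def using inj ind o by blast
qed

lemma adapted_basis_exists:
  fixes h k :: "complex^'r::{finite,linorder} \<Rightarrow> complex^'r::{finite,linorder} \<Rightarrow> complex"
  assumes "pd_form h" "pd_form k"
  shows "\<exists>e a. adapted_basis h k e a"
proof -
  have "vec.dim (UNIV :: (complex^'r::{finite,linorder}) set) = card (UNIV :: 'r set)" by (rule vec_dim_card)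
  from simultaneous_diagonalization[OF assms finite vec.subspace_UNIV this]
  obtain e :: "'r \<Rightarrow> complex^'r::{finite,linorder}" and a where
    ea': "\<forall>m\<in>UNIV. e m \<in> UNIV \<and> e m \<noteq> 0 \<and> Re (k (e m) (e m)) = exp (2 * a m) * Re (h (e m) (e m))"
    "\<forall>m\<in>UNIV. \<forall>n\<in>UNIV. m \<noteq> n \<longrightarrow> h (e m) (e n) = 0 \<and> k (e m) (e n) = 0"
    "\<forall>m\<in>UNIV. \<forall>n\<in>UNIV. m \<le> n \<longrightarrow> a m \<ge> a n"
    by (elim exE conjE) (rule that)
  have ea: "\<And>m. e m \<noteq> 0" "\<And>m. Re (k (e m) (e m)) = exp (2 * a m) * Re (h (e m) (e m))"
    "\<And>m n. m \<noteq> n \<Longrightarrow> h (e m) (e n) = 0" "\<And>m n. m \<noteq> n \<Longrightarrow> k (e m) (e n) = 0" "\<And>m n. m \<le> n \<Longrightarrow> a m \<ge> a n"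
    using ea' by simp_all
  have "metric_norm k (e m) = exp (a m) * metric_norm h (e m)" for m
  proof -
    have "exp (2 * a m) = (exp (a m))\<^sup>2" by (rule exp_double)
    then show ?thesis unfolding metric_norm_def ea(2) by (simp add: real_sqrt_mult)
  qed
  then have "adapted_basis h k e (\<chi> m. a m)"
    unfolding adapted_basis_def
    using orthogonal_basisI[OF assms(1) ea(1,3)] orthogonal_basisI[OF assms(2) ea(1,4)] ea(5) by simp
  then show ?thesis by blast
qed

lemma orthogonal_basis_expansion:
  assumes h: "pd_form h" and o: "\<And>m n. m \<in> K \<Longrightarrow> n \<in> K \<Longrightarrow> m \<noteq> n \<Longrightarrow> h (e m) (e n) = 0" and K: "finite K"
  shows "Re (h (\<Sum>m\<in>K. c m *s e m) (\<Sum>m\<in>K. c m *s e m)) = (\<Sum>m\<in>K. (cmod (c m))\<^sup>2 * Re (h (e m) (e m)))"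
proof -
  have "h (\<Sum>m\<in>K. c m *s e m) (\<Sum>m\<in>K. c m *s e m) = (\<Sum>m\<in>K. \<Sum>n\<in>K. c m * (cnj (c n) * h (e m) (e n)))"
    by (rule pd_form_sum2[OF h K K])
  also have "\<dots> = (\<Sum>m\<in>K. c m * (cnj (c m) * h (e m) (e m)))"
  proof (rule sum.cong[OF refl])
    fix m assume m: "m \<in> K"
    have "(\<Sum>n\<in>K - {m}. c m * (cnj (c n) * h (e m) (e n))) = 0"
    proof (rule sum.neutral, rule ballI)
      fix n assume "n \<in> K - {m}"
      then have "h (e m) (e n) = 0" using o[of m n] m by blast
      then show "c m * (cnj (c n) * h (e m) (e n)) = 0" by simp
    qed
    then show "(\<Sum>n\<in>K. c m * (cnj (c n) * h (e m) (e n))) = c m * (cnj (c m) * h (e m) (e m))"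
      using sum.remove[OF K m, of "\<lambda>n. c m * (cnj (c n) * h (e m) (e n))"] by simp
  qed
  also have "\<dots> = of_real (\<Sum>m\<in>K. (cmod (c m))\<^sup>2 * Re (h (e m) (e m)))"
    unfolding of_real_sum
  proof (rule sum.cong[OF refl])
    fix m assume "m \<in> K"
    show "c m * (cnj (c m) * h (e m) (e m)) = of_real ((cmod (c m))\<^sup>2 * Re (h (e m) (e m)))"
      unfolding of_real_mult complex_norm_square pd_form_real[OF h, of "e m", symmetric] by simp
  qed
  finally show ?thesis by simp
qed

lemma adapted_basis_ratio:
  fixes a :: "real^'r::{finite,linorder}"
  assumes ab: "adapted_basis h k e a" and h: "pd_form h" and k: "pd_form k"
  shows "Re (k (e m) (e m)) = exp (2 * a $ m) * Re (h (e m) (e m))"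
proof -
  have "metric_norm k (e m) = exp (a $ m) * metric_norm h (e m)"
    using ab unfolding adapted_basis_def by blast
  then have "(metric_norm k (e m))\<^sup>2 = (exp (a $ m) * metric_norm h (e m))\<^sup>2" by simp
  then show ?thesis
    unfolding metric_norm_def power_mult_distrib exp_double
    by (simp add: pd_form_nonneg h k)
qed

lemma span_indexed:
  fixes e :: "'r::finite \<Rightarrow> complex^'r"
  assumes "inj e" "v \<in> vec.span (e ` K)"
  shows "\<exists>c. v = (\<Sum>m\<in>K. c m *s e m)"
proof -
  obtain c where "v = (\<Sum>x\<in>e ` K. c x *s x)"
    using assms(2) vec.span_finite[of "e ` K"] by auto
  then have "v = (\<Sum>m\<in>K. c (e m) *s e m)"
    using assms(1) by (simp add: sum.reindex inj_on_subset)
  then show ?thesis by (rule exI[of _ "\<lambda>m. c (e m)"])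
qed

lemma dim_span_indexed:
  assumes "inj e" "vec.independent (range e)"
  shows "vec.dim (vec.span (e ` K)) = card K"
proof -
  have "vec.independent (e ` K)" by (rule vec.independent_mono[OF assms(2)]) auto
  then show ?thesis using assms(1) using vec.dim_eq_card_independent[of "e ` K"]
    by (simp add: vec.dim_span card_image inj_on_subset)
qed

lemma adapted_basis_upper:
  fixes a :: "real^'r::{finite,linorder}"
  assumes ab: "adapted_basis h k e a" and h: "pd_form h" and k: "pd_form k"
    and v: "v \<in> vec.span (e ` {j..})"
  shows "Re (k v v) \<le> exp (2 * a $ j) * Re (h v v)"
proof -
  have o: "inj e" "\<And>m n. m \<noteq> n \<Longrightarrow> h (e m) (e n) = 0" "\<And>m n. m \<noteq> n \<Longrightarrow> k (e m) (e n) = 0"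
    using ab unfolding adapted_basis_def orthogonal_basis_def by auto
  obtain c where c: "v = (\<Sum>m\<in>{j..}. c m *s e m)" using span_indexed[OF o(1) v] by blast
  have hv: "Re (h v v) = (\<Sum>m\<in>{j..}. (cmod (c m))\<^sup>2 * Re (h (e m) (e m)))"
    unfolding c by (rule orthogonal_basis_expansion[OF h]) (use o in auto)
  have kv: "Re (k v v) = (\<Sum>m\<in>{j..}. (cmod (c m))\<^sup>2 * Re (k (e m) (e m)))"
    unfolding c by (rule orthogonal_basis_expansion[OF k]) (use o in auto)
  show ?thesis
    unfolding hv kv sum_distrib_left
  proof (rule sum_mono)
    fix m assume m: "m \<in> {j..}"
    then have "exp (2 * a $ m) \<le> exp (2 * a $ j)" using ab unfolding adapted_basis_def by auto
    then show "(cmod (c m))\<^sup>2 * Re (k (e m) (e m)) \<le> exp (2 * a $ j) * ((cmod (c m))\<^sup>2 * Re (h (e m) (e m)))"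
      unfolding adapted_basis_ratio[OF ab h k] mult.left_commute[of _ "(cmod (c m))\<^sup>2"]
      by (intro mult_left_mono mult_right_mono) (simp_all add: pd_form_nonneg[OF h])
  qed
qed

lemma adapted_basis_lower:
  fixes a :: "real^'r::{finite,linorder}"
  assumes ab: "adapted_basis h k e a" and h: "pd_form h" and k: "pd_form k"
    and v: "v \<in> vec.span (e ` {..j})"
  shows "Re (k v v) \<ge> exp (2 * a $ j) * Re (h v v)"
proof -
  have o: "inj e" "\<And>m n. m \<noteq> n \<Longrightarrow> h (e m) (e n) = 0" "\<And>m n. m \<noteq> n \<Longrightarrow> k (e m) (e n) = 0"
    using ab unfolding adapted_basis_def orthogonal_basis_def by auto
  obtain c where c: "v = (\<Sum>m\<in>{..j}. c m *s e m)" using span_indexed[OF o(1) v] by blast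
  have hv: "Re (h v v) = (\<Sum>m\<in>{..j}. (cmod (c m))\<^sup>2 * Re (h (e m) (e m)))"
    unfolding c by (rule orthogonal_basis_expansion[OF h]) (use o in auto)
  have kv: "Re (k v v) = (\<Sum>m\<in>{..j}. (cmod (c m))\<^sup>2 * Re (k (e m) (e m)))"
    unfolding c by (rule orthogonal_basis_expansion[OF k]) (use o in auto)
  show ?thesis
    unfolding hv kv sum_distrib_left
  proof (rule sum_mono)
    fix m assume m: "m \<in> {..j}"
    then have "exp (2 * a $ j) \<le> exp (2 * a $ m)" using ab unfolding adapted_basis_def by auto
    then show "(cmod (c m))\<^sup>2 * Re (k (e m) (e m)) \<ge> exp (2 * a $ j) * ((cmod (c m))\<^sup>2 * Re (h (e m) (e m)))"
      unfolding adapted_basis_ratio[OF ab h k] mult.left_commute[of _ "(cmod (c m))\<^sup>2"]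
      by (intro mult_left_mono mult_right_mono) (simp_all add: pd_form_nonneg[OF h])
  qed
qed

section \<open>The minimax principle for two Hermitian forms\<close>

lemma card_atMost_atLeast: "card {..j} + card {j..} = CARD('r) + 1" for j :: "'r::{finite,linorder}"
proof -
  have "card {..j} + card {j..} = card ({..j} \<union> {j..}) + card ({..j} \<inter> {j..})"
    by (rule card_Un_Int) auto
  moreover have "{..j} \<union> {j..} = UNIV" "{..j} \<inter> {j..} = {j}" by auto
  ultimately show ?thesis by simp
qed

text \<open>The dimensions of S and of the span of the basis vectors from j on add up to
  \<open>CARD('r) + 1\<close>, so the two share a nonzero vector. On it the growth is at least exp
  (2 x) by assumption and at most exp (2 a_j) by the ordering of the exponents.\<close>

lemma adapted_basis_minmax_lower:
  fixes a :: "real^'r::{finite,linorder}"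
  assumes ab: "adapted_basis h k e a" and h: "pd_form h" and k: "pd_form k"
    and S: "vec.subspace S" "vec.dim S = card {..j}"
    and le: "\<And>v. v \<in> S \<Longrightarrow> Re (k v v) \<ge> exp (2 * x) * Re (h v v)"
  shows "a $ j \<ge> x"
proof -
  have e: "inj e" "vec.independent (range e)" using ab unfolding adapted_basis_def orthogonal_basis_def by auto
  obtain v where v: "v \<noteq> 0" "v \<in> S" "v \<in> vec.span (e ` {j..})"
    using vec_subspaces_meet[OF S(1) vec.subspace_span, of "e ` {j..}"]
      dim_span_indexed[OF e, of "{j..}"] S(2) card_atMost_atLeast[of j] by auto
  have "exp (2 * x) * Re (h v v) \<le> exp (2 * a $ j) * Re (h v v)"
    using le[OF v(2)] adapted_basis_upper[OF ab h k v(3)] by linarith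
  then show ?thesis using pd_form_pos[OF h v(1)] by simp
qed

lemma adapted_basis_minmax_upper:
  fixes a :: "real^'r::{finite,linorder}"
  assumes ab: "adapted_basis h k e a" and h: "pd_form h" and k: "pd_form k"
    and S: "vec.subspace S" "vec.dim S = card {j..}"
    and le: "\<And>v. v \<in> S \<Longrightarrow> Re (k v v) \<le> exp (2 * x) * Re (h v v)"
  shows "a $ j \<le> x"
proof -
  have e: "inj e" "vec.independent (range e)" using ab unfolding adapted_basis_def orthogonal_basis_def by auto
  obtain v where v: "v \<noteq> 0" "v \<in> S" "v \<in> vec.span (e ` {..j})"
    using vec_subspaces_meet[OF S(1) vec.subspace_span, of "e ` {..j}"]
      dim_span_indexed[OF e, of "{..j}"] S(2) card_atMost_atLeast[of j] by auto
  have "exp (2 * a $ j) * Re (h v v) \<le> exp (2 * x) * Re (h v v)"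
    using le[OF v(2)] adapted_basis_lower[OF ab h k v(3)] by linarith
  then show ?thesis using pd_form_pos[OF h v(1)] by simp
qed

text \<open>The definite description denotes: the span of the first j vectors of one adapted basis
  is a test space for any other, so minimax in both directions forces equal exponents.\<close>

lemma vector_distance_adapted:
  fixes h k :: "complex^'r::{finite,linorder} \<Rightarrow> complex^'r::{finite,linorder} \<Rightarrow> complex"
  assumes h: "pd_form h" and k: "pd_form k"
  shows "\<exists>e. adapted_basis h k e (vector_distance h k)"
proof -
  obtain e a where ea: "adapted_basis h k e a" using adapted_basis_exists[OF h k] by blast
  have le: "a' $ j \<le> a'' $ j" if "adapted_basis h k e' a'" "adapted_basis h k e'' a''"
    for e' e'' :: "'r \<Rightarrow> complex^'r::{finite,linorder}" and a' a'' :: "real^'r::{finite,linorder}" and j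
  proof -
    have e: "inj e'" "vec.independent (range e')"
      using that unfolding adapted_basis_def orthogonal_basis_def by auto
    show ?thesis
      using adapted_basis_minmax_lower[OF that(2) h k vec.subspace_span dim_span_indexed[OF e]
        adapted_basis_lower[OF that(1) h k]] .
  qed
  have "(THE a. \<exists>e. adapted_basis h k e a) = a"
  proof (rule the_equality)
    show "\<exists>e. adapted_basis h k e a" using ea by blast
    fix a' assume "\<exists>e. adapted_basis h k e a'"
    then obtain e' where "adapted_basis h k e' a'" by blast
    then show "a' = a" using le ea by (metis vec_eq_iff order_antisym)
  qed
  moreover have "vector_distance h k = (THE a. \<exists>e. adapted_basis h k e a)"
    unfolding vector_distance_def adapted_basis_def by (rule arg_cong[where f = The]) auto
  ultimately show ?thesis using ea by auto
qed

lemma vector_distance_lower: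
  fixes h k :: "complex^'r::{finite,linorder} \<Rightarrow> complex^'r::{finite,linorder} \<Rightarrow> complex"
  assumes "pd_form h" "pd_form k" "vec.subspace S" "vec.dim S = card {..j}"
    and "\<And>v. v \<in> S \<Longrightarrow> Re (k v v) \<ge> exp (2 * x) * Re (h v v)"
  shows "vector_distance h k $ j \<ge> x"
  using vector_distance_adapted[OF assms(1,2)] adapted_basis_minmax_lower[OF _ assms] by blast

lemma vector_distance_upper:
  fixes h k :: "complex^'r::{finite,linorder} \<Rightarrow> complex^'r::{finite,linorder} \<Rightarrow> complex"
  assumes "pd_form h" "pd_form k" "vec.subspace S" "vec.dim S = card {j..}"
    and "\<And>v. v \<in> S \<Longrightarrow> Re (k v v) \<le> exp (2 * x) * Re (h v v)"
  shows "vector_distance h k $ j \<le> x"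
  using vector_distance_adapted[OF assms(1,2)] adapted_basis_minmax_upper[OF _ assms] by blast

section \<open>Growth of signed sums\<close>

text \<open>With the integrating factor the product D exp (- I) has nonnegative derivative, whatever
  the sign of D.\<close>

lemma gronwall_lower:
  fixes D D' \<phi> :: "real \<Rightarrow> real"
  assumes D: "\<And>u. u \<in> {0..1} \<Longrightarrow> (D has_real_derivative D' u) (at u within {0..1})"
    and le: "\<And>u. u \<in> {0..1} \<Longrightarrow> D' u \<ge> \<phi> u * D u" and \<phi>: "continuous_on {0..1} \<phi>"
  shows "D 1 \<ge> exp (integral {0..1} \<phi>) * D 0"
proof -
  define I where "I u = integral {0..u} \<phi>" for u
  define F where "F u = D u * exp (- I u)" for u
  have I: "(I has_real_derivative \<phi> u) (at u within {0..1})" if "u \<in> {0..1}" for u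
    unfolding I_def using integral_has_real_derivative[OF \<phi> that] .
  have F: "(F has_real_derivative (D' u - \<phi> u * D u) * exp (- I u)) (at u within {0..1})" if "u \<in> {0..1}" for u
    unfolding F_def by (rule derivative_eq_intros D[OF that] I[OF that] refl)+ (simp add: algebra_simps)
  have "\<exists>u\<in>{0<..<1}. F 1 - F 0 = (*) ((D' u - \<phi> u * D u) * exp (- I u)) (1 - 0)"
    by (rule mvt_simple) (use F in \<open>auto simp: has_field_derivative_def\<close>)
  then obtain u where u: "u \<in> {0<..<1}" "F 1 - F 0 = (D' u - \<phi> u * D u) * exp (- I u)" by auto
  moreover have "(D' u - \<phi> u * D u) * exp (- I u) \<ge> 0" using le[of u] u(1) by (intro mult_nonneg_nonneg) auto
  ultimately have "F 1 \<ge> F 0" by simp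
  moreover have "I 0 = 0" by (simp add: I_def)
  ultimately have "D 1 * exp (- I 1) \<ge> D 0" by (simp add: F_def)
  then have "exp (I 1) * (D 1 * exp (- I 1)) \<ge> exp (I 1) * D 0" by (intro mult_left_mono) auto
  moreover have "exp (I 1) * (D 1 * exp (- I 1)) = D 1"
    using exp_minus_inverse[of "I 1"] by (simp add: mult.left_commute)
  ultimately have "D 1 \<ge> exp (I 1) * D 0" by linarith
  then show ?thesis by (simp add: I_def)
qed

text \<open>With the signs of the weights matching the spectral gap, the signed sum
  satisfies a differential inequality whatever its sign, so no invariant cone is needed.\<close>

lemma signed_sum_growth:
  fixes N N' b :: "'r::finite \<Rightarrow> real \<Rightarrow> real" and c :: "real \<Rightarrow> real" and s C t \<eta> :: real and K :: "'r set"
  defines "n \<equiv> real CARD('r)"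
  defines "D \<equiv> \<lambda>u. \<Sum>l\<in>UNIV. (if l \<in> K then 1 else -1) * N l u"
  assumes pos: "\<And>l u. u \<in> {0..1} \<Longrightarrow> N l u \<ge> 0"
    and N: "\<And>l u. u \<in> {0..1} \<Longrightarrow> (N l has_real_derivative N' l u) (at u within {0..1})"
    and err: "\<And>l u. u \<in> {0..1} \<Longrightarrow> \<bar>N' l u - 2 * t * b l u * N l u\<bar> \<le> C * (\<Sum>m\<in>UNIV. N m u)"
    and s: "s = 1 \<or> s = -1"
    and K: "\<And>l u. u \<in> {0..1} \<Longrightarrow> l \<in> K \<Longrightarrow> s * (b l u - c u) \<ge> 0"
      "\<And>l u. u \<in> {0..1} \<Longrightarrow> l \<notin> K \<Longrightarrow> s * (c u - b l u) \<ge> \<eta>"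
    and C: "C \<ge> 0" and t: "t \<ge> 0" "t * \<eta> \<ge> 2 * n * C" and c: "continuous_on {0..1} c"
  shows "s * D 1 \<ge> exp (2 * t * integral {0..1} c - s * (2 * n * C)) * (s * D 0)"
proof -
  define \<sigma> where "\<sigma> l = (if l \<in> K then 1 else -1 :: real)" for l
  define S where "S u = (\<Sum>l\<in>UNIV. N l u)" for u
  define R where "R u = (\<Sum>l | l \<notin> K. N l u)" for u
  let ?\<phi> = "\<lambda>u. 2 * t * c u - s * (2 * n * C)"
  have D: "D u = (\<Sum>l\<in>UNIV. \<sigma> l * N l u)" for u unfolding D_def \<sigma>_def ..
  \<comment> \<open>S is the total and R the part outside K. In this form the gain from the gap, a
    multiple of R, can absorb the error, a multiple of S.\<close>
  have DSR: "D u = S u - 2 * R u" for u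
  proof -
    have "D u = (\<Sum>l\<in>UNIV. N l u - 2 * (if l \<notin> K then N l u else 0))"
      unfolding D_def by (rule sum.cong) auto
    also have "\<dots> = S u - 2 * R u"
      unfolding S_def R_def sum_subtractf sum_distrib_left[symmetric] by (simp add: sum.If_cases)
    finally show ?thesis .
  qed
  have le: "s * (\<Sum>l\<in>UNIV. \<sigma> l * N' l u) \<ge> ?\<phi> u * (s * D u)" if u: "u \<in> {0..1}" for u
  proof -
    have S0: "S u \<ge> 0" "R u \<ge> 0" unfolding S_def R_def using pos[OF u] by (auto intro: sum_nonneg)
    \<comment> \<open>The sign s times \<sigma> l is the sign of \<open>b l - c\<close> on K and off
      K alike, so the term carrying t is nonnegative everywhere and gains \<eta> off K.\<close>
    have est: "s * (\<sigma> l * N' l u) - 2 * t * c u * (s * (\<sigma> l * N l u))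
        \<ge> 2 * t * \<eta> * (if l \<notin> K then N l u else 0) - C * S u" for l
    proof -
      have "\<bar>s * \<sigma> l\<bar> = 1" using s by (auto simp: \<sigma>_def)
      then have "\<bar>s * \<sigma> l * (N' l u - 2 * t * b l u * N l u)\<bar> \<le> C * S u"
        using err[OF u, of l] by (simp add: abs_mult S_def)
      then have 1: "s * \<sigma> l * (N' l u - 2 * t * b l u * N l u) \<ge> - (C * S u)" by linarith
      have 2: "s * \<sigma> l * (b l u - c u) \<ge> (if l \<notin> K then \<eta> else 0)"
        using K[OF u, of l] by (auto simp: \<sigma>_def algebra_simps)
      have "2 * t * N l u * (s * \<sigma> l * (b l u - c u)) \<ge> 2 * t * N l u * (if l \<notin> K then \<eta> else 0)"
        using 2 t(1) pos[OF u, of l] by (intro mult_left_mono) auto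
      then show ?thesis using 1 by (auto simp: algebra_simps)
    qed
    have "(\<Sum>l\<in>UNIV. 2 * t * \<eta> * (if l \<notin> K then N l u else 0) - C * S u)
        \<le> (\<Sum>l\<in>UNIV. s * (\<sigma> l * N' l u) - 2 * t * c u * (s * (\<sigma> l * N l u)))"
      by (rule sum_mono) (rule est)
    moreover have "(\<Sum>l\<in>UNIV. 2 * t * \<eta> * (if l \<notin> K then N l u else 0) - C * S u)
        = 2 * t * \<eta> * R u - n * C * S u"
      unfolding R_def n_def sum_subtractf sum_distrib_left[symmetric] by (simp add: sum.If_cases)
    moreover have "(\<Sum>l\<in>UNIV. s * (\<sigma> l * N' l u) - 2 * t * c u * (s * (\<sigma> l * N l u)))
        = s * (\<Sum>l\<in>UNIV. \<sigma> l * N' l u) - 2 * t * c u * (s * D u)"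
      unfolding D sum_subtractf sum_distrib_left[symmetric] ..
    \<comment> \<open>Since s s = 1, the right side is -2 n C D = -2 n C S + 4 n C R. The condition
      t \<eta> \<ge> 2 n C is what bounds 4 n C R by 2 t \<eta> R.\<close>
    moreover have "2 * t * \<eta> * R u - n * C * S u \<ge> - (s * (2 * n * C)) * (s * D u)"
    proof -
      have "s * s = 1" using s by auto
      then have "- (s * (2 * n * C)) * (s * D u) = - (2 * n * C) * D u"
        by (metis (no_types, lifting) mult.assoc mult.commute mult.left_neutral mult_minus_left)
      also have "\<dots> = - 2 * (n * C * S u) + 2 * (2 * n * C) * R u" unfolding DSR by (simp add: algebra_simps)
      also have "\<dots> \<le> - 2 * (n * C * S u) + 2 * (t * \<eta>) * R u"
        using t(2) S0(2) by (intro add_left_mono mult_right_mono mult_left_mono) auto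
      also have "\<dots> \<le> - (n * C * S u) + 2 * (t * \<eta>) * R u"
        using C S0(1) by (simp add: n_def)
      finally show ?thesis by simp
    qed
    ultimately show ?thesis by (simp add: algebra_simps)
  qed
  have dD: "((\<lambda>u. s * D u) has_real_derivative s * (\<Sum>l\<in>UNIV. \<sigma> l * N' l u)) (at u within {0..1})"
    if "u \<in> {0..1}" for u
    unfolding D by (intro DERIV_cmult DERIV_sum N that)
  have "s * D 1 \<ge> exp (integral {0..1} ?\<phi>) * (s * D 0)"
    by (rule gronwall_lower[OF dD le]) (auto intro!: continuous_intros c)
  moreover have "integral {0..1} ?\<phi> = 2 * t * integral {0..1} c - s * (2 * n * C)"
  proof -
    have "(\<lambda>u. 2 * t * c u) integrable_on {0..1}"
      by (intro integrable_continuous_interval continuous_intros c)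
    then show ?thesis by (subst integral_diff) auto
  qed
  ultimately show ?thesis by simp
qed

text \<open>Growth with s = 1 and positive weights up to k. Components beyond k vanish at time 0, so
  the signed sum is the full sum there; at time 1 it is at most the full sum.\<close>

lemma signed_sum_lower:
  fixes N N' b :: "'r::{finite,linorder} \<Rightarrow> real \<Rightarrow> real" and C t \<eta> :: real
  defines "n \<equiv> real CARD('r)"
  assumes pos: "\<And>l u. u \<in> {0..1} \<Longrightarrow> N l u \<ge> 0"
    and N: "\<And>l u. u \<in> {0..1} \<Longrightarrow> (N l has_real_derivative N' l u) (at u within {0..1})"
    and err: "\<And>l u. u \<in> {0..1} \<Longrightarrow> \<bar>N' l u - 2 * t * b l u * N l u\<bar> \<le> C * (\<Sum>m\<in>UNIV. N m u)"
    and gap: "\<And>k l u. u \<in> {0..1} \<Longrightarrow> k < l \<Longrightarrow> b k u - b l u \<ge> \<eta>"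
    and C: "C \<ge> 0" and t: "t \<ge> 0" "t * \<eta> \<ge> 2 * n * C" "\<eta> \<ge> 0" and b: "\<And>k. continuous_on {0..1} (b k)"
    and z: "\<And>l. l > k \<Longrightarrow> N l 0 = 0"
  shows "(\<Sum>l\<in>UNIV. N l 1) \<ge> exp (2 * t * integral {0..1} (b k) - 2 * n * C) * (\<Sum>l\<in>UNIV. N l 0)"
proof -
  let ?D = "\<lambda>u. \<Sum>l\<in>UNIV. (if l \<in> {..k} then 1 else -1) * N l u"
  have "1 * ?D 1 \<ge> exp (2 * t * integral {0..1} (b k) - 1 * (2 * real CARD('r) * C)) * (1 * ?D 0)"
  proof (rule signed_sum_growth[OF pos N err])
    fix l u assume u: "u \<in> {0..1::real}" and "l \<in> {..k}"
    then have "l = k \<or> l < k" by auto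
    then show "1 * (b l u - b k u) \<ge> 0" using gap[OF u, of l k] t(3) by auto
  qed (use gap C t b in \<open>auto simp: n_def not_le\<close>)
  moreover have "?D 0 = (\<Sum>l\<in>UNIV. N l 0)" by (rule sum.cong) (use z in auto)
  moreover have "?D 1 \<le> (\<Sum>l\<in>UNIV. N l 1)"
  proof (rule sum_mono)
    fix l show "(if l \<in> {..k} then 1 else -1) * N l 1 \<le> N l 1" using pos[of 1 l] by auto
  qed
  ultimately show ?thesis by (simp add: n_def)
qed

text \<open>The time-reversed counterpart: s = -1, positive weights from k on. Components before k
  vanish at time 1, where the signed sum is now the full sum; at time 0 it is at most the full
  sum.\<close>

lemma signed_sum_upper:
  fixes N N' b :: "'r::{finite,linorder} \<Rightarrow> real \<Rightarrow> real" and C t \<eta> :: real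
  defines "n \<equiv> real CARD('r)"
  assumes pos: "\<And>l u. u \<in> {0..1} \<Longrightarrow> N l u \<ge> 0"
    and N: "\<And>l u. u \<in> {0..1} \<Longrightarrow> (N l has_real_derivative N' l u) (at u within {0..1})"
    and err: "\<And>l u. u \<in> {0..1} \<Longrightarrow> \<bar>N' l u - 2 * t * b l u * N l u\<bar> \<le> C * (\<Sum>m\<in>UNIV. N m u)"
    and gap: "\<And>k l u. u \<in> {0..1} \<Longrightarrow> k < l \<Longrightarrow> b k u - b l u \<ge> \<eta>"
    and C: "C \<ge> 0" and t: "t \<ge> 0" "t * \<eta> \<ge> 2 * n * C" "\<eta> \<ge> 0" and b: "\<And>k. continuous_on {0..1} (b k)"
    and z: "\<And>l. l < k \<Longrightarrow> N l 1 = 0"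
  shows "(\<Sum>l\<in>UNIV. N l 1) \<le> exp (2 * t * integral {0..1} (b k) + 2 * n * C) * (\<Sum>l\<in>UNIV. N l 0)"
proof -
  let ?D = "\<lambda>u. \<Sum>l\<in>UNIV. (if l \<in> {k..} then 1 else -1) * N l u"
  have "-1 * ?D 1 \<ge> exp (2 * t * integral {0..1} (b k) - (-1) * (2 * real CARD('r) * C)) * (-1 * ?D 0)"
  proof (rule signed_sum_growth[OF pos N err])
    fix l u assume u: "u \<in> {0..1::real}" and "l \<in> {k..}"
    then have "l = k \<or> k < l" by auto
    then show "-1 * (b l u - b k u) \<ge> 0" using gap[OF u, of k l] t(3) by auto
  next
    fix l u assume u: "u \<in> {0..1::real}" and "l \<notin> {k..}"
    then show "-1 * (b k u - b l u) \<ge> \<eta>" using gap[OF u, of l k] by auto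
  qed (use C t b in \<open>auto simp: n_def\<close>)
  then have "?D 1 \<le> exp (2 * t * integral {0..1} (b k) + 2 * n * C) * ?D 0" by (simp add: n_def)
  moreover have "?D 1 = (\<Sum>l\<in>UNIV. N l 1)" by (rule sum.cong) (use z in auto)
  moreover have "?D 0 \<le> (\<Sum>l\<in>UNIV. N l 0)"
  proof (rule sum_mono)
    fix l show "(if l \<in> {k..} then 1 else -1) * N l 0 \<le> N l 0" using pos[of 0 l] by auto
  qed
  then have "exp (2 * t * integral {0..1} (b k) + 2 * n * C) * ?D 0
    \<le> exp (2 * t * integral {0..1} (b k) + 2 * n * C) * (\<Sum>l\<in>UNIV. N l 0)"
    by (intro mult_left_mono) auto
  ultimately show ?thesis by linarith
qed

text \<open>The quotient of F and G is homogeneous of degree 0 in x and continuous on the compact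
  product of J and the unit sphere. This is the source of all constants that do not depend on the
  section.\<close>

lemma homogeneous_bound:
  fixes F G :: "real \<Rightarrow> 'v::euclidean_space \<Rightarrow> real"
  assumes J: "compact J"
    and F: "continuous_on (J \<times> UNIV) (\<lambda>(u, x). F u x)" and G: "continuous_on (J \<times> UNIV) (\<lambda>(u, x). G u x)"
    and hF: "\<And>u c x. F u (c *\<^sub>R x) = c\<^sup>2 * F u x" and hG: "\<And>u c x. G u (c *\<^sub>R x) = c\<^sup>2 * G u x"
    and pos: "\<And>u x. u \<in> J \<Longrightarrow> x \<noteq> 0 \<Longrightarrow> G u x > 0"
  shows "\<exists>C\<ge>0. \<forall>u\<in>J. \<forall>x. \<bar>F u x\<bar> \<le> C * G u x"
proof -
  let ?K = "J \<times> sphere (0::'v) 1"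
  have cont: "continuous_on ?K (\<lambda>p. \<bar>F (fst p) (snd p)\<bar> / G (fst p) (snd p))"
  proof (intro continuous_intros)
    show "continuous_on ?K (\<lambda>p. F (fst p) (snd p))" "continuous_on ?K (\<lambda>p. G (fst p) (snd p))"
      using continuous_on_subset[OF F, of ?K] continuous_on_subset[OF G, of ?K]
      by (auto simp: case_prod_beta')
    show "\<forall>p\<in>?K. G (fst p) (snd p) \<noteq> 0"
    proof
      fix p assume "p \<in> ?K"
      then have "fst p \<in> J" "snd p \<noteq> 0" by auto
      from pos[OF this] show "G (fst p) (snd p) \<noteq> 0" by simp
    qed
  qed
  have "compact ?K" using J by (intro compact_Times compact_sphere)
  then have "bounded ((\<lambda>p. \<bar>F (fst p) (snd p)\<bar> / G (fst p) (snd p)) ` ?K)"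
    using compact_continuous_image[OF cont] compact_imp_bounded by blast
  then obtain C where C: "C > 0" "\<And>p. p \<in> ?K \<Longrightarrow> norm (\<bar>F (fst p) (snd p)\<bar> / G (fst p) (snd p)) \<le> C"
    unfolding bounded_pos by auto
  have "\<bar>F u x\<bar> \<le> C * G u x" if u: "u \<in> J" for u x
  proof (cases "x = 0")
    case True
    then show ?thesis using hF[of u 0 0] hG[of u 0 0] by simp
  next
    case False
    define y where "y = (1 / norm x) *\<^sub>R x"
    have y: "y \<in> sphere 0 1" "x = norm x *\<^sub>R y" using False by (auto simp: y_def)
    have Gy: "G u y > 0" using pos[OF u, of y] y(1) by (cases "y = 0") auto
    have "norm (\<bar>F u y\<bar> / G u y) \<le> C" using C(2)[of "(u, y)"] u y(1) by simp
    then have "\<bar>F u y\<bar> \<le> C * G u y" using Gy by (simp add: field_simps)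
    then have "(norm x)\<^sup>2 * \<bar>F u y\<bar> \<le> (norm x)\<^sup>2 * (C * G u y)" by (intro mult_left_mono) auto
    moreover have "\<bar>F u x\<bar> = (norm x)\<^sup>2 * \<bar>F u y\<bar>"
      using hF[of u "norm x" y] y(2) by (simp add: abs_mult)
    moreover have "G u x = (norm x)\<^sup>2 * G u y" using hG[of u "norm x" y] y(2) by simp
    ultimately show ?thesis by (simp add: mult.left_commute)
  qed
  then show ?thesis using C(1) by (intro exI[of _ C]) auto
qed

section \<open>Spectral projections\<close>

lemma mat_mult_vec: "mat c *v x = c *s (x :: complex^'r::finite)"
  by (simp add: vec_eq_iff matrix_vector_mult_def mat_def if_distrib[of "\<lambda>z. z * _"] sum.delta' cong: if_cong)

primrec eig_factors :: "complex^'r^'r \<Rightarrow> ('r::finite \<Rightarrow> complex) \<Rightarrow> 'r list \<Rightarrow> complex^'r^'r" where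
  "eig_factors M b [] = mat 1"
| "eig_factors M b (l # ls) = (M - mat (b l)) ** eig_factors M b ls"

text \<open>Lagrange interpolation: the projection onto the eigenspace of \<open>b k\<close> is a polynomial in the
  matrix, so it depends holomorphically on the matrix and its eigenvalues.\<close>

definition others :: "'r \<Rightarrow> 'r::finite list" where
  "others k = (SOME ls. set ls = UNIV - {k})"

lemma set_others [simp]: "set (others k) = UNIV - {k}"
  unfolding others_def by (rule someI_ex) (simp add: finite_list)

definition eig_proj :: "complex^'r^'r \<Rightarrow> ('r::finite \<Rightarrow> complex) \<Rightarrow> 'r \<Rightarrow> complex^'r^'r" where
  "eig_proj M b k = mat (\<Prod>l\<leftarrow>others k. inverse (b k - b l)) **
     eig_factors M b (others k)"

definition eigensystem :: "complex^'r^'r \<Rightarrow> ('r::finite \<Rightarrow> complex) \<Rightarrow> ('r \<Rightarrow> complex^'r) \<Rightarrow> bool" where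
  "eigensystem M b v \<longleftrightarrow> inj b \<and> (\<forall>k. v k \<noteq> 0 \<and> M *v v k = b k *s v k)"

lemma eig_factors_mult:
  assumes "M *v x = c *s x"
  shows "eig_factors M b ls *v x = (\<Prod>l\<leftarrow>ls. c - b l) *s x"
proof (induction ls)
  case Nil show ?case by simp
next
  case (Cons l ls)
  have "(M - mat (b l)) *v (d *s x) = (d * (c - b l)) *s x" for d
    by (simp add: matrix_vector_mult_diff_rdistrib vec.scale mat_mult_vec assms)
       (simp add: vec_eq_iff algebra_simps)
  then show ?case using Cons by (simp add: matrix_vector_mul_assoc[symmetric] mult.commute)
qed

text \<open>On an eigenvector the projection acts by the value of the Lagrange polynomial at the
  eigenvalue.\<close>

lemma eig_proj_mult:
  assumes "inj b" "M *v x = b j *s x"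
  shows "eig_proj M b k *v x = (if j = k then x else 0)"
proof -
  let ?ls = "others k"
  have "eig_proj M b k *v x = ((\<Prod>l\<leftarrow>?ls. inverse (b k - b l)) * (\<Prod>l\<leftarrow>?ls. b j - b l)) *s x"
    unfolding eig_proj_def
    by (simp add: matrix_vector_mul_assoc[symmetric] eig_factors_mult[OF assms(2)] mat_mult_vec)
  moreover have "(\<Prod>l\<leftarrow>?ls. inverse (b k - b l)) * (\<Prod>l\<leftarrow>?ls. b j - b l) = (if j = k then 1 else 0)"
  proof (cases "j = k")
    case True
    \<comment> \<open>Both products run over the same list, so an index that occurs repeatedly in
      \<open>others k\<close> cancels too.\<close>
    have "(\<Prod>l\<leftarrow>ls. inverse (b k - b l)) * (\<Prod>l\<leftarrow>ls. b k - b l) = 1" if "k \<notin> set ls" for ls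
      using that
    proof (induction ls)
      case (Cons l ls)
      have "b k - b l \<noteq> 0" using Cons(2) assms(1) by (auto dest: injD)
      then show ?case using Cons by (simp add: field_simps)
    qed simp
    from this[of ?ls] show ?thesis using True by simp
  next
    case False
    have "(\<Prod>l\<leftarrow>?ls. b j - b l) = 0"
      using False by (subst prod_list_zero_iff) (auto simp: image_iff)
    then show ?thesis using False by simp
  qed
  ultimately show ?thesis by auto
qed

text \<open>Applying the k-th projection to a linear relation among the eigenvectors isolates its
  k-th coefficient.\<close>

lemma eigensystem_span:
  assumes "eigensystem M b (v :: 'r::finite \<Rightarrow> complex^'r::finite)"
  shows "inj v" "vec.independent (range v)" "vec.span (range v) = UNIV"
proof -
  have b: "inj b" and v: "v k \<noteq> 0" "M *v v k = b k *s v k" for k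
    using assms by (auto simp: eigensystem_def)
  have P: "eig_proj M b k *v v j = (if j = k then v j else 0)" for j k by (rule eig_proj_mult[OF b v(2)])
  show inj: "inj v"
  proof (rule injI, rule ccontr)
    fix i j assume "v i = v j" "i \<noteq> j"
    then show False using P[of i i] P[of i j] v(1)[of i] by simp
  qed
  show ind: "vec.independent (range v)"
  proof (rule vec.independent_if_scalars_zero)
    fix c x assume s: "(\<Sum>x\<in>range v. c x *s x) = 0" and x: "x \<in> range v"
    then obtain k where k: "x = v k" by blast
    have "0 = eig_proj M b k *v (\<Sum>j\<in>UNIV. c (v j) *s v j)"
      using s inj by (simp add: sum.reindex)
    also have "\<dots> = (\<Sum>j\<in>UNIV. c (v j) *s (eig_proj M b k *v v j))"
      by (simp add: vec.sum vec.scale)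
    also have "\<dots> = (\<Sum>j\<in>UNIV. if j = k then c (v j) *s v j else 0)"
      by (rule sum.cong) (simp_all add: P)
    also have "\<dots> = c (v k) *s v k" by simp
    finally show "c x = 0" using v(1) k by simp
  qed simp
  have "vec.dim (UNIV :: (complex^'r::finite) set) \<le> card (range v)"
    using inj by (simp only: vec_dim_card card_image)
  then show "vec.span (range v) = UNIV" using vec.card_ge_dim_independent[OF subset_UNIV ind] by blast
qed

lemma eigensystem_ext:
  assumes "eigensystem M b (v :: 'r::finite \<Rightarrow> complex^'r::finite)"
    and "\<And>j. A *v v j = B *v v j"
  shows "A = B"
proof -
  have "A *v x = B *v x" for x
  proof -
    have "x \<in> vec.span (range v)" using eigensystem_span(3)[OF assms(1)] by simp
    then show ?thesis
      by (induction rule: vec.span_induct_alt)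
         (auto simp: matrix_vector_right_distrib vec.scale assms(2))
  qed
  then show ?thesis by (metis matrix_of_matrix_vector_mul ext)
qed

text \<open>Both sides agree on the eigenvectors of M. With a transition matrix as G this yields
  independence of frames; with G = \<open>mat 1\<close> it shows that multiplying a matrix and its
  eigenvalues by a common factor does not change the projections.\<close>

lemma eig_proj_commute:
  assumes v: "eigensystem M b v" and b': "inj b'" and G: "\<And>j. M' *v (G *v v j) = b' j *s (G *v v j)"
  shows "eig_proj M' b' k ** G = G ** eig_proj M b k"
proof (rule eigensystem_ext[OF v])
  fix j
  have "eig_proj M b k *v v j = (if j = k then v j else 0)"
    by (rule eig_proj_mult) (use v in \<open>auto simp: eigensystem_def\<close>)
  then show "eig_proj M' b' k ** G *v v j = G ** eig_proj M b k *v v j"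
    using eig_proj_mult[OF b' G[of j], of k] by (simp add: matrix_vector_mul_assoc[symmetric])
qed

lemma sum_matrix_vector_mult:
  "finite K \<Longrightarrow> (\<Sum>k\<in>K. F k) *v (x :: complex^'r::finite) = (\<Sum>k\<in>K. F k *v x)"
  by (induction K rule: finite_induct) (auto simp: matrix_vector_mult_add_rdistrib)

lemma eig_proj_sum:
  assumes v: "eigensystem M b v"
  shows "(\<Sum>k\<in>UNIV. eig_proj M b k *v x) = x"
proof -
  have "(\<Sum>k\<in>UNIV. eig_proj M b k) = mat 1"
  proof (rule eigensystem_ext[OF v])
    fix j
    have "eig_proj M b k *v v j = (if j = k then v j else 0)" for k
      by (rule eig_proj_mult) (use v in \<open>auto simp: eigensystem_def\<close>)
    then have "(\<Sum>k\<in>UNIV. eig_proj M b k *v v j) = v j" by simp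
    then show "(\<Sum>k\<in>UNIV. eig_proj M b k) *v v j = mat 1 *v v j"
      by (simp add: sum_matrix_vector_mult)
  qed
  then show ?thesis by (metis matrix_vector_mul_lid sum_matrix_vector_mult finite)
qed

lemma eig_proj_right_mult:
  assumes v: "eigensystem M b v"
  shows "eig_proj M b k *v (M *v x) = b k *s (eig_proj M b k *v x)"
proof -
  have "eig_proj M b k ** M = mat (b k) ** eig_proj M b k"
  proof (rule eigensystem_ext[OF v])
    fix j
    have 1: "M *v v j = b j *s v j" using v by (auto simp: eigensystem_def)
    have "eig_proj M b k *v v j = (if j = k then v j else 0)"
      by (rule eig_proj_mult) (use v in \<open>auto simp: eigensystem_def\<close>)
    then show "eig_proj M b k ** M *v v j = mat (b k) ** eig_proj M b k *v v j"
      by (simp add: matrix_vector_mul_assoc[symmetric] 1 vec.scale mat_mult_vec)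
  qed
  then show ?thesis by (metis mat_mult_vec matrix_vector_mul_assoc)
qed

text \<open>Converts the vanishing of components into membership in a subspace of known dimension,
  as the minimax principle requires.\<close>

lemma eig_proj_eq_0_iff:
  assumes v: "eigensystem M b v"
  shows "(\<forall>l\<in>- K. eig_proj M b l *v x = 0) \<longleftrightarrow> x \<in> vec.span (v ` K)"
proof
  have P: "eig_proj M b k *v v j = (if j = k then v j else 0)" for j k
    by (rule eig_proj_mult) (use v in \<open>auto simp: eigensystem_def\<close>)
  {
    fix l assume l: "l \<in> - K" and x: "x \<in> vec.span (v ` K)"
    from x have "eig_proj M b l *v x = 0"
    proof (induction rule: vec.span_induct_alt)
      case (step c y x)
      then have "eig_proj M b l *v y = 0" using P l by auto
      then show ?case using step by (simp add: matrix_vector_right_distrib vec.scale)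
    qed simp
  }
  then show "x \<in> vec.span (v ` K) \<Longrightarrow> \<forall>l\<in>- K. eig_proj M b l *v x = 0" by blast
  have "eig_proj M b k *v x \<in> vec.span {v k}" for x k
  proof -
    have "x \<in> vec.span (range v)" using eigensystem_span(3)[OF v] by simp
    then show ?thesis
    proof (induction rule: vec.span_induct_alt)
      case (step c y x)
      have "eig_proj M b k *v y \<in> vec.span {v k}" using step(1) P by (auto intro: vec.span_base vec.span_zero)
      then show ?case using step
        by (simp add: matrix_vector_right_distrib vec.scale vec.span_add vec.span_scale)
    qed (simp add: vec.span_zero)
  qed
  then have *: "eig_proj M b k *v x \<in> vec.span (v ` K)" if "k \<in> K" for x k
    using vec.span_mono[of "{v k}" "v ` K"] that by auto
  assume z: "\<forall>l\<in>- K. eig_proj M b l *v x = 0"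
  have "(\<Sum>k\<in>UNIV. eig_proj M b k *v x) \<in> vec.span (v ` K)"
    by (rule vec.span_sum) (use * z vec.span_zero in \<open>metis ComplI\<close>)
  then show "x \<in> vec.span (v ` K)" using eig_proj_sum[OF v] by simp
qed

lemma holomorphic_matrix_mult:
  fixes A B :: "complex \<Rightarrow> complex^'r^'r::finite"
  assumes "\<And>i j. (\<lambda>w. A w $ i $ j) holomorphic_on S" "\<And>i j. (\<lambda>w. B w $ i $ j) holomorphic_on S"
  shows "(\<lambda>w. (A w ** B w) $ i $ j) holomorphic_on S"
  unfolding matrix_matrix_mult_def by (simp, intro holomorphic_intros assms)

lemma holomorphic_eig_proj:
  fixes M :: "complex \<Rightarrow> complex^'r^'r::finite"
  assumes M: "\<And>i j. (\<lambda>w. M w $ i $ j) holomorphic_on S" and b: "\<And>l. (\<lambda>w. b l w) holomorphic_on S"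
    and inj: "\<And>w. w \<in> S \<Longrightarrow> inj (\<lambda>l. b l w)"
  shows "(\<lambda>w. eig_proj (M w) (\<lambda>l. b l w) k $ i $ j) holomorphic_on S"
proof -
  have mat: "(\<lambda>w. mat (f w) $ i $ j) holomorphic_on S" if "f holomorphic_on S" for f :: "complex \<Rightarrow> complex" and i j :: 'r
    using that by (cases "i = j") (auto simp: mat_def)
  have 1: "(\<lambda>w. eig_factors (M w) (\<lambda>l. b l w) ls $ i $ j) holomorphic_on S" for ls i j
  proof (induction ls arbitrary: i j)
    case Nil show ?case by (simp add: mat)
  next
    case (Cons l ls)
    show ?case unfolding eig_factors.simps
    proof (rule holomorphic_matrix_mult)
      show "(\<lambda>w. (M w - mat (b l w)) $ i $ j) holomorphic_on S" for i j
        by (simp, intro holomorphic_intros M mat b)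
    qed (rule Cons)
  qed
  have 2: "(\<lambda>w. \<Prod>l\<leftarrow>ls. inverse (b k w - b l w)) holomorphic_on S" if "k \<notin> set ls" for ls
    using that
  proof (induction ls)
    case (Cons l ls)
    have "b k w - b l w \<noteq> 0" if "w \<in> S" for w using inj[OF that] Cons(2) by (auto dest: injD)
    then show ?case using Cons b by (auto intro!: holomorphic_intros)
  qed simp
  show ?thesis unfolding eig_proj_def
    by (intro holomorphic_matrix_mult 1 mat 2) simp
qed

section \<open>Transported sections\<close>

locale flat_bundle =
  fixes U :: "('i, 'a::t2_space) cover" and z :: "('i, 'a) coords"
    and g :: "('i, 'a, 'r::finite) transitions" and \<Phi> A :: "('i, 'a, 'r) matrices"
    and p :: "'b::t2_space \<Rightarrow> 'a"
  assumes surface: "riemann_surface U z" and hol_bundle: "holomorphic_bundle U z g"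
    and higgs: "higgs_field U z g \<Phi>" and connection: "holomorphic_connection U z g A"
    and cover: "covering_space (UNIV :: 'b set) p (UNIV :: 'a set)"
begin

section \<open>Charts, sheets of the covering, and the transport equation in coordinates\<close>

abbreviation coord_inv :: "'i \<Rightarrow> complex \<Rightarrow> 'a" where "coord_inv i \<equiv> the_inv_into (U i) (z i)"

lemma U_cover: "\<exists>i. x \<in> U i"
  using surface unfolding riemann_surface_def by blast

lemma open_U: "open (U i)" and open_coord: "open (z i ` U i)"
  using surface unfolding riemann_surface_def by blast+

lemma coord_homeo: "inj_on (z i) (U i)" "continuous_on (U i) (z i)" "continuous_on (z i ` U i) (coord_inv i)"
proof -
  obtain y where y: "homeomorphism (U i) (z i ` U i) (z i) y"
    using surface unfolding riemann_surface_def by blast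
  show inj: "inj_on (z i) (U i)" by (rule inj_on_inverseI) (use y in \<open>auto simp: homeomorphism_def\<close>)
  show "continuous_on (U i) (z i)" using y by (simp add: homeomorphism_def)
  have "coord_inv i w = y w" if "w \<in> z i ` U i" for w
    using that y inj by (auto simp: homeomorphism_def the_inv_into_f_f)
  then show "continuous_on (z i ` U i) (coord_inv i)"
    using y continuous_on_cong[of "z i ` U i" _ "coord_inv i" y] by (simp add: homeomorphism_def)
qed

lemma coord_inv_coord [simp]: "x \<in> U i \<Longrightarrow> coord_inv i (z i x) = x"
  using coord_homeo(1) the_inv_into_f_f by metis

lemma coord_coord_inv: "w \<in> z i ` U i \<Longrightarrow> z i (coord_inv i w) = w"
  by auto

lemma open_coord_image:
  assumes "open W" "W \<subseteq> U i"
  shows "open (z i ` W)"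
proof -
  have "z i ` W = z i ` U i \<inter> coord_inv i -` W"
  proof (intro set_eqI iffI)
    fix w assume "w \<in> z i ` W"
    then show "w \<in> z i ` U i \<inter> coord_inv i -` W" using assms(2) by auto
  next
    fix w assume "w \<in> z i ` U i \<inter> coord_inv i -` W"
    then show "w \<in> z i ` W" using coord_coord_inv by (metis IntE imageI vimageE)
  qed
  then show ?thesis using continuous_open_preimage[OF coord_homeo(3) open_coord assms(1)] by simp
qed

lemma p_cont: "continuous_on S p"
  using covering_space_imp_continuous[OF cover] continuous_on_subset by blast

lemma open_p_preimage: "open W \<Longrightarrow> open (p -` W)"
  using p_cont[of UNIV] open_vimage by (simp add: open_vimage continuous_on_eq_continuous_within)

lemma local_homeomorphism: "\<exists>T u q. Q \<in> T \<and> open T \<and> open u \<and> homeomorphism T u p q"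
proof -
  have "\<exists>T. p Q \<in> T \<and> openin (top_of_set UNIV) T \<and> (\<exists>v. \<Union>v = UNIV \<inter> p -` T \<and>
      (\<forall>u\<in>v. openin (top_of_set UNIV) u) \<and> pairwise disjnt v \<and> (\<forall>u\<in>v. \<exists>q. homeomorphism u T p q))"
    using cover unfolding covering_space_def by blast
  then obtain T v where T': "p Q \<in> T" "openin (top_of_set UNIV) T" "\<Union>v = UNIV \<inter> p -` T"
    "\<forall>u\<in>v. openin (top_of_set UNIV) u" "pairwise disjnt v" "\<forall>u\<in>v. \<exists>q. homeomorphism u T p q"
    by (elim exE conjE) (rule that)
  have "Q \<in> \<Union>v" unfolding T'(3) using T'(1) by simp
  then obtain u where u: "u \<in> v" "Q \<in> u" by (rule UnionE)
  obtain q where q: "homeomorphism u T p q" using bspec[OF T'(6) u(1)] by (elim exE) (rule that)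
  show ?thesis
  proof (intro exI conjI)
    show "Q \<in> u" by fact
    show "open u" using bspec[OF T'(4) u(1)] by simp
    show "open T" using T'(2) by simp
    show "homeomorphism u T p q" by fact
  qed
qed

lemma open_p_image:
  assumes "open V"
  shows "open (p ` V)"
proof (subst open_subopen, rule ballI)
  fix x assume "x \<in> p ` V"
  then obtain Q where Q: "Q \<in> V" "x = p Q" by blast
  obtain T u q where T: "Q \<in> T" "open T" "open u" "homeomorphism T u p q"
    using local_homeomorphism[of Q] by (elim exE conjE) (rule that)
  have "open (u \<inter> q -` (V \<inter> T))"
    by (rule continuous_open_preimage) (use T assms in \<open>auto simp: homeomorphism_def\<close>)
  moreover have "x \<in> u \<inter> q -` (V \<inter> T)" using Q T by (auto simp: homeomorphism_def)
  moreover have "u \<inter> q -` (V \<inter> T) \<subseteq> p ` V"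
  proof
    fix y assume "y \<in> u \<inter> q -` (V \<inter> T)"
    then have "y = p (q y)" "q y \<in> V" using T(4) by (auto simp: homeomorphism_def)
    then show "y \<in> p ` V" by blast
  qed
  ultimately show "\<exists>W. open W \<and> x \<in> W \<and> W \<subseteq> p ` V" by blast
qed

text \<open>The sign convention solved for the derivative: ds/dw = (t \<Phi> - A) s.\<close>

definition ode_matrix :: "real \<Rightarrow> 'i \<Rightarrow> complex \<Rightarrow> complex^'r^'r" where
  "ode_matrix t i w = (\<chi> k l. of_real t * \<Phi> i (coord_inv i w) $ k $ l - A i (coord_inv i w) $ k $ l)"

lemma matrix_holomorphic:
  "(\<lambda>w. \<Phi> i (coord_inv i w) $ k $ l) holomorphic_on z i ` U i"
  "(\<lambda>w. A i (coord_inv i w) $ k $ l) holomorphic_on z i ` U i"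
  using higgs connection
  unfolding higgs_field_def holomorphic_connection_def chart_holomorphic_on_def in_chart_def comp_def
  by simp_all

lemma ode_matrix_holomorphic: "(\<lambda>w. ode_matrix t i w $ k $ l) holomorphic_on z i ` U i"
  unfolding ode_matrix_def by (simp, intro holomorphic_intros matrix_holomorphic)

lemma ode_matrix_mult:
  "ode_matrix t i w *v x = of_real t *s (\<Phi> i (coord_inv i w) *v x) - A i (coord_inv i w) *v x"
  unfolding ode_matrix_def matrix_vector_mult_def
  by (simp add: vec_eq_iff algebra_simps sum_subtractf sum_distrib_left)

lemma ode_matrix_continuous: "S \<subseteq> z i ` U i \<Longrightarrow> continuous_on S (\<lambda>w. ode_matrix t i w $ k $ l)"
  by (rule continuous_on_subset[OF holomorphic_on_imp_continuous_on[OF ode_matrix_holomorphic]])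

lemma transition_holomorphic: "(\<lambda>w. z i (coord_inv j w)) holomorphic_on z j ` (U i \<inter> U j)"
  using surface unfolding riemann_surface_def in_chart_def comp_def by blast

lemma transition_deriv:
  assumes "x \<in> U i" "x \<in> U j"
  shows "((\<lambda>w. z i (coord_inv j w)) has_field_derivative chart_deriv U z j (z i) x) (at (z j x))"
proof -
  have "open (z j ` (U i \<inter> U j))" by (rule open_coord_image) (auto intro: open_Int open_U)
  then have "((\<lambda>w. z i (coord_inv j w)) has_field_derivative deriv (\<lambda>w. z i (coord_inv j w)) (z j x)) (at (z j x))"
    using holomorphic_derivI[OF transition_holomorphic[of i j]] assms by blast
  then show ?thesis unfolding chart_deriv_def in_chart_def comp_def .
qed

lemma transition_deriv_inverse:
  assumes "x \<in> U i" "x \<in> U j"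
  shows "chart_deriv U z j (z i) x * chart_deriv U z i (z j) x = 1"
proof -
  have o: "open (z i ` (U i \<inter> U j))" by (rule open_coord_image) (auto intro: open_Int open_U)
  have 1: "((\<lambda>w. z i (coord_inv j w)) has_field_derivative chart_deriv U z j (z i) x) (at (z j (coord_inv i (z i x))))"
    using transition_deriv[OF assms] assms by simp
  have "((\<lambda>w. z i (coord_inv j (z j (coord_inv i w)))) has_field_derivative
      chart_deriv U z j (z i) x * chart_deriv U z i (z j) x) (at (z i x))"
    by (rule DERIV_chain2[OF 1 transition_deriv[OF assms(2,1)]])
  moreover have "((\<lambda>w. z i (coord_inv j (z j (coord_inv i w)))) has_field_derivative 1) (at (z i x))"
    by (rule has_field_derivative_transform_within_open[OF DERIV_ident o])
       (use assms in auto)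
  ultimately show ?thesis by (rule DERIV_unique)
qed

lemma g_id: "x \<in> U i \<Longrightarrow> g i i x = mat 1"
  and g_cocycle: "x \<in> U i \<Longrightarrow> x \<in> U j \<Longrightarrow> x \<in> U k \<Longrightarrow> g i j x ** g j k x = g i k x"
  using hol_bundle unfolding holomorphic_bundle_def by blast+

lemma g_cocycle_vec: "x \<in> U i \<Longrightarrow> x \<in> U j \<Longrightarrow> x \<in> U k \<Longrightarrow> g i j x *v (g j k x *v v) = g i k x *v v"
  by (simp add: matrix_vector_mul_assoc g_cocycle)

lemma g_deriv:
  assumes "x \<in> U i" "x \<in> U j"
  shows "((\<lambda>w. g i j (coord_inv j w) $ k $ l) has_field_derivative chart_deriv U z j (\<lambda>y. g i j y $ k $ l) x) (at (z j x))"
proof -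
  have o: "open (z j ` (U i \<inter> U j))" by (rule open_coord_image) (auto intro: open_Int open_U)
  have "(\<lambda>w. g i j (coord_inv j w) $ k $ l) holomorphic_on z j ` (U i \<inter> U j)"
    using hol_bundle unfolding holomorphic_bundle_def chart_holomorphic_on_def in_chart_def comp_def
    by (simp add: Int_assoc)
  from holomorphic_derivI[OF this o] show ?thesis
    using assms unfolding chart_deriv_def in_chart_def comp_def by blast
qed

abbreviation transported :: "real \<Rightarrow> ('b \<Rightarrow> 'i \<Rightarrow> complex^'r) \<Rightarrow> bool" where
  "transported \<equiv> transported_section U z g A \<Phi> p"

text \<open>The section is written as a solution y of the equation in the chart, composed with the
  coordinate and \<open>p\<close>. No inverse of a sheet occurs, which makes restriction and gluing
  easy.\<close>

definition solution_at :: "real \<Rightarrow> 'b \<Rightarrow> 'i \<Rightarrow> ('b \<Rightarrow> 'i \<Rightarrow> complex^'r) \<Rightarrow> bool" where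
  "solution_at t Q i s \<longleftrightarrow> (\<exists>S y V. open S \<and> S \<subseteq> z i ` U i \<and> linear_ode_on (ode_matrix t i) S y \<and>
     open V \<and> Q \<in> V \<and> (\<forall>Q'\<in>V. p Q' \<in> U i \<and> z i (p Q') \<in> S \<and> s Q' i = y (z i (p Q'))))"

lemma solution_atE:
  assumes "solution_at t Q i s"
  obtains S y V where "open S" "S \<subseteq> z i ` U i" "linear_ode_on (ode_matrix t i) S y" "open V" "Q \<in> V"
    "\<forall>Q'\<in>V. p Q' \<in> U i \<and> z i (p Q') \<in> S \<and> s Q' i = y (z i (p Q'))"
  using assms unfolding solution_at_def by (elim exE conjE) (rule that)

lemma solution_atI:
  assumes "open S" "S \<subseteq> z i ` U i" "linear_ode_on (ode_matrix t i) S y" "open V" "Q \<in> V"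
    "\<And>Q'. Q' \<in> V \<Longrightarrow> p Q' \<in> U i" "\<And>Q'. Q' \<in> V \<Longrightarrow> z i (p Q') \<in> S"
    "\<And>Q'. Q' \<in> V \<Longrightarrow> s Q' i = y (z i (p Q'))"
  shows "solution_at t Q i s"
  unfolding solution_at_def
  by (rule exI[of _ S], rule exI[of _ y], rule exI[of _ V]) (simp add: assms)

text \<open>The transformation laws of connection and Higgs field express that g y solves the
  transport equation in the new frame. The factor dz_i/dz_j in these laws cancels against dz_j/dz_i
  from the chain rule.\<close>

lemma ode_frame_change:
  assumes S: "S \<subseteq> z j ` U j" and y: "linear_ode_on (ode_matrix t j) S y"
    and x: "x \<in> U i" "x \<in> U j" "z j x \<in> S" and w: "w = z i x"
  shows "((\<lambda>w. (g i j (coord_inv i w) *v y (z j (coord_inv i w))) $ k) has_field_derivative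
    (ode_matrix t i w *v (g i j x *v y (z j x))) $ k) (at w)"
proof -
  let ?c = "chart_deriv U z j (z i) x" and ?d = "chart_deriv U z i (z j) x"
  let ?G' = "\<chi> k l. chart_deriv U z j (\<lambda>y. g i j y $ k $ l) x" and ?G = "g i j x"
  let ?y = "y (z j x)"
  have "((\<lambda>w. \<Sum>l\<in>UNIV. g i j (coord_inv j w) $ k $ l * y w $ l) has_field_derivative
     (\<Sum>l\<in>UNIV. ?G' $ k $ l * ?y $ l + (ode_matrix t j (z j x) *v ?y) $ l * ?G $ k $ l)) (at (z j x))"
  proof (rule DERIV_sum)
    fix l
    have 1: "((\<lambda>w. g i j (coord_inv j w) $ k $ l) has_field_derivative ?G' $ k $ l) (at (z j x))"
      using g_deriv[OF x(1,2)] by simp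
    have 2: "((\<lambda>w. y w $ l) has_field_derivative (ode_matrix t j (z j x) *v ?y) $ l) (at (z j x))"
      using y x(3) unfolding linear_ode_on_def by blast
    show "((\<lambda>w. g i j (coord_inv j w) $ k $ l * y w $ l) has_field_derivative
      ?G' $ k $ l * ?y $ l + (ode_matrix t j (z j x) *v ?y) $ l * ?G $ k $ l) (at (z j x))"
      using DERIV_mult[OF 1 2] x(2) by simp
  qed
  then have 1: "((\<lambda>w. \<Sum>l\<in>UNIV. g i j (coord_inv j w) $ k $ l * y w $ l) has_field_derivative
     (?G' *v ?y + ?G *v (ode_matrix t j (z j x) *v ?y)) $ k) (at (z j (coord_inv i (z i x))))"
    using x(1) by (simp add: matrix_vector_mult_def sum.distrib mult.commute)
  \<comment> \<open>The derivative of the transition matrix is absorbed by the inhomogeneous term of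
    the connection law; the Higgs law is tensorial.\<close>
  have eq: "?G' *v ?y + ?G *v (ode_matrix t j (z j x) *v ?y) = ?c *s (ode_matrix t i (z i x) *v (?G *v ?y))"
  proof -
    have A: "?G' + mat ?c ** A i x ** ?G = ?G ** A j x"
      using connection x unfolding holomorphic_connection_def by blast
    have P: "mat ?c ** \<Phi> i x ** ?G = ?G ** \<Phi> j x"
      using higgs x unfolding higgs_field_def by blast
    have A': "?G *v (A j x *v ?y) = ?G' *v ?y + ?c *s (A i x *v (?G *v ?y))"
      using arg_cong[OF A, of "\<lambda>M. M *v ?y"]
      by (simp add: matrix_vector_mult_add_rdistrib matrix_vector_mul_assoc[symmetric] mat_mult_vec)
    have P': "?G *v (\<Phi> j x *v ?y) = ?c *s (\<Phi> i x *v (?G *v ?y))"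
      using arg_cong[OF P, of "\<lambda>M. M *v ?y"] by (simp add: matrix_vector_mul_assoc[symmetric] mat_mult_vec)
    show ?thesis using x
      by (simp add: ode_matrix_mult matrix_vector_mult_diff_distrib vec.scale A' P')
  qed
  have 2: "((\<lambda>w. z j (coord_inv i w)) has_field_derivative ?d) (at (z i x))"
    by (rule transition_deriv[OF x(2,1)])
  have 3: "((\<lambda>w. \<Sum>l\<in>UNIV. g i j (coord_inv j (z j (coord_inv i w))) $ k $ l * y (z j (coord_inv i w)) $ l)
      has_field_derivative (?c *s (ode_matrix t i (z i x) *v (?G *v ?y))) $ k * ?d) (at (z i x))"
    using DERIV_chain2[OF 1 2] unfolding eq .
  have "(?c *s (ode_matrix t i (z i x) *v (?G *v ?y))) $ k * ?d = (ode_matrix t i (z i x) *v (?G *v ?y)) $ k"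
  proof -
    have "(?c *s (ode_matrix t i (z i x) *v (?G *v ?y))) $ k * ?d = (?c * ?d) * (ode_matrix t i (z i x) *v (?G *v ?y)) $ k"
      by simp
    then show ?thesis unfolding transition_deriv_inverse[OF x(1,2)] by simp
  qed
  note 3 = 3[unfolded this]
  have o: "open (z i ` (U i \<inter> U j))" by (rule open_coord_image) (auto intro: open_Int open_U)
  show ?thesis unfolding w
  proof (rule has_field_derivative_transform_within_open[OF 3 o])
    show "z i x \<in> z i ` (U i \<inter> U j)" using x by blast
    fix w assume "w \<in> z i ` (U i \<inter> U j)"
    then show "(\<Sum>l\<in>UNIV. g i j (coord_inv j (z j (coord_inv i w))) $ k $ l * y (z j (coord_inv i w)) $ l)
      = (g i j (coord_inv i w) *v y (z j (coord_inv i w))) $ k"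
      by (auto simp: matrix_vector_mult_def)
  qed
qed

lemma solution_at_frame_change:
  assumes s: "solution_at t Q j s" and Q: "p Q \<in> U i" "open N" "Q \<in> N"
    and gs: "\<And>Q'. Q' \<in> N \<Longrightarrow> p Q' \<in> U i \<Longrightarrow> p Q' \<in> U j \<Longrightarrow> s Q' i = g i j (p Q') *v s Q' j"
  shows "solution_at t Q i s"
proof -
  obtain S y V where **: "open S" "S \<subseteq> z j ` U j" "linear_ode_on (ode_matrix t j) S y" "open V" "Q \<in> V"
    "\<forall>Q'\<in>V. p Q' \<in> U j \<and> z j (p Q') \<in> S \<and> s Q' j = y (z j (p Q'))" by (rule solution_atE[OF s])
  note * = **(1-5) bspec[OF **(6), THEN conjunct1] bspec[OF **(6), THEN conjunct2, THEN conjunct1]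
    bspec[OF **(6), THEN conjunct2, THEN conjunct2]
  define W where "W = U i \<inter> (U j \<inter> z j -` S)"
  have W: "open W" unfolding W_def
    by (intro open_Int open_U continuous_open_preimage[OF coord_homeo(2) open_U *(1)])
  show ?thesis
  proof (rule solution_atI)
    show "open (z i ` W)" by (rule open_coord_image[OF W]) (auto simp: W_def)
    show "z i ` W \<subseteq> z i ` U i" by (auto simp: W_def)
    show "linear_ode_on (ode_matrix t i) (z i ` W) (\<lambda>w. g i j (coord_inv i w) *v y (z j (coord_inv i w)))"
      unfolding linear_ode_on_def
    proof (intro ballI allI)
      fix w k assume "w \<in> z i ` W"
      then obtain x where x: "x \<in> U i" "x \<in> U j" "z j x \<in> S" "w = z i x" by (auto simp: W_def)
      then have xx: "coord_inv i w = x" by simp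
      show "((\<lambda>w. (g i j (coord_inv i w) *v y (z j (coord_inv i w))) $ k) has_field_derivative
          (ode_matrix t i w *v (g i j (coord_inv i w) *v y (z j (coord_inv i w)))) $ k) (at w)"
        unfolding xx by (rule ode_frame_change[OF *(2,3) x])
    qed
    show "open (V \<inter> N \<inter> p -` U i)" using * Q open_p_preimage[OF open_U] by (intro open_Int) auto
    show "Q \<in> V \<inter> N \<inter> p -` U i" using * Q by simp
    fix Q' assume Q': "Q' \<in> V \<inter> N \<inter> p -` U i"
    then show "p Q' \<in> U i" by simp
    then have "p Q' \<in> W" using Q' *(6,7)[of Q'] by (simp add: W_def)
    then show "z i (p Q') \<in> z i ` W" by simp
    show "s Q' i = g i j (coord_inv i (z i (p Q'))) *v y (z j (coord_inv i (z i (p Q'))))"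
      using gs[of Q'] Q' *(6,8)[of Q'] by simp
  qed
qed

lemma local_sheet:
  obtains V where "open V" "Q \<in> V" "inj_on p V" "continuous_on (p ` V) (the_inv_into V p)"
proof -
  obtain T u q where T: "Q \<in> T" "open T" "open u" "homeomorphism T u p q"
    using local_homeomorphism[of Q] by (elim exE conjE) (rule that)
  have inj: "inj_on p T" by (rule inj_on_inverseI) (use T in \<open>auto simp: homeomorphism_def\<close>)
  have "the_inv_into T p x = q x" if "x \<in> p ` T" for x
    using that inj T(4) by (auto simp: homeomorphism_def the_inv_into_f_f)
  moreover have "continuous_on (p ` T) q" using T(4) by (simp add: homeomorphism_def)
  ultimately have "continuous_on (p ` T) (the_inv_into T p)" by (metis continuous_on_eq)
  from that[OF T(2,1) inj this] show ?thesis .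
qed

text \<open>The definition speaks about all injective sheets; the local form only asks for one chart
  solution near each point and is what Picard iteration produces.\<close>

lemma transported_section_iff:
  "transported t s \<longleftrightarrow>
     (\<forall>Q i j. p Q \<in> U i \<inter> U j \<longrightarrow> s Q i = g i j (p Q) *v s Q j) \<and>
     (\<forall>Q i. p Q \<in> U i \<longrightarrow> solution_at t Q i s)" (is "?L \<longleftrightarrow> ?C \<and> ?R")
proof (intro iffI conjI)
  assume L: ?L
  then show ?C unfolding transported_section_def by blast
  show ?R
  proof (intro allI impI)
    fix Q i assume Q: "p Q \<in> U i"
    obtain V0 where V0: "open V0" "Q \<in> V0" "inj_on p V0" "continuous_on (p ` V0) (the_inv_into V0 p)"
      by (rule local_sheet)
    define V where "V = V0 \<inter> p -` U i"
    have V: "open V" "Q \<in> V" "inj_on p V" "p ` V \<subseteq> U i"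
      using V0 Q open_p_preimage[OF open_U] by (auto simp: V_def intro: inj_on_subset)
    have inj: "inj_on (z i \<circ> p) V" using V coord_homeo(1) by (intro comp_inj_on) (auto intro: inj_on_subset)
    let ?y = "\<lambda>w. s (the_inv_into V (z i \<circ> p) w) i"
    show "solution_at t Q i s"
    proof (rule solution_atI[where S = "z i ` p ` V" and y = ?y and V = V])
      show "open (z i ` p ` V)" by (rule open_coord_image) (use V open_p_image in auto)
      show "z i ` p ` V \<subseteq> z i ` U i" using V by auto
      show "linear_ode_on (ode_matrix t i) (z i ` p ` V) ?y" unfolding linear_ode_on_def
      proof (intro ballI allI)
        fix w k assume "w \<in> z i ` p ` V"
        then obtain Q' where Q': "Q' \<in> V" "w = z i (p Q')" by blast
        have pQ': "p Q' \<in> U i" using Q' V by auto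
        have inv: "the_inv_into V (z i \<circ> p) w = Q'" using the_inv_into_f_f[OF inj Q'(1)] Q'(2) by simp
        obtain s' where s': "\<And>k. ((\<lambda>w. s (the_inv_into V (z i \<circ> p) w) i $ k) has_field_derivative s' $ k)
             (at (z i (p Q')))" "s' + A i (p Q') *v s Q' i = of_real t *s (\<Phi> i (p Q') *v s Q' i)"
          using L V Q'(1) unfolding transported_section_def by blast
        have "s' = ode_matrix t i w *v s Q' i"
          using s'(2) pQ' Q'(2) by (simp add: ode_matrix_mult algebra_simps)
        then show "((\<lambda>w. ?y w $ k) has_field_derivative (ode_matrix t i w *v ?y w) $ k) (at w)"
          using s'(1)[of k] inv Q'(2) by simp
      qed
      show "open V" "Q \<in> V" by fact+
      fix Q' assume Q': "Q' \<in> V"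
      show "p Q' \<in> U i" "z i (p Q') \<in> z i ` p ` V" using Q' V by auto
      show "s Q' i = ?y (z i (p Q'))" using the_inv_into_f_f[OF inj Q'] by simp
    qed
  qed
next
  assume CR: "?C \<and> ?R"
  show ?L unfolding transported_section_def
  proof (intro conjI)
    show ?C using CR by blast
    show "\<forall>i V. open V \<and> inj_on p V \<and> p ` V \<subseteq> U i \<longrightarrow>
        (\<forall>Q \<in> V. \<exists>s'. (\<forall>k. ((\<lambda>w. s (the_inv_into V (z i \<circ> p) w) i $ k) has_field_derivative s' $ k)
                  (at (z i (p Q)))) \<and> s' + A i (p Q) *v s Q i = of_real t *s (\<Phi> i (p Q) *v s Q i))"
    proof (intro allI impI ballI)
      fix i V Q assume V: "open V \<and> inj_on p V \<and> p ` V \<subseteq> U i" and Q: "Q \<in> V"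
      have pQ: "p Q \<in> U i" using V Q by auto
      have inj: "inj_on (z i \<circ> p) V" using V coord_homeo(1) by (intro comp_inj_on) (auto intro: inj_on_subset)
      have "solution_at t Q i s" using CR pQ by blast
      then obtain S y V' where **: "open S" "S \<subseteq> z i ` U i" "linear_ode_on (ode_matrix t i) S y" "open V'"
        "Q \<in> V'" "\<forall>Q'\<in>V'. p Q' \<in> U i \<and> z i (p Q') \<in> S \<and> s Q' i = y (z i (p Q'))" by (rule solution_atE)
      note * = **(1-5) bspec[OF **(6), THEN conjunct1] bspec[OF **(6), THEN conjunct2, THEN conjunct1]
        bspec[OF **(6), THEN conjunct2, THEN conjunct2]
      have o: "open (z i ` p ` (V \<inter> V'))"
        by (intro open_coord_image open_p_image open_Int) (use V *(4) in auto)
      let ?s' = "ode_matrix t i (z i (p Q)) *v y (z i (p Q))"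
      show "\<exists>s'. (\<forall>k. ((\<lambda>w. s (the_inv_into V (z i \<circ> p) w) i $ k) has_field_derivative s' $ k)
                  (at (z i (p Q)))) \<and> s' + A i (p Q) *v s Q i = of_real t *s (\<Phi> i (p Q) *v s Q i)"
      proof (intro exI[of _ ?s'] conjI allI)
        fix k
        have "((\<lambda>w. y w $ k) has_field_derivative ?s' $ k) (at (z i (p Q)))"
          using *(3) *(7)[OF *(5)] unfolding linear_ode_on_def by blast
        then show "((\<lambda>w. s (the_inv_into V (z i \<circ> p) w) i $ k) has_field_derivative ?s' $ k) (at (z i (p Q)))"
        proof (rule has_field_derivative_transform_within_open[OF _ o])
          show "z i (p Q) \<in> z i ` p ` (V \<inter> V')" using Q *(5) by blast
          fix w assume "w \<in> z i ` p ` (V \<inter> V')"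
          then obtain Q' where Q': "Q' \<in> V" "Q' \<in> V'" "w = z i (p Q')" by blast
          have "the_inv_into V (z i \<circ> p) w = Q'" using the_inv_into_f_f[OF inj Q'(1)] Q'(3) by simp
          then show "y w $ k = s (the_inv_into V (z i \<circ> p) w) i $ k" using *(8)[OF Q'(2)] Q'(3) by simp
        qed
        show "?s' + A i (p Q) *v s Q i = of_real t *s (\<Phi> i (p Q) *v s Q i)"
          using *(8)[OF *(5)] pQ by (simp add: ode_matrix_mult)
      qed
    qed
  qed
qed

text \<open>A vector of the fibre is stored as its components in all frames at once. Components in
  frames not defined at \<open>p Q\<close> are set to 0, so that equality of vectors is equality of
  functions.\<close>

definition fibre :: "'b \<Rightarrow> ('i \<Rightarrow> complex^'r) set" where
  "fibre Q = {v. (\<forall>i j. p Q \<in> U i \<and> p Q \<in> U j \<longrightarrow> v i = g i j (p Q) *v v j) \<and> (\<forall>i. p Q \<notin> U i \<longrightarrow> v i = 0)}"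

definition flat_on :: "real \<Rightarrow> 'b set \<Rightarrow> ('b \<Rightarrow> 'i \<Rightarrow> complex^'r) \<Rightarrow> bool" where
  "flat_on t V s \<longleftrightarrow> open V \<and> (\<forall>Q\<in>V. s Q \<in> fibre Q) \<and> (\<forall>Q\<in>V. \<forall>i. p Q \<in> U i \<longrightarrow> solution_at t Q i s)"

lemma fibre_frame: "v \<in> fibre Q \<Longrightarrow> p Q \<in> U i \<Longrightarrow> p Q \<in> U j \<Longrightarrow> v i = g i j (p Q) *v v j"
  unfolding fibre_def by blast

lemma fibre_eqI:
  assumes "v \<in> fibre Q" "v' \<in> fibre Q" "p Q \<in> U i" "v i = v' i"
  shows "v = v'"
proof
  fix j
  show "v j = v' j"
  proof (cases "p Q \<in> U j")
    case True
    show ?thesis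
      unfolding fibre_frame[OF assms(1) True assms(3)] fibre_frame[OF assms(2) True assms(3)] assms(4) ..
  next
    case False
    then show ?thesis using assms(1,2) unfolding fibre_def by simp
  qed
qed

definition spread :: "'i \<Rightarrow> 'b \<Rightarrow> complex^'r \<Rightarrow> 'i \<Rightarrow> complex^'r" where
  "spread i Q v j = (if p Q \<in> U j then g j i (p Q) *v v else 0)"

lemma spread_fibre: "p Q \<in> U i \<Longrightarrow> spread i Q v \<in> fibre Q"
  unfolding fibre_def spread_def by (simp add: g_cocycle_vec)

lemma spread_self: "p Q \<in> U i \<Longrightarrow> spread i Q v i = v"
  by (simp add: spread_def g_id)

text \<open>On the part of a neighbourhood lying over a small coordinate disc, agreement at a single
  point propagates by uniqueness for the linear equation.\<close>

lemma flat_on_sep: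
  assumes s: "flat_on t V s" "flat_on t V' s'" and x: "x \<in> V" "x \<in> V'"
  shows "\<exists>N. open N \<and> x \<in> N \<and> ((\<forall>y\<in>N. s y = s' y) \<or> (\<forall>y\<in>N. s y \<noteq> s' y))"
proof -
  obtain i where i: "p x \<in> U i" using U_cover by blast
  have sol: "solution_at t x i s" "solution_at t x i s'" using s x i unfolding flat_on_def by blast+
  obtain S y W where 1: "open S" "S \<subseteq> z i ` U i" "linear_ode_on (ode_matrix t i) S y" "open W" "x \<in> W"
    "\<forall>Q'\<in>W. p Q' \<in> U i \<and> z i (p Q') \<in> S \<and> s Q' i = y (z i (p Q'))" by (rule solution_atE[OF sol(1)])
  obtain S' y' W' where 2: "open S'" "S' \<subseteq> z i ` U i" "linear_ode_on (ode_matrix t i) S' y'" "open W'" "x \<in> W'"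
    "\<forall>Q'\<in>W'. p Q' \<in> U i \<and> z i (p Q') \<in> S' \<and> s' Q' i = y' (z i (p Q'))" by (rule solution_atE[OF sol(2)])
  have "open (S \<inter> S')" "z i (p x) \<in> S \<inter> S'" using 1 2 by auto
  then obtain r where r: "r > 0" "ball (z i (p x)) r \<subseteq> S \<inter> S'" unfolding open_contains_ball by blast
  let ?B = "ball (z i (p x)) r"
  have ode: "linear_ode_on (ode_matrix t i) ?B y" "linear_ode_on (ode_matrix t i) ?B y'"
    using 1(3) 2(3) r(2) unfolding linear_ode_on_def by blast+
  have un: "y w' = y' w'" if "w \<in> ?B" "y w = y' w" "w' \<in> ?B" for w w'
    by (rule linear_ode_unique[OF open_ball connected_ball ode_matrix_continuous ode that])
       (use r(2) 1(2) in blast)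
  define N where "N = V \<inter> V' \<inter> (W \<inter> W' \<inter> p -` (U i \<inter> z i -` ?B))"
  have "open (U i \<inter> z i -` ?B)" by (rule continuous_open_preimage[OF coord_homeo(2) open_U open_ball])
  then have "open (p -` (U i \<inter> z i -` ?B))" by (rule open_p_preimage)
  moreover have "open V" "open V'" using s unfolding flat_on_def by blast+
  ultimately have "open N" unfolding N_def using 1(4) 2(4) by (intro open_Int)
  moreover have "x \<in> N" unfolding N_def using x 1(5) 2(5) i r(1) by simp
  moreover have iff: "s Q' = s' Q' \<longleftrightarrow> y (z i (p Q')) = y' (z i (p Q'))" "z i (p Q') \<in> ?B" if "Q' \<in> N" for Q'
  proof -
    have m: "Q' \<in> V" "Q' \<in> V'" "Q' \<in> W" "Q' \<in> W'" "p Q' \<in> U i" "z i (p Q') \<in> ?B" using that by (auto simp: N_def)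
    have f: "s Q' \<in> fibre Q'" "s' Q' \<in> fibre Q'" using s m(1,2) unfolding flat_on_def by blast+
    have e: "s Q' i = y (z i (p Q'))" "s' Q' i = y' (z i (p Q'))"
      using bspec[OF 1(6) m(3)] bspec[OF 2(6) m(4)] by simp_all
    show "s Q' = s' Q' \<longleftrightarrow> y (z i (p Q')) = y' (z i (p Q'))"
      using fibre_eqI[OF f m(5)] e by metis
    show "z i (p Q') \<in> ?B" by (rule m(6))
  qed
  moreover have "(\<forall>Q'\<in>N. s Q' = s' Q') \<or> (\<forall>Q'\<in>N. s Q' \<noteq> s' Q')"
  proof (cases "\<exists>Q'\<in>N. s Q' = s' Q'")
    case True
    then obtain Q0 where Q0: "Q0 \<in> N" "s Q0 = s' Q0" by blast
    have "s Q' = s' Q'" if "Q' \<in> N" for Q'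
      using un[of "z i (p Q0)" "z i (p Q')"] iff[OF Q0(1)] iff[OF that] Q0(2) by simp
    then show ?thesis by blast
  qed blast
  ultimately show ?thesis by (intro exI[of _ N]) simp
qed

text \<open>V is the part of a sheet over a small coordinate disc: path connected as a continuous
  image of the disc, and Picard iteration works on all of it from any initial point. The solution
  found in one frame is spread to the others.\<close>

lemma flat_on_ex:
  "\<exists>V. open V \<and> x \<in> V \<and> path_connected V \<and> (\<forall>q\<in>V. \<forall>v\<in>fibre q. \<exists>s. flat_on t V s \<and> s q = v)"
proof -
  obtain i where i: "p x \<in> U i" using U_cover by blast
  obtain V0 where V0: "open V0" "x \<in> V0" "inj_on p V0" "continuous_on (p ` V0) (the_inv_into V0 p)"
    by (rule local_sheet)
  define w0 where "w0 = z i (p x)"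
  have oI: "open (z i ` (U i \<inter> p ` V0))"
    by (intro open_coord_image open_Int open_U open_p_image V0(1)) blast
  have "w0 \<in> z i ` (U i \<inter> p ` V0)" using i V0(2) by (auto simp: w0_def)
  then obtain R where R: "R > 0" "cball w0 R \<subseteq> z i ` (U i \<inter> p ` V0)"
    using oI open_contains_cball by blast
  have RU: "cball w0 R \<subseteq> z i ` U i" using R(2) by blast
  obtain M where M: "M > 0"
    and Bkl: "\<forall>w\<in>cball w0 R. \<forall>k l. norm (ode_matrix t i w $ k $ l) \<le> M"
    by (rule continuous_matrix_bounded[OF compact_cball ode_matrix_continuous[OF RU]])
  define n where "n = real CARD('r)"
  have n: "n > 0" by (simp add: n_def)
  \<comment> \<open>M bounds the matrix on the closed disc of radius R; r then makes n n M times the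
    diameter 2 r at most 1/2.\<close>
  define r where "r = min R (1 / (4 * n * n * M))"
  have r: "r > 0" "r \<le> R" "n * n * M * (2 * r) \<le> 1/2"
  proof -
    show "r > 0" using R(1) M n by (simp add: r_def)
    show "r \<le> R" by (simp add: r_def)
    have "n * n * M * (2 * r) \<le> n * n * M * (2 * (1 / (4 * n * n * M)))"
      using n M by (intro mult_left_mono) (auto simp: r_def)
    also have "\<dots> = 1/2" using n M by (simp add: field_simps)
    finally show "n * n * M * (2 * r) \<le> 1/2" .
  qed
  let ?B = "ball w0 r"
  have BR: "?B \<subseteq> cball w0 R" using r(2) by auto
  note Bsub = subset_trans[OF BR R(2)] BR subset_trans[OF BR RU]
  define V where "V = V0 \<inter> p -` (U i \<inter> z i -` ?B)"
  have Vm: "Q \<in> V0" "p Q \<in> U i" "z i (p Q) \<in> ?B" if "Q \<in> V" for Q using that by (auto simp: V_def)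
  have oV: "open V" unfolding V_def
    by (intro open_Int V0(1) open_p_preimage continuous_open_preimage[OF coord_homeo(2) open_U open_ball])
  have xV: "x \<in> V" using V0(2) i r(1) by (simp add: V_def w0_def)
  have pcV: "path_connected V"
  proof -
    have "V = (\<lambda>w. the_inv_into V0 p (coord_inv i w)) ` ?B"
    proof (intro set_eqI iffI)
      fix Q assume Q: "Q \<in> V"
      have "Q = the_inv_into V0 p (coord_inv i (z i (p Q)))"
        using Vm[OF Q] the_inv_into_f_f[OF V0(3)] by simp
      then show "Q \<in> (\<lambda>w. the_inv_into V0 p (coord_inv i w)) ` ?B" using Vm(3)[OF Q] by (rule image_eqI)
    next
      fix Q assume "Q \<in> (\<lambda>w. the_inv_into V0 p (coord_inv i w)) ` ?B"
      then obtain w where w: "w \<in> ?B" "Q = the_inv_into V0 p (coord_inv i w)" by (elim imageE) simp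
      obtain Q' where Q': "Q' \<in> V0" "p Q' \<in> U i" "w = z i (p Q')" using Bsub(1) w(1) by auto
      then have "Q = Q'" using w(2) the_inv_into_f_f[OF V0(3)] by simp
      then show "Q \<in> V" using Q' w(1) by (simp add: V_def)
    qed
    moreover have "continuous_on ?B (\<lambda>w. the_inv_into V0 p (coord_inv i w))"
    proof (rule continuous_on_compose2[OF V0(4)])
      show "continuous_on ?B (coord_inv i)" by (rule continuous_on_subset[OF coord_homeo(3) Bsub(3)])
      show "coord_inv i ` ?B \<subseteq> p ` V0"
      proof
        fix y assume "y \<in> coord_inv i ` ?B"
        then obtain w where "w \<in> ?B" "y = coord_inv i w" by (elim imageE) simp
        then show "y \<in> p ` V0" using Bsub(1) by auto
      qed
    qed
    ultimately show ?thesis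
      using path_connected_continuous_image[OF _ convex_imp_path_connected[OF convex_ball]] by metis
  qed
  have "\<exists>s. flat_on t V s \<and> s q = v" if q: "q \<in> V" and v: "v \<in> fibre q" for q v
  proof -
    have "\<exists>y. linear_ode_on (ode_matrix t i) ?B y \<and> y (z i (p q)) = v i"
    proof (rule linear_ode_exists)
      show "(\<lambda>w. ode_matrix t i w $ k $ l) holomorphic_on ?B" for k l
        by (rule holomorphic_on_subset[OF ode_matrix_holomorphic Bsub(3)])
      show "norm (ode_matrix t i w $ k $ l) \<le> M" if "w \<in> ?B" for k l w
        using Bkl that Bsub(2) by blast
      show "real CARD('r) * real CARD('r) * M * (2 * r) \<le> 1 / 2" using r(3) by (simp add: n_def)
      show "z i (p q) \<in> ?B" by (rule Vm(3)[OF q])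
    qed
    then obtain y where y: "linear_ode_on (ode_matrix t i) ?B y" "y (z i (p q)) = v i" by blast
    define s where "s Q = spread i Q (y (z i (p Q)))" for Q
    have fib: "s Q \<in> fibre Q" if "Q \<in> V" for Q unfolding s_def by (rule spread_fibre[OF Vm(2)[OF that]])
    have self: "s Q i = y (z i (p Q))" if "Q \<in> V" for Q unfolding s_def by (rule spread_self[OF Vm(2)[OF that]])
    have sol: "solution_at t Q i s" if "Q \<in> V" for Q
      by (rule solution_atI[OF open_ball Bsub(3) y(1) oV that]) (use Vm self in simp_all)
    have sol': "solution_at t Q j s" if Q: "Q \<in> V" "p Q \<in> U j" for Q j
      by (rule solution_at_frame_change[OF sol[OF Q(1)] Q(2) oV Q(1)]) (use fibre_frame fib in simp)
    have "flat_on t V s" unfolding flat_on_def using oV fib sol' by blast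
    moreover have "s q = v" by (rule fibre_eqI[OF fib[OF q] v Vm(2)[OF q]]) (simp add: self[OF q] y(2))
    ultimately show ?thesis by blast
  qed
  then show ?thesis using oV xV pcV by (intro exI[of _ V]) simp
qed

sublocale flat: local_system "flat_on t" fibre for t
proof
  show "flat_on t V s \<Longrightarrow> open V" for V s by (simp add: flat_on_def)
  show "flat_on t V s \<Longrightarrow> x \<in> V \<Longrightarrow> s x \<in> fibre x" for V s x unfolding flat_on_def by blast
qed (fact flat_on_sep flat_on_ex)+

lemma solution_at_cong:
  assumes "solution_at t Q i s" "open N" "Q \<in> N" "\<And>Q'. Q' \<in> N \<Longrightarrow> p Q' \<in> U i \<Longrightarrow> s Q' i = s' Q' i"
  shows "solution_at t Q i s'"
proof -
  obtain S y W where 1: "open S" "S \<subseteq> z i ` U i" "linear_ode_on (ode_matrix t i) S y" "open W" "Q \<in> W"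
    "\<forall>Q'\<in>W. p Q' \<in> U i \<and> z i (p Q') \<in> S \<and> s Q' i = y (z i (p Q'))" by (rule solution_atE[OF assms(1)])
  show ?thesis
  proof (rule solution_atI[OF 1(1-3)])
    show "open (W \<inter> N)" "Q \<in> W \<inter> N" using 1(4,5) assms(2,3) by auto
    fix Q' assume Q': "Q' \<in> W \<inter> N"
    then have "Q' \<in> W" by simp
    note b = bspec[OF 1(6) this]
    show "p Q' \<in> U i" "z i (p Q') \<in> S" using b by simp_all
    show "s' Q' i = y (z i (p Q'))" using b assms(4)[of Q'] Q' by simp
  qed
qed

section \<open>Global transported sections and the transport as a linear isomorphism\<close>

lemma transported_section_exists:
  assumes sc: "simply_connected (UNIV :: 'b set)" and x0: "p x0 \<in> U i0"
  shows "\<exists>s. transported t s \<and> s x0 i0 = v"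
proof -
  obtain s where s: "s x0 = spread i0 x0 v" "\<forall>x. \<exists>V s'. x \<in> V \<and> flat_on t V s' \<and> (\<forall>y\<in>V. s y = s' y)"
    using flat.global_section[OF sc spread_fibre[OF x0], of v t] by (elim exE conjE) (rule that)
  have "s Q \<in> fibre Q \<and> (\<forall>i. p Q \<in> U i \<longrightarrow> solution_at t Q i s)" for Q
  proof -
    obtain V s' where V: "Q \<in> V" "flat_on t V s'" "\<forall>y\<in>V. s y = s' y" using spec[OF s(2), of Q] by (elim exE conjE) (rule that)
    have 1: "open V" "s' Q \<in> fibre Q" "\<And>i. p Q \<in> U i \<Longrightarrow> solution_at t Q i s'"
      using V(1,2) unfolding flat_on_def by blast+
    have "solution_at t Q i s" if "p Q \<in> U i" for i
      by (rule solution_at_cong[OF 1(3)[OF that] 1(1) V(1)]) (use V(3) in simp)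
    then show ?thesis using 1(2) V by simp
  qed
  then have "transported t s"
    unfolding transported_section_iff using fibre_frame by blast
  then show ?thesis using s(1) spread_self[OF x0] by auto
qed

lemma transported_section_unique:
  assumes sc: "simply_connected (UNIV :: 'b set)" and x0: "p x0 \<in> U i0"
    and s: "transported t s" "transported t s'" "s x0 i0 = s' x0 i0"
    and Q: "p Q \<in> U j"
  shows "s Q j = s' Q j"
proof -
  \<comment> \<open>A transported section is unconstrained in frames not defined at
    \<open>p Q\<close>; setting these components to 0 puts it into \<open>fibre\<close>.\<close>
  define cut where "cut s Q i = (if p Q \<in> U i then s Q i else 0)" for s :: "'b \<Rightarrow> 'i \<Rightarrow> complex^'r" and Q i
  have fl: "flat_on t UNIV (cut s)" if "transported t s" for s
  proof -
    have 1: "\<And>Q i j. p Q \<in> U i \<inter> U j \<Longrightarrow> s Q i = g i j (p Q) *v s Q j"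
      "\<And>Q i. p Q \<in> U i \<Longrightarrow> solution_at t Q i s"
      using that unfolding transported_section_iff by blast+
    have "cut s Q \<in> fibre Q" for Q unfolding fibre_def cut_def using 1(1)[of Q] by simp
    moreover have "solution_at t Q i (cut s)" if "p Q \<in> U i" for Q i
      by (rule solution_at_cong[OF 1(2)[OF that], of UNIV]) (simp_all add: cut_def)
    ultimately show ?thesis unfolding flat_on_def by simp
  qed
  have "cut s x0 = cut s' x0"
    by (rule fibre_eqI[OF _ _ x0]) (use fl[OF s(1)] fl[OF s(2)] s(3) in \<open>auto simp: flat_on_def cut_def\<close>)
  from flat.global_section_unique[OF sc fl[OF s(1)] fl[OF s(2)] this] have "cut s Q = cut s' Q" .
  from fun_cong[OF this, of j] show ?thesis using Q by (simp add: cut_def)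
qed

lemma transported_section_combination:
  assumes "transported t s" "transported t s'"
  shows "transported t (\<lambda>Q i. c *s s Q i + d *s s' Q i)"
proof -
  have 1: "\<And>Q i j. p Q \<in> U i \<inter> U j \<Longrightarrow> s Q i = g i j (p Q) *v s Q j"
      "\<And>Q i. p Q \<in> U i \<Longrightarrow> solution_at t Q i s"
      "\<And>Q i j. p Q \<in> U i \<inter> U j \<Longrightarrow> s' Q i = g i j (p Q) *v s' Q j"
      "\<And>Q i. p Q \<in> U i \<Longrightarrow> solution_at t Q i s'"
    using assms unfolding transported_section_iff by blast+
  have "solution_at t Q i (\<lambda>Q i. c *s s Q i + d *s s' Q i)" if Q: "p Q \<in> U i" for Q i
  proof -
    obtain S y W where 2: "open S" "S \<subseteq> z i ` U i" "linear_ode_on (ode_matrix t i) S y" "open W" "Q \<in> W"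
      "\<forall>Q'\<in>W. p Q' \<in> U i \<and> z i (p Q') \<in> S \<and> s Q' i = y (z i (p Q'))" by (rule solution_atE[OF 1(2)[OF Q]])
    obtain S' y' W' where 3: "open S'" "S' \<subseteq> z i ` U i" "linear_ode_on (ode_matrix t i) S' y'" "open W'" "Q \<in> W'"
      "\<forall>Q'\<in>W'. p Q' \<in> U i \<and> z i (p Q') \<in> S' \<and> s' Q' i = y' (z i (p Q'))" by (rule solution_atE[OF 1(4)[OF Q]])
    have "linear_ode_on (ode_matrix t i) (S \<inter> S') y" "linear_ode_on (ode_matrix t i) (S \<inter> S') y'"
      using 2(3) 3(3) unfolding linear_ode_on_def by blast+
    from linear_ode_combination[OF this]
    show ?thesis
    proof (rule solution_atI[rotated 2])
      show "open (S \<inter> S')" "S \<inter> S' \<subseteq> z i ` U i" "open (W \<inter> W')" "Q \<in> W \<inter> W'"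
        using 2 3 by auto
      fix Q' assume "Q' \<in> W \<inter> W'"
      then have "Q' \<in> W" "Q' \<in> W'" by simp_all
      note b = bspec[OF 2(6) this(1)] bspec[OF 3(6) this(2)]
      show "p Q' \<in> U i" "z i (p Q') \<in> S \<inter> S'" using b by simp_all
      show "c *s s Q' i + d *s s' Q' i = c *s y (z i (p Q')) + d *s y' (z i (p Q'))" using b by simp
    qed
  qed
  moreover have "c *s s Q i + d *s s' Q i = g i j (p Q) *v (c *s s Q j + d *s s' Q j)"
    if "p Q \<in> U i \<inter> U j" for Q i j
    using 1(1)[OF that] 1(3)[OF that] by (simp add: matrix_vector_right_distrib vec.scale)
  ultimately show ?thesis unfolding transported_section_iff by blast
qed

text \<open>Uniqueness of global sections turns the definite description into evaluation of any
  section with the right initial value.\<close>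

lemma transport_eq:
  assumes sc: "simply_connected (UNIV :: 'b set)" and x0: "p x0 \<in> U i0"
    and s: "transported t s" and Q: "p Q \<in> U j"
  shows "transport U z g A \<Phi> p x0 i0 t Q j (s x0 i0) = s Q j"
  unfolding transport_def
proof (rule the_equality)
  show "\<exists>s'. transported t s' \<and> s' x0 i0 = s x0 i0 \<and> s' Q j = s Q j" using s by blast
  fix w assume "\<exists>s'. transported t s' \<and> s' x0 i0 = s x0 i0 \<and> s' Q j = w"
  then obtain s' where s': "transported t s'" "s' x0 i0 = s x0 i0" "s' Q j = w" by blast
  show "w = s Q j" using transported_section_unique[OF sc x0 s'(1) s s'(2) Q] s'(3) by simp
qed

lemma transport_combination:
  assumes sc: "simply_connected (UNIV :: 'b set)" and x0: "p x0 \<in> U i0" and Q: "p Q \<in> U j"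
  shows "transport U z g A \<Phi> p x0 i0 t Q j (c *s v + d *s v') =
    c *s transport U z g A \<Phi> p x0 i0 t Q j v + d *s transport U z g A \<Phi> p x0 i0 t Q j v'"
proof -
  obtain s where s: "transported t s" "s x0 i0 = v"
    using transported_section_exists[OF sc x0] by blast
  obtain s' where s': "transported t s'" "s' x0 i0 = v'"
    using transported_section_exists[OF sc x0] by blast
  show ?thesis
    using transport_eq[OF sc x0 s(1) Q] transport_eq[OF sc x0 s'(1) Q]
      transport_eq[OF sc x0 transported_section_combination[OF s(1) s'(1), of c d] Q] s(2) s'(2)
    by simp
qed

text \<open>Uniqueness is used with Q as the base point; the zero section enters as the combination
  with both coefficients 0.\<close>

lemma transport_eq_0:
  assumes sc: "simply_connected (UNIV :: 'b set)" and x0: "p x0 \<in> U i0" and Q: "p Q \<in> U j"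
    and 0: "transport U z g A \<Phi> p x0 i0 t Q j v = 0"
  shows "v = 0"
proof -
  obtain s where s: "transported t s" "s x0 i0 = v"
    using transported_section_exists[OF sc x0] by blast
  have s0: "transported t (\<lambda>Q i. 0 *s s Q i + 0 *s s Q i)"
    by (rule transported_section_combination[OF s(1) s(1)])
  have "s Q j = 0" using transport_eq[OF sc x0 s(1) Q] s(2) 0 by simp
  then have "s x0 i0 = 0 *s s x0 i0 + 0 *s s x0 i0"
    using transported_section_unique[OF sc Q s(1) s0 _ x0] by simp
  then show ?thesis using s(2) by simp
qed

lemma transport_linear:
  assumes sc: "simply_connected (UNIV :: 'b set)" and x0: "p x0 \<in> U i0" and Q: "p Q \<in> U j"
  shows "Vector_Spaces.linear (*s) (*s) (transport U z g A \<Phi> p x0 i0 t Q j)"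
    "inj (transport U z g A \<Phi> p x0 i0 t Q j)" "surj (transport U z g A \<Phi> p x0 i0 t Q j)"
proof -
  let ?T = "transport U z g A \<Phi> p x0 i0 t Q j"
  note comb = transport_combination[OF sc x0 Q, of t]
  have add: "?T (v + w) = ?T v + ?T w" for v w using comb[of 1 v 1 w] by simp
  have scale: "?T (c *s v) = c *s ?T v" for c v using comb[of c v 0 v] by simp
  show lin: "Vector_Spaces.linear (*s) (*s) ?T"
    by unfold_locales (simp_all add: add scale)
  show inj: "inj ?T"
  proof (rule injI)
    fix v w assume "?T v = ?T w"
    then have "?T (1 *s v + (-1) *s w) = 0" unfolding comb by simp
    from transport_eq_0[OF sc x0 Q this] show "v = w" by (simp add: vec_eq_iff)
  qed
  show "surj ?T" by (rule vec.linear_inj_imp_surj[OF lin inj])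
qed

end

section \<open>From local to uniform constants, and calculus with Hermitian forms along a
  path\<close>

lemma unit_interval_bound:
  assumes loc: "\<And>u0. u0 \<in> {0..1} \<Longrightarrow> \<exists>d>0. \<exists>C. \<forall>u\<in>{0..1}. \<bar>u - u0\<bar> < d \<longrightarrow> P u C"
    and mono: "\<And>u C C'. P u C \<Longrightarrow> C \<le> C' \<Longrightarrow> P u C'"
  shows "\<exists>C::real. \<forall>u\<in>{0..1::real}. P u C"
proof -
  have "\<exists>C. \<forall>u\<in>{0..1}. 0 \<le> u \<longrightarrow> u \<le> 1 \<longrightarrow> P u C"
  proof (rule Bolzano[where P = "\<lambda>a b. \<exists>C. \<forall>u\<in>{0..1}. a \<le> u \<longrightarrow> u \<le> b \<longrightarrow> P u C"])
    fix a b c :: real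
    assume "\<exists>C. \<forall>u\<in>{0..1}. a \<le> u \<longrightarrow> u \<le> b \<longrightarrow> P u C" "\<exists>C. \<forall>u\<in>{0..1}. b \<le> u \<longrightarrow> u \<le> c \<longrightarrow> P u C"
    then obtain C C' where C: "\<forall>u\<in>{0..1}. a \<le> u \<longrightarrow> u \<le> b \<longrightarrow> P u C" "\<forall>u\<in>{0..1}. b \<le> u \<longrightarrow> u \<le> c \<longrightarrow> P u C'"
      by blast
    have "P u (max C C')" if "u \<in> {0..1}" "a \<le> u" "u \<le> c" for u
    proof (cases "u \<le> b")
      case True then show ?thesis using C(1) that mono[of u C "max C C'"] by auto
    next
      case False then show ?thesis using C(2) that mono[of u C' "max C C'"] by auto
    qed
    then show "\<exists>C. \<forall>u\<in>{0..1}. a \<le> u \<longrightarrow> u \<le> c \<longrightarrow> P u C" by blast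
  next
    fix x :: real assume "0 \<le> x" "x \<le> 1"
    then obtain d C where d: "d > 0" "\<forall>u\<in>{0..1}. \<bar>u - x\<bar> < d \<longrightarrow> P u C" using loc[of x] by auto
    show "\<exists>d>0. \<forall>a b. a \<le> x \<and> x \<le> b \<and> b - a < d \<longrightarrow> (\<exists>C. \<forall>u\<in>{0..1}. a \<le> u \<longrightarrow> u \<le> b \<longrightarrow> P u C)"
    proof (rule exI[of _ d], intro conjI allI impI)
      fix a b assume "a \<le> x \<and> x \<le> b \<and> b - a < d"
      then show "\<exists>C. \<forall>u\<in>{0..1}. a \<le> u \<longrightarrow> u \<le> b \<longrightarrow> P u C" using d(2) by (intro exI[of _ C]) auto
    qed (rule d)
  qed auto
  then show ?thesis by auto
qed

lemma herm_simps:
  "herm M (x + y) w = herm M x w + herm M y w" "herm M (c *s x) w = c * herm M x w"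
  "herm M x (y + w) = herm M x y + herm M x w" "herm M x (c *s y) = cnj c * herm M x y"
  unfolding herm_def
  by (simp_all add: algebra_simps sum.distrib sum_distrib_left)

lemma pd_form_herm:
  assumes "\<And>v w. herm M w v = cnj (herm M v w)" "\<And>v. v \<noteq> 0 \<Longrightarrow> Re (herm M v v) > 0"
  shows "pd_form (herm M)"
proof -
  have "\<forall>x y z. herm M (x + y) z = herm M x z + herm M y z" "\<forall>c x y. herm M (c *s x) y = c * herm M x y"
    by (simp_all add: herm_simps)
  moreover have "\<forall>x y. herm M y x = cnj (herm M x y)" by (intro allI) (rule assms(1))
  moreover have "\<forall>x. x \<noteq> 0 \<longrightarrow> Re (herm M x x) > 0" using assms(2) by simp
  ultimately show ?thesis unfolding pd_form_def by (intro conjI)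
qed

lemma pd_form_compose_linear:
  fixes T :: "complex^'s::finite \<Rightarrow> complex^'r::finite"
  assumes h: "pd_form h" and T: "Vector_Spaces.linear (*s) (*s) T" "inj T"
  shows "pd_form (\<lambda>v w. h (T v) (T w))"
proof -
  interpret T: Vector_Spaces.linear "(*s)" "(*s)" T by (rule T(1))
  have "\<forall>x. x \<noteq> 0 \<longrightarrow> Re (h (T x) (T x)) > 0"
  proof (intro allI impI pd_form_pos[OF h])
    fix x :: "complex^'s" assume "x \<noteq> 0"
    then show "T x \<noteq> 0" using T(2) T.zero by (metis injD)
  qed
  moreover have "\<forall>x y. h (T y) (T x) = cnj (h (T x) (T y))" by (intro allI) (rule pd_form_sym[OF h])
  moreover have "\<forall>x y w. h (T (x + y)) (T w) = h (T x) (T w) + h (T y) (T w)"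
    "\<forall>c x y. h (T (c *s x)) (T y) = c * h (T x) (T y)"
    by (simp_all add: T.add T.scale pd_form_simps[OF h])
  ultimately show ?thesis unfolding pd_form_def by (intro conjI)
qed

lemma herm_has_vector_derivative:
  fixes x y :: "real \<Rightarrow> complex^'r::finite" and M :: "real \<Rightarrow> complex^'r^'r"
  assumes x: "\<And>k. ((\<lambda>u. x u $ k) has_vector_derivative x' $ k) (at u within S)"
    and y: "\<And>k. ((\<lambda>u. y u $ k) has_vector_derivative y' $ k) (at u within S)"
    and M: "\<And>k l. ((\<lambda>u. M u $ k $ l) has_vector_derivative M' $ k $ l) (at u within S)"
  shows "((\<lambda>u. herm (M u) (x u) (y u)) has_vector_derivative
    herm (M u) x' (y u) + herm (M u) (x u) y' + herm M' (x u) (y u)) (at u within S)"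
proof -
  have "((\<lambda>u. herm (M u) (x u) (y u)) has_vector_derivative
    (\<Sum>k\<in>UNIV. \<Sum>l\<in>UNIV. x u $ k * M u $ k $ l * cnj (y' $ l) +
      (x u $ k * M' $ k $ l + x' $ k * M u $ k $ l) * cnj (y u $ l))) (at u within S)"
    unfolding herm_def
    by (intro has_vector_derivative_sum has_vector_derivative_mult x M
          bounded_linear.has_vector_derivative[OF bounded_linear_cnj] y)
  moreover have "(\<Sum>k\<in>UNIV. \<Sum>l\<in>UNIV. x u $ k * M u $ k $ l * cnj (y' $ l) +
      (x u $ k * M' $ k $ l + x' $ k * M u $ k $ l) * cnj (y u $ l))
    = herm (M u) x' (y u) + herm (M u) (x u) y' + herm M' (x u) (y u)"
    unfolding herm_def by (simp add: algebra_simps sum.distrib)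
  ultimately show ?thesis by simp
qed

lemma matrix_vector_has_vector_derivative:
  fixes x :: "real \<Rightarrow> complex^'r::finite" and M :: "real \<Rightarrow> complex^'r^'r"
  assumes x: "\<And>k. ((\<lambda>u. x u $ k) has_vector_derivative x' $ k) (at u within S)"
    and M: "\<And>k l. ((\<lambda>u. M u $ k $ l) has_vector_derivative M' $ k $ l) (at u within S)"
  shows "((\<lambda>u. (M u *v x u) $ k) has_vector_derivative (M u *v x' + M' *v x u) $ k) (at u within S)"
proof -
  have "((\<lambda>u. (M u *v x u) $ k) has_vector_derivative
    (\<Sum>l\<in>UNIV. M u $ k $ l * x' $ l + M' $ k $ l * x u $ l)) (at u within S)"
    unfolding matrix_vector_mult_def vec_lambda_beta
    by (intro has_vector_derivative_sum has_vector_derivative_mult x M)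
  then show ?thesis by (simp add: matrix_vector_mult_def sum.distrib)
qed

lemma herm_continuous_on:
  fixes x y :: "'c::topological_space \<Rightarrow> complex^'r::finite" and M :: "'c \<Rightarrow> complex^'r^'r"
  assumes "\<And>k. continuous_on S (\<lambda>u. x u $ k)" "\<And>k. continuous_on S (\<lambda>u. y u $ k)"
    "\<And>k l. continuous_on S (\<lambda>u. M u $ k $ l)"
  shows "continuous_on S (\<lambda>u. herm (M u) (x u) (y u))"
  unfolding herm_def by (intro continuous_intros assms)

lemma matrix_vector_continuous_on:
  fixes x :: "'c::topological_space \<Rightarrow> complex^'r::finite" and M :: "'c \<Rightarrow> complex^'r^'r"
  assumes "\<And>k. continuous_on S (\<lambda>u. x u $ k)" "\<And>k l. continuous_on S (\<lambda>u. M u $ k $ l)"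
  shows "continuous_on S (\<lambda>u. (M u *v x u) $ k)"
  unfolding matrix_vector_mult_def vec_lambda_beta by (intro continuous_intros assms)

section \<open>Norms of the eigencomponents along the path\<close>

locale wkb_path = flat_bundle U z g \<Phi> A p
  for U :: "('i, 'a::t2_space) cover" and z :: "('i, 'a) coords"
    and g :: "('i, 'a, 'r::{finite,linorder}) transitions" and \<Phi> A :: "('i, 'a, 'r::{finite,linorder}) matrices"
    and p :: "'b::t2_space \<Rightarrow> 'a" +
  fixes H :: "('i, 'a, 'r::{finite,linorder}) matrices" and \<gamma> :: "real \<Rightarrow> 'b"
    and \<beta> :: "'r \<Rightarrow> real \<Rightarrow> complex"
  assumes metric: "hermitian_metric U z g H" and path: "path \<gamma>" and C1: "C1_path U z (p \<circ> \<gamma>)"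
    and eigenforms: "pullback_eigenforms U z \<Phi> (p \<circ> \<gamma>) \<beta>"
    and order: "\<forall>u \<in> {0..1}. \<forall>k l. k < l \<longrightarrow> Re (\<beta> k u) > Re (\<beta> l u)"
begin

definition speed :: "'i \<Rightarrow> real \<Rightarrow> complex" where
  "speed i u = vector_derivative (z i \<circ> (p \<circ> \<gamma>)) (at u within {0..1})"

lemma speed:
  assumes "u \<in> {0..1}" "p (\<gamma> u) \<in> U i"
  shows "((\<lambda>u. z i (p (\<gamma> u))) has_vector_derivative speed i u) (at u within {0..1})"
    and "continuous_on {u \<in> {0..1}. p (\<gamma> u) \<in> U i} (speed i)"
proof -
  obtain D where D: "continuous_on {u \<in> {0..1}. (p \<circ> \<gamma>) u \<in> U i} D"
    "\<forall>u \<in> {0..1}. (p \<circ> \<gamma>) u \<in> U i \<longrightarrow> ((z i \<circ> (p \<circ> \<gamma>)) has_vector_derivative D u) (at u within {0..1})"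
    using C1 unfolding C1_path_def by blast
  have eq: "speed i u = D u" if "u \<in> {0..1}" "p (\<gamma> u) \<in> U i" for u
    unfolding speed_def
    by (rule vector_derivative_within_closed_interval) (use D(2) that in auto)
  show "((\<lambda>u. z i (p (\<gamma> u))) has_vector_derivative speed i u) (at u within {0..1})"
    using bspec[OF D(2) assms(1)] assms eq by (simp add: comp_def)
  show "continuous_on {u \<in> {0..1}. p (\<gamma> u) \<in> U i} (speed i)"
    by (rule continuous_on_eq[OF D(1)[unfolded comp_def]]) (simp add: eq)
qed

lemma path_near:
  assumes "open W" "u \<in> {0..1}" "\<gamma> u \<in> W"
  shows "\<exists>d>0. \<forall>u'\<in>{0..1}. dist u' u < d \<longrightarrow> \<gamma> u' \<in> W"
proof -
  have "continuous_on {0..1} \<gamma>" using path by (simp add: path_def)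
  then obtain M where M: "open M" "M \<inter> {0..1} = \<gamma> -` W \<inter> {0..1}"
    using assms(1) continuous_on_open_invariant by metis
  have "u \<in> M" using M(2) assms by blast
  then obtain d where "d > 0" "\<forall>u'. dist u' u < d \<longrightarrow> u' \<in> M" using M(1) unfolding open_dist by blast
  then show ?thesis using M(2) by (intro exI[of _ d]) blast
qed

lemma path_near_base:
  assumes "open W" "u \<in> {0..1}" "p (\<gamma> u) \<in> W"
  shows "\<exists>d>0. \<forall>u'\<in>{0..1}. dist u' u < d \<longrightarrow> p (\<gamma> u') \<in> W"
  using path_near[OF open_p_preimage[OF assms(1)] assms(2)] assms(3) by simp

lemma coord_path_continuous:
  assumes "J \<subseteq> {0..1}" "\<And>u. u \<in> J \<Longrightarrow> p (\<gamma> u) \<in> U i"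
  shows "continuous_on J (\<lambda>u. z i (p (\<gamma> u)))"
proof (rule continuous_on_compose2[OF coord_homeo(2)])
  show "continuous_on J (\<lambda>u. p (\<gamma> u))"
    by (rule continuous_on_compose2[OF p_cont[of UNIV]])
       (use path assms(1) in \<open>auto simp: path_def intro: continuous_on_subset\<close>)
qed (use assms(2) in auto)

lemma path_chain:
  assumes "u \<in> {0..1}" "p (\<gamma> u) \<in> U i" "(f has_field_derivative f') (at (z i (p (\<gamma> u))))"
  shows "((\<lambda>u. f (z i (p (\<gamma> u)))) has_vector_derivative speed i u * f') (at u within {0..1})"
  using field_vector_diff_chain_within[OF speed(1)[OF assms(1,2)] has_field_derivative_at_within[OF assms(3)]]
  by (simp add: comp_def)

lemma speed_frame_change:
  assumes u: "u \<in> {0..1}" "p (\<gamma> u) \<in> U i" "p (\<gamma> u) \<in> U j"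
  shows "speed i u = chart_deriv U z j (z i) (p (\<gamma> u)) * speed j u"
proof -
  obtain d where d: "d > 0" "\<forall>u'\<in>{0..1}. dist u' u < d \<longrightarrow> p (\<gamma> u') \<in> U i \<inter> U j"
    using path_near_base[OF open_Int[OF open_U open_U] u(1), of i j] u by blast
  have "((\<lambda>u. z i (coord_inv j (z j (p (\<gamma> u))))) has_vector_derivative
      speed j u * chart_deriv U z j (z i) (p (\<gamma> u))) (at u within {0..1})"
    by (rule path_chain[OF u(1,3) transition_deriv[OF u(2,3)]])
  then have "((\<lambda>u. z i (p (\<gamma> u))) has_vector_derivative
      speed j u * chart_deriv U z j (z i) (p (\<gamma> u))) (at u within {0..1})"
    by (rule has_vector_derivative_transform_within[OF _ d(1) u(1)]) (use d(2) in simp)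
  then show ?thesis
    using vector_derivative_unique_within_closed_interval[of 0 1 u] speed(1)[OF u(1,2)] u(1)
    by (simp add: mult.commute)
qed

text \<open>The Higgs field contracted with the velocity of the path; its eigenvalues are the
  functions \<open>\<beta> k\<close>.\<close>

definition path_matrix :: "'i \<Rightarrow> real \<Rightarrow> ((complex, 'r) vec, 'r) vec" where
  "path_matrix i u = (\<chi> k l. speed i u * \<Phi> i (p (\<gamma> u)) $ k $ l)"

lemma path_matrix_mult: "path_matrix i u *v x = speed i u *s (\<Phi> i (p (\<gamma> u)) *v x)"
  by (simp add: path_matrix_def matrix_vector_mult_def vec_eq_iff sum_distrib_left mult.assoc)

lemma inj_\<beta>: "u \<in> {0..1} \<Longrightarrow> inj (\<lambda>l. \<beta> l u)"
proof (rule injI, rule ccontr)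
  fix k l assume "u \<in> {0..1}" "\<beta> k u = \<beta> l u" "k \<noteq> l"
  then show False using order by (metis neq_iff less_irrefl)
qed

lemma local_eigenforms:
  assumes "u \<in> {0..1}"
  obtains W \<omega> N where "eigenforms_on U z \<Phi> W \<omega>" "open N" "u \<in> N"
    "\<forall>u'\<in>N \<inter> {0..1}. p (\<gamma> u') \<in> W \<and> (\<forall>k i. p (\<gamma> u') \<in> U i \<longrightarrow> \<beta> k u' = \<omega> k i (p (\<gamma> u')) * speed i u')"
proof -
  have "\<exists>W \<omega> N. eigenforms_on U z \<Phi> W \<omega> \<and> open N \<and> u \<in> N \<and>
     (\<forall>u'\<in>N \<inter> {0..1}. p (\<gamma> u') \<in> W \<and> (\<forall>k i. p (\<gamma> u') \<in> U i \<longrightarrow> \<beta> k u' = \<omega> k i (p (\<gamma> u')) * speed i u'))"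
    using eigenforms assms unfolding pullback_eigenforms_def speed_def[symmetric] by simp
  then show thesis by (elim exE conjE) (rule that)
qed

lemma eigenforms_eigensystem:
  assumes "eigenforms_on U z \<Phi> W \<omega>" "x \<in> W" "x \<in> U i"
  shows "\<exists>v. eigensystem (\<Phi> i x) (\<lambda>k. \<omega> k i x) v"
proof -
  have "\<forall>k. \<exists>v. v \<noteq> 0 \<and> \<Phi> i x *v v = \<omega> k i x *s v" "inj (\<lambda>k. \<omega> k i x)"
    using assms unfolding eigenforms_on_def by blast+
  then show ?thesis unfolding eigensystem_def by metis
qed

lemma path_matrix_eigensystem:
  assumes "u \<in> {0..1}" "p (\<gamma> u) \<in> U i"
  shows "\<exists>v. eigensystem (path_matrix i u) (\<lambda>k. \<beta> k u) v"
proof -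
  obtain W \<omega> N where 1: "eigenforms_on U z \<Phi> W \<omega>" "open N" "u \<in> N"
    "\<forall>u'\<in>N \<inter> {0..1}. p (\<gamma> u') \<in> W \<and> (\<forall>k i. p (\<gamma> u') \<in> U i \<longrightarrow> \<beta> k u' = \<omega> k i (p (\<gamma> u')) * speed i u')"
    by (rule local_eigenforms[OF assms(1)])
  have u: "p (\<gamma> u) \<in> W" "\<And>k. \<beta> k u = \<omega> k i (p (\<gamma> u)) * speed i u"
    using 1(3,4) assms by simp_all
  obtain v where "eigensystem (\<Phi> i (p (\<gamma> u))) (\<lambda>k. \<omega> k i (p (\<gamma> u))) v"
    using eigenforms_eigensystem[OF 1(1) u(1) assms(2)] by blast
  then have "eigensystem (path_matrix i u) (\<lambda>k. \<beta> k u) v"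
    unfolding eigensystem_def using inj_\<beta>[OF assms(1)] u(2)
    by (simp add: path_matrix_mult vec_eq_iff mult.commute mult.left_commute)
  then show ?thesis by blast
qed

definition branch_proj :: "'r \<Rightarrow> 'i \<Rightarrow> real \<Rightarrow> ((complex, 'r) vec, 'r) vec" where
  "branch_proj k i u = eig_proj (path_matrix i u) (\<lambda>l. \<beta> l u) k"

definition branch_norm :: "'r \<Rightarrow> 'i \<Rightarrow> real \<Rightarrow> (complex, 'r) vec \<Rightarrow> real" where
  "branch_norm k i u x = Re (herm (H i (p (\<gamma> u))) (branch_proj k i u *v x) (branch_proj k i u *v x))"

lemma metric_pd: "x \<in> U i \<Longrightarrow> pd_form (herm (H i x))"
proof -
  assume x: "x \<in> U i"
  have m: "\<forall>i. \<forall>x \<in> U i. (\<forall>v w. herm (H i x) w v = cnj (herm (H i x) v w)) \<and>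
        (\<forall>v. v \<noteq> 0 \<longrightarrow> Re (herm (H i x) v v) > 0)"
    using metric unfolding hermitian_metric_def by (elim conjE)
  note m = bspec[OF spec[OF m, of i] x]
  show ?thesis by (rule pd_form_herm) (use m in blast)+
qed

text \<open>Velocity and Higgs matrix change by inverse factors, so the transition matrix
  intertwines the two path matrices, hence also their projections for the same eigenvalue; it is
  moreover an isometry of the metrics.\<close>

lemma branch_norm_frame_change:
  assumes u: "u \<in> {0..1}" "p (\<gamma> u) \<in> U i" "p (\<gamma> u) \<in> U j"
  shows "branch_norm k i u (g i j (p (\<gamma> u)) *v x) = branch_norm k j u x"
proof -
  let ?G = "g i j (p (\<gamma> u))"
  obtain v where v: "eigensystem (path_matrix j u) (\<lambda>k. \<beta> k u) v"
    using path_matrix_eigensystem[OF u(1,3)] by blast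
  let ?c = "chart_deriv U z j (z i) (p (\<gamma> u))"
  have P: "mat ?c ** \<Phi> i (p (\<gamma> u)) ** ?G = ?G ** \<Phi> j (p (\<gamma> u))"
    using higgs u unfolding higgs_field_def by blast
  have "?c *s (\<Phi> i (p (\<gamma> u)) *v (?G *v y)) = ?G *v (\<Phi> j (p (\<gamma> u)) *v y)" for y
    using arg_cong[OF P, of "\<lambda>M. M *v y"] by (simp add: matrix_vector_mul_assoc[symmetric] mat_mult_vec)
  then have "path_matrix i u *v (?G *v y) = ?G *v (path_matrix j u *v y)" for y
    unfolding path_matrix_mult speed_frame_change[OF u] vec.scale
    by (metis vec.scale_scale mult.commute)
  then have "path_matrix i u *v (?G *v v l) = \<beta> l u *s (?G *v v l)" for l
    using v by (simp add: eigensystem_def vec.scale)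
  from eig_proj_commute[OF v inj_\<beta>[OF u(1)] this, of k]
  have "branch_proj k i u ** ?G = ?G ** branch_proj k j u" unfolding branch_proj_def .
  then have "branch_proj k i u *v (?G *v x) = ?G *v (branch_proj k j u *v x)"
    by (simp add: matrix_vector_mul_assoc)
  moreover have "\<forall>i j. \<forall>x \<in> U i \<inter> U j. \<forall>v w. herm (H i x) (g i j x *v v) (g i j x *v w) = herm (H j x) v w"
    using metric unfolding hermitian_metric_def by (elim conjE)
  ultimately show ?thesis unfolding branch_norm_def using u by simp
qed

lemma branch_norm_nonneg: "p (\<gamma> u) \<in> U i \<Longrightarrow> branch_norm k i u x \<ge> 0"
  unfolding branch_norm_def by (rule pd_form_nonneg[OF metric_pd])

lemma branch_norm_sum_pos:
  assumes u: "u \<in> {0..1}" "p (\<gamma> u) \<in> U i" and x: "x \<noteq> 0"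
  shows "(\<Sum>k\<in>UNIV. branch_norm k i u x) > 0"
proof -
  obtain v where v: "eigensystem (path_matrix i u) (\<lambda>k. \<beta> k u) v"
    using path_matrix_eigensystem[OF u] by blast
  have "(\<Sum>k\<in>UNIV. branch_proj k i u *v x) \<noteq> 0"
    using eig_proj_sum[OF v, of x] x unfolding branch_proj_def by simp
  then obtain k where "branch_proj k i u *v x \<noteq> 0" by (metis sum.neutral)
  then have "branch_norm k i u x > 0" unfolding branch_norm_def by (rule pd_form_pos[OF metric_pd[OF u(2)]])
  also have "branch_norm k i u x \<le> (\<Sum>k\<in>UNIV. branch_norm k i u x)"
    by (rule member_le_sum) (use branch_norm_nonneg[OF u(2)] in auto)
  finally show ?thesis .
qed

lemma branch_norm_scale: "branch_norm k i u (c *\<^sub>R x) = c\<^sup>2 * branch_norm k i u x"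
  unfolding branch_norm_def scaleR_eq_scalar by (simp add: vec.scale herm_simps power2_eq_square mult.assoc)

text \<open>The same choice as in \<open>pulled_back_metric\<close>. It may jump with u, but
  \<open>section_norm\<close> does not depend on it, so any fixed frame can be used for
  differentiation.\<close>

definition frame_at :: "real \<Rightarrow> 'i" where "frame_at u = (SOME j. p (\<gamma> u) \<in> U j)"

lemma frame_at: "p (\<gamma> u) \<in> U (frame_at u)"
  unfolding frame_at_def by (rule someI_ex[OF U_cover])

definition section_norm :: "('b \<Rightarrow> 'i \<Rightarrow> (complex, 'r) vec) \<Rightarrow> 'r \<Rightarrow> real \<Rightarrow> real" where
  "section_norm s k u = branch_norm k (frame_at u) u (s (\<gamma> u) (frame_at u))"

lemma section_norm_eq:
  assumes "transported t s" "u \<in> {0..1}" "p (\<gamma> u) \<in> U i"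
  shows "section_norm s k u = branch_norm k i u (s (\<gamma> u) i)"
proof -
  have "s (\<gamma> u) i = g i (frame_at u) (p (\<gamma> u)) *v s (\<gamma> u) (frame_at u)"
    using assms(1,3) frame_at[of u] unfolding transported_section_def by blast
  then show ?thesis
    using branch_norm_frame_change[OF assms(2,3) frame_at] by (simp add: section_norm_def)
qed

lemma section_norm_nonneg: "section_norm s k u \<ge> 0"
  unfolding section_norm_def by (rule branch_norm_nonneg[OF frame_at])

lemma section_has_vector_derivative:
  assumes s: "transported t s" and u: "u \<in> {0..1}" "p (\<gamma> u) \<in> U i"
  shows "((\<lambda>u. s (\<gamma> u) i $ k) has_vector_derivative
    (of_real t *s (path_matrix i u *v s (\<gamma> u) i) - speed i u *s (A i (p (\<gamma> u)) *v s (\<gamma> u) i)) $ k) (at u within {0..1})"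
proof -
  have "solution_at t (\<gamma> u) i s" using s u(2) unfolding transported_section_iff by blast
  then obtain S y V where 1: "open S" "S \<subseteq> z i ` U i" "linear_ode_on (ode_matrix t i) S y" "open V" "\<gamma> u \<in> V"
    "\<forall>Q'\<in>V. p Q' \<in> U i \<and> z i (p Q') \<in> S \<and> s Q' i = y (z i (p Q'))" by (rule solution_atE)
  obtain d where d: "d > 0" "\<forall>u'\<in>{0..1}. dist u' u < d \<longrightarrow> \<gamma> u' \<in> V"
    using path_near[OF 1(4) u(1) 1(5)] by blast
  note b = bspec[OF 1(6) 1(5)]
  have "((\<lambda>w. y w $ k) has_field_derivative (ode_matrix t i (z i (p (\<gamma> u))) *v y (z i (p (\<gamma> u)))) $ k)
      (at (z i (p (\<gamma> u))))"
    using 1(3) b unfolding linear_ode_on_def by blast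
  from path_chain[OF u this]
  have "((\<lambda>u. s (\<gamma> u) i $ k) has_vector_derivative
      speed i u * (ode_matrix t i (z i (p (\<gamma> u))) *v y (z i (p (\<gamma> u)))) $ k) (at u within {0..1})"
    by (rule has_vector_derivative_transform_within[OF _ d(1) u(1)]) (use d(2) 1(6) in simp)
  moreover have "speed i u * (ode_matrix t i (z i (p (\<gamma> u))) *v y (z i (p (\<gamma> u)))) $ k
     = (of_real t *s (path_matrix i u *v s (\<gamma> u) i) - speed i u *s (A i (p (\<gamma> u)) *v s (\<gamma> u) i)) $ k"
    using b u(2) by (simp add: ode_matrix_mult path_matrix_mult algebra_simps)
  ultimately show ?thesis by simp
qed

text \<open>Near each time a single chart and a single numbering of the eigenforms serve at
  once.\<close>

lemma noncritical_chart:
  assumes u0: "u0 \<in> {0..1}"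
  obtains i W \<omega> d where "eigenforms_on U z \<Phi> W \<omega>" "d > 0"
    "\<forall>u\<in>{0..1}. dist u u0 < d \<longrightarrow> p (\<gamma> u) \<in> W \<and> p (\<gamma> u) \<in> U i \<and> (\<forall>k. \<beta> k u = \<omega> k i (p (\<gamma> u)) * speed i u)"
proof -
  obtain i where i: "p (\<gamma> u0) \<in> U i" using U_cover by blast
  obtain W \<omega> N where 1: "eigenforms_on U z \<Phi> W \<omega>" "open N" "u0 \<in> N"
    "\<forall>u'\<in>N \<inter> {0..1}. p (\<gamma> u') \<in> W \<and> (\<forall>k i. p (\<gamma> u') \<in> U i \<longrightarrow> \<beta> k u' = \<omega> k i (p (\<gamma> u')) * speed i u')"
    by (rule local_eigenforms[OF u0])
  obtain d1 where d1: "d1 > 0" "\<forall>u\<in>{0..1}. dist u u0 < d1 \<longrightarrow> p (\<gamma> u) \<in> U i"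
    using path_near_base[OF open_U u0 i] by blast
  obtain d2 where d2: "d2 > 0" "\<forall>u. dist u u0 < d2 \<longrightarrow> u \<in> N" using 1(2,3) unfolding open_dist by blast
  show ?thesis
    by (rule that[OF 1(1), of "min d1 d2" i]) (use d1 d2 1(4) in auto)
qed

lemma eigenforms_holomorphic:
  assumes "eigenforms_on U z \<Phi> W \<omega>"
  shows "open (z i ` (W \<inter> U i))" "(\<lambda>w. \<omega> k i (coord_inv i w)) holomorphic_on z i ` (W \<inter> U i)"
proof -
  have W: "open W" "chart_holomorphic_on U z i W (\<omega> k i)" using assms unfolding eigenforms_on_def by blast+
  show "open (z i ` (W \<inter> U i))" by (rule open_coord_image) (use W(1) open_U in auto)
  show "(\<lambda>w. \<omega> k i (coord_inv i w)) holomorphic_on z i ` (W \<inter> U i)"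
    using W(2) unfolding chart_holomorphic_on_def in_chart_def comp_def .
qed

lemma path_compose_continuous:
  assumes J: "J \<subseteq> {0..1}" "\<And>u. u \<in> J \<Longrightarrow> p (\<gamma> u) \<in> W \<inter> U i"
    and f: "continuous_on (z i ` (W \<inter> U i)) f"
  shows "continuous_on J (\<lambda>u. f (z i (p (\<gamma> u))))"
  by (rule continuous_on_compose2[OF f coord_path_continuous[OF J(1)]]) (use J(2) in auto)

lemma \<beta>_continuous: "continuous_on {0..1} (\<beta> k)"
  unfolding continuous_on_eq_continuous_within
proof
  fix u0 :: real assume u0: "u0 \<in> {0..1}"
  obtain i W \<omega> d where 1: "eigenforms_on U z \<Phi> W \<omega>" "d > 0"
    "\<forall>u\<in>{0..1}. dist u u0 < d \<longrightarrow> p (\<gamma> u) \<in> W \<and> p (\<gamma> u) \<in> U i \<and> (\<forall>k. \<beta> k u = \<omega> k i (p (\<gamma> u)) * speed i u)"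
    by (rule noncritical_chart[OF u0])
  define J where "J = {0..1} \<inter> ball u0 d"
  have J: "J \<subseteq> {0..1}" "u \<in> J \<Longrightarrow> p (\<gamma> u) \<in> W \<inter> U i" "u \<in> J \<Longrightarrow> \<beta> k u = \<omega> k i (p (\<gamma> u)) * speed i u" for u
    using 1(3) by (auto simp: J_def dist_commute)
  have "continuous_on J (\<lambda>u. \<omega> k i (coord_inv i (z i (p (\<gamma> u)))) * speed i u)"
  proof (intro continuous_on_mult)
    show "continuous_on J (\<lambda>u. \<omega> k i (coord_inv i (z i (p (\<gamma> u)))))"
      by (rule path_compose_continuous[OF J(1,2) holomorphic_on_imp_continuous_on[OF eigenforms_holomorphic(2)[OF 1(1)]]])
    show "continuous_on J (speed i)"
      by (rule continuous_on_subset[OF speed(2)[of u0]]) (use u0 J 1(2,3) in auto)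
  qed
  then have "continuous_on J (\<beta> k)"
    by (rule continuous_on_eq) (use J(2,3) in auto)
  moreover have "u0 \<in> J" using u0 1(2) by (simp add: J_def)
  ultimately have "continuous (at u0 within J) (\<beta> k)" by (simp add: continuous_on_eq_continuous_within)
  moreover have "at u0 within J = at u0 within {0..1}"
    by (rule at_within_nhd[of _ "ball u0 d"]) (use 1(2) in \<open>auto simp: J_def\<close>)
  ultimately show "continuous (at u0 within {0..1}) (\<beta> k)" by simp
qed

text \<open>The metric is differentiable only in the real sense, so the chain rule uses its two real
  partial derivatives.\<close>

lemma metric_path_derivative:
  "\<exists>H' :: real \<Rightarrow> ((complex, 'r) vec, 'r) vec.
    (\<forall>u k l. u \<in> {0..1} \<longrightarrow> p (\<gamma> u) \<in> U i \<longrightarrow>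
      ((\<lambda>u. H i (p (\<gamma> u)) $ k $ l) has_vector_derivative H' u $ k $ l) (at u within {0..1})) \<and>
    (\<forall>J k l. J \<subseteq> {0..1} \<longrightarrow> (\<forall>u\<in>J. p (\<gamma> u) \<in> U i) \<longrightarrow> continuous_on J (\<lambda>u. H' u $ k $ l))"
proof -
  have "C_k_on (Suc 0) (z i ` U i) (in_chart U z i (\<lambda>x. H i x $ k $ l))" for k l
    using metric unfolding hermitian_metric_def by blast
  then have ex: "\<exists>fx fy. continuous_on (z i ` U i) fx \<and> continuous_on (z i ` U i) fy \<and>
     (\<forall>w\<in>z i ` U i. ((\<lambda>w. H i (coord_inv i w) $ k $ l) has_derivative (\<lambda>h. Re h *\<^sub>R fx w + Im h *\<^sub>R fy w)) (at w))" for k l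
    unfolding C_k_on.simps in_chart_def comp_def .
  \<comment> \<open>Pairing the two partial derivatives lets one choice serve for each matrix
    entry.\<close>
  define Q where "Q k l q \<longleftrightarrow> continuous_on (z i ` U i) (fst q) \<and> continuous_on (z i ` U i) (snd q) \<and>
     (\<forall>w\<in>z i ` U i. ((\<lambda>w. H i (coord_inv i w) $ k $ l) has_derivative
       (\<lambda>h. Re h *\<^sub>R fst q w + Im h *\<^sub>R snd q w)) (at w))" for k l and q :: "(complex \<Rightarrow> complex) \<times> (complex \<Rightarrow> complex)"
  have "\<exists>q. Q k l q" for k l
    using ex[of k l]
  proof (elim exE)
    fix fx fy assume "continuous_on (z i ` U i) fx \<and> continuous_on (z i ` U i) fy \<and>
     (\<forall>w\<in>z i ` U i. ((\<lambda>w. H i (coord_inv i w) $ k $ l) has_derivative (\<lambda>h. Re h *\<^sub>R fx w + Im h *\<^sub>R fy w)) (at w))"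
    then have "Q k l (fx, fy)" unfolding Q_def fst_conv snd_conv .
    then show ?thesis by (rule exI)
  qed
  then have Q: "Q k l (SOME q. Q k l q)" for k l by (rule someI_ex)
  define fx where "fx k l = fst (SOME q. Q k l q)" for k l
  define fy where "fy k l = snd (SOME q. Q k l q)" for k l
  have f: "continuous_on (z i ` U i) (fx k l)" "continuous_on (z i ` U i) (fy k l)"
    "\<And>w. w \<in> z i ` U i \<Longrightarrow> ((\<lambda>w. H i (coord_inv i w) $ k $ l) has_derivative
       (\<lambda>h. Re h *\<^sub>R fx k l w + Im h *\<^sub>R fy k l w)) (at w)" for k l
    using Q_def[THEN iffD1, OF Q, of k l] unfolding fx_def[symmetric] fy_def[symmetric] by blast+
  define H' where "H' u = (\<chi> k l. Re (speed i u) *\<^sub>R fx k l (z i (p (\<gamma> u))) + Im (speed i u) *\<^sub>R fy k l (z i (p (\<gamma> u))))" for u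
  show ?thesis
  proof (rule exI[of _ H'], intro conjI allI impI)
    fix u k l assume u: "u \<in> {0..1}" "p (\<gamma> u) \<in> U i"
    obtain d where d: "d > 0" "\<forall>u'\<in>{0..1}. dist u' u < d \<longrightarrow> p (\<gamma> u') \<in> U i"
      using path_near_base[OF open_U u] by blast
    have "((\<lambda>w. H i (coord_inv i w) $ k $ l) has_derivative
       (\<lambda>h. Re h *\<^sub>R fx k l (z i (p (\<gamma> u))) + Im h *\<^sub>R fy k l (z i (p (\<gamma> u))))) (at (z i (p (\<gamma> u))))"
      by (rule f(3)) (use u in blast)
    from vector_derivative_diff_chain_within[OF speed(1)[OF u] has_derivative_at_withinI[OF this]]
    have "((\<lambda>u. H i (coord_inv i (z i (p (\<gamma> u)))) $ k $ l) has_vector_derivative H' u $ k $ l) (at u within {0..1})"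
      by (simp add: comp_def H'_def)
    then show "((\<lambda>u. H i (p (\<gamma> u)) $ k $ l) has_vector_derivative H' u $ k $ l) (at u within {0..1})"
      by (rule has_vector_derivative_transform_within[OF _ d(1) u(1)]) (use d(2) in simp)
  next
    fix J k l assume J1: "J \<subseteq> {0..1}" and J2: "\<forall>u\<in>J. p (\<gamma> u) \<in> U i"
    have J: "J \<subseteq> {0..1}" "\<And>u. u \<in> J \<Longrightarrow> p (\<gamma> u) \<in> U i" using J1 J2 by blast+
    have sp: "continuous_on J (speed i)"
    proof (cases "J = {}")
      case False
      then obtain u where u: "u \<in> J" by blast
      show ?thesis by (rule continuous_on_subset[OF speed(2)[of u]]) (use J u in auto)
    qed simp
    have c: "continuous_on J (\<lambda>u. z i (p (\<gamma> u)))" by (rule coord_path_continuous[OF J])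
    have im: "(\<lambda>u. z i (p (\<gamma> u))) ` J \<subseteq> z i ` U i" using J(2) by blast
    show "continuous_on J (\<lambda>u. H' u $ k $ l)" unfolding H'_def vec_lambda_beta
      by (intro continuous_intros sp continuous_on_compose2[OF f(1) c im] continuous_on_compose2[OF f(2) c im])
  qed
qed

end

section \<open>Differential inequalities with constants independent of t and of the section\<close>

context wkb_path begin

text \<open>The constant C is fixed before t, the section and the branch. Derivatives appear
  existentially, so bounds found in different charts can be combined.\<close>

definition growth_bound :: "real \<Rightarrow> real \<Rightarrow> bool" where
  "growth_bound u C \<longleftrightarrow> (\<forall>t s k. transported t s \<longrightarrow>
     (\<exists>n'. (section_norm s k has_real_derivative n') (at u within {0..1}) \<and>
        \<bar>n' - 2 * t * Re (\<beta> k u) * section_norm s k u\<bar> \<le> C * (\<Sum>m\<in>UNIV. section_norm s m u)))"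

lemma growth_bound_mono: "growth_bound u C \<Longrightarrow> C \<le> C' \<Longrightarrow> growth_bound u C'"
proof -
  assume C: "growth_bound u C" "C \<le> C'"
  have "C * (\<Sum>m\<in>UNIV. section_norm s m u) \<le> C' * (\<Sum>m\<in>UNIV. section_norm s m u)" for s
    by (intro mult_right_mono C(2) sum_nonneg section_norm_nonneg)
  then show ?thesis using C(1) unfolding growth_bound_def by (meson order_trans)
qed

text \<open>The velocity inside \<open>path_matrix\<close> is merely continuous. It is a common
  factor of matrix and eigenvalues and drops out of the projection, which is thus a holomorphic
  function of the chart composed with the path.\<close>

lemma branch_proj_path_derivative:
  assumes J: "J \<subseteq> {0..1}" and W: "eigenforms_on U z \<Phi> W \<omega>" and d: "d > 0"
    and near0: "\<forall>u\<in>J. \<forall>u'\<in>{0..1}. dist u' u < d \<longrightarrow>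
      p (\<gamma> u') \<in> W \<and> p (\<gamma> u') \<in> U i \<and> (\<forall>k. \<beta> k u' = \<omega> k i (p (\<gamma> u')) * speed i u')"
  shows "\<exists>P' :: 'r \<Rightarrow> real \<Rightarrow> ((complex, 'r) vec, 'r) vec.
    (\<forall>u k a b. u \<in> J \<longrightarrow> ((\<lambda>u. branch_proj k i u $ a $ b) has_vector_derivative P' k u $ a $ b) (at u within {0..1})) \<and>
    (\<forall>k a b. continuous_on J (\<lambda>u. P' k u $ a $ b)) \<and> (\<forall>k a b. continuous_on J (\<lambda>u. branch_proj k i u $ a $ b))"
proof -
  have near: "p (\<gamma> u') \<in> W \<and> p (\<gamma> u') \<in> U i \<and> (\<forall>k. \<beta> k u' = \<omega> k i (p (\<gamma> u')) * speed i u')"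
    if "u \<in> J" "u' \<in> {0..1}" "dist u' u < d" for u u'
    using near0 that by blast
  let ?D = "z i ` (W \<inter> U i)"
  define Ph where "Ph k w = eig_proj (\<Phi> i (coord_inv i w)) (\<lambda>l. \<omega> l i (coord_inv i w)) k" for k w
  note hol\<omega> = eigenforms_holomorphic[OF W, where i = i]
  have holP: "(\<lambda>w. Ph k w $ a $ b) holomorphic_on ?D" for k a b
    unfolding Ph_def
  proof (rule holomorphic_eig_proj)
    show "(\<lambda>w. \<Phi> i (coord_inv i w) $ a $ b) holomorphic_on ?D" for a b
      by (rule holomorphic_on_subset[OF matrix_holomorphic(1)]) blast
    show "(\<lambda>w. \<omega> l i (coord_inv i w)) holomorphic_on ?D" for l by (rule hol\<omega>(2))
    fix w assume "w \<in> ?D"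
    then have "coord_inv i w \<in> W \<inter> U i" by auto
    then show "inj (\<lambda>l. \<omega> l i (coord_inv i w))" using W unfolding eigenforms_on_def by blast
  qed
  have eq: "branch_proj k i u = Ph k (z i (p (\<gamma> u)))"
    if u: "u \<in> {0..1}" "p (\<gamma> u) \<in> W" "p (\<gamma> u) \<in> U i" "\<forall>k. \<beta> k u = \<omega> k i (p (\<gamma> u)) * speed i u" for k u
  proof -
    obtain v where v: "eigensystem (\<Phi> i (p (\<gamma> u))) (\<lambda>k. \<omega> k i (p (\<gamma> u))) v"
      using eigenforms_eigensystem[OF W u(2,3)] by blast
    \<comment> \<open>The identity intertwines the Higgs matrix with its multiple by the velocity;
      the eigenvalues \<omega> turn into \<beta>.\<close>
    have "path_matrix i u *v (mat 1 *v v j) = \<beta> j u *s (mat 1 *v v j)" for j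
      using v u(4) by (simp add: path_matrix_mult eigensystem_def mult.commute)
    from eig_proj_commute[OF v inj_\<beta>[OF u(1)] this, of k]
    show ?thesis unfolding branch_proj_def Ph_def using u(3) by simp
  qed
  have JW: "p (\<gamma> u) \<in> W \<inter> U i" if "u \<in> J" for u using near[OF that, of u] J d that by auto
  define P' where "P' k u = (\<chi> a b. speed i u * deriv (\<lambda>w. Ph k w $ a $ b) (z i (p (\<gamma> u))))" for k u
  show ?thesis
  proof (rule exI[of _ P'], intro conjI allI impI)
    fix u k a b assume u: "u \<in> J"
    have u1: "u \<in> {0..1}" using J u by blast
    have "((\<lambda>w. Ph k w $ a $ b) has_field_derivative deriv (\<lambda>w. Ph k w $ a $ b) (z i (p (\<gamma> u)))) (at (z i (p (\<gamma> u))))"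
      by (rule holomorphic_derivI[OF holP hol\<omega>(1)]) (use JW[OF u] in blast)
    from path_chain[OF u1 _ this]
    have "((\<lambda>u. Ph k (z i (p (\<gamma> u))) $ a $ b) has_vector_derivative P' k u $ a $ b) (at u within {0..1})"
      using JW[OF u] by (simp add: P'_def)
    then show "((\<lambda>u. branch_proj k i u $ a $ b) has_vector_derivative P' k u $ a $ b) (at u within {0..1})"
    proof (rule has_vector_derivative_transform_within[OF _ d u1])
      fix u' assume u': "u' \<in> {0..1}" "dist u' u < d"
      show "Ph k (z i (p (\<gamma> u'))) $ a $ b = branch_proj k i u' $ a $ b"
        using eq[OF u'(1)] near[OF u u'] by simp
    qed
  next
    have sp: "continuous_on J (speed i)"
    proof (cases "J = {}")
      case False
      then obtain u where u: "u \<in> J" by blast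
      show ?thesis by (rule continuous_on_subset[OF speed(2)[of u]]) (use J JW u in auto)
    qed simp
    fix k a b
    have "continuous_on J (\<lambda>u. deriv (\<lambda>w. Ph k w $ a $ b) (z i (p (\<gamma> u))))"
      by (rule path_compose_continuous[OF J JW])
         (auto intro!: holomorphic_on_imp_continuous_on holomorphic_deriv holP hol\<omega>)
    then show "continuous_on J (\<lambda>u. P' k u $ a $ b)" unfolding P'_def vec_lambda_beta
      by (intro continuous_on_mult sp)
  next
    fix k a b
    have "continuous_on J (\<lambda>u. Ph k (z i (p (\<gamma> u))) $ a $ b)"
      by (rule path_compose_continuous[OF J JW holomorphic_on_imp_continuous_on[OF holP]])
    then show "continuous_on J (\<lambda>u. branch_proj k i u $ a $ b)"
    proof (rule continuous_on_eq)
      fix u assume u: "u \<in> J"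
      then have "u \<in> {0..1}" using J by blast
      then show "Ph k (z i (p (\<gamma> u))) $ a $ b = branch_proj k i u $ a $ b"
        using eq[of u k] near[OF u, of u] d by simp
    qed
  qed
qed

text \<open>In one chart the derivative of \<open>section_norm\<close> splits into the expected term
  with t and a t-free quadratic form F in the value of the section. \<open>homogeneous_bound\<close>
  compares F with the sum G of all components.\<close>

lemma growth_bound_local:
  assumes u0: "u0 \<in> {0..1}"
  shows "\<exists>d>0. \<exists>C. \<forall>u\<in>{0..1}. \<bar>u - u0\<bar> < d \<longrightarrow> growth_bound u C"
proof -
  obtain i W \<omega> d where W: "eigenforms_on U z \<Phi> W \<omega>" and d: "d > 0" and
    near: "\<forall>u\<in>{0..1}. dist u u0 < d \<longrightarrow> p (\<gamma> u) \<in> W \<and> p (\<gamma> u) \<in> U i \<and> (\<forall>k. \<beta> k u = \<omega> k i (p (\<gamma> u)) * speed i u)"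
    by (rule noncritical_chart[OF u0])
  \<comment> \<open>Compact, and small enough that the d/2-neighbourhood of each of its points still
    lies in the good d-neighbourhood of \<open>u0\<close>.\<close>
  define J where "J = {0..1} \<inter> cball u0 (d/2)"
  have J: "J \<subseteq> {0..1}" "compact J" by (auto simp: J_def intro: compact_Int)
  have near': "p (\<gamma> u') \<in> W \<and> p (\<gamma> u') \<in> U i \<and> (\<forall>k. \<beta> k u' = \<omega> k i (p (\<gamma> u')) * speed i u')"
    if "u \<in> J" "u' \<in> {0..1}" "dist u' u < d/2" for u u'
  proof -
    have "dist u' u0 \<le> dist u' u + dist u u0" by (rule dist_triangle)
    also have "\<dots> < d" using that by (simp add: J_def dist_commute)
    finally show ?thesis using near that(2) by blast
  qed
  then have near'': "\<forall>u\<in>J. \<forall>u'\<in>{0..1}. dist u' u < d/2 \<longrightarrow>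
      p (\<gamma> u') \<in> W \<and> p (\<gamma> u') \<in> U i \<and> (\<forall>k. \<beta> k u' = \<omega> k i (p (\<gamma> u')) * speed i u')" by blast
  have JU: "p (\<gamma> u) \<in> U i" if "u \<in> J" for u using near'[OF that, of u] that J(1) d by auto
  have d2: "d/2 > 0" using d by simp
  obtain P' :: "'r \<Rightarrow> real \<Rightarrow> ((complex, 'r) vec, 'r) vec" where
    P0: "\<forall>u k a b. u \<in> J \<longrightarrow> ((\<lambda>u. branch_proj k i u $ a $ b) has_vector_derivative P' k u $ a $ b) (at u within {0..1})"
    "\<forall>k a b. continuous_on J (\<lambda>u. P' k u $ a $ b)" "\<forall>k a b. continuous_on J (\<lambda>u. branch_proj k i u $ a $ b)"
    using branch_proj_path_derivative[OF J(1) W d2 near''] by (elim exE conjE) (rule that)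
  note P' = P0(1)[rule_format] P0(2)[rule_format] P0(3)[rule_format]
  obtain H' :: "real \<Rightarrow> ((complex, 'r) vec, 'r) vec" where
    H0: "\<forall>u k l. u \<in> {0..1} \<longrightarrow> p (\<gamma> u) \<in> U i \<longrightarrow>
      ((\<lambda>u. H i (p (\<gamma> u)) $ k $ l) has_vector_derivative H' u $ k $ l) (at u within {0..1})"
    "\<forall>J k l. J \<subseteq> {0..1} \<longrightarrow> (\<forall>u\<in>J. p (\<gamma> u) \<in> U i) \<longrightarrow> continuous_on J (\<lambda>u. H' u $ k $ l)"
    using metric_path_derivative[of i] by (elim exE conjE) (rule that)
  note H' = H0(1)[rule_format] H0(2)[rule_format]
  \<comment> \<open>The t-free part of the derivative of the k-th component: from the moving
    projection and from the connection form.\<close>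
  define R where "R k u x = P' k u *v x - speed i u *s (branch_proj k i u *v (A i (p (\<gamma> u)) *v x))" for k u x
  define F where "F k u x = Re (herm (H i (p (\<gamma> u))) (R k u x) (branch_proj k i u *v x) +
     herm (H i (p (\<gamma> u))) (branch_proj k i u *v x) (R k u x) +
     herm (H' u) (branch_proj k i u *v x) (branch_proj k i u *v x))" for k u x
  define G where "G u x = (\<Sum>m\<in>UNIV. branch_norm m i u x)" for u x
  have Rs: "R k u (c *s x) = c *s R k u x" for k u c x
    by (simp add: R_def vec.scale vec_eq_iff algebra_simps)
  have hF: "F k u (c *\<^sub>R x) = c\<^sup>2 * F k u x" for k u c x
    unfolding F_def scaleR_eq_scalar Rs by (simp add: vec.scale herm_simps power2_eq_square algebra_simps)
  have hG: "G u (c *\<^sub>R x) = c\<^sup>2 * G u x" for u c x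
    unfolding G_def branch_norm_scale by (simp add: sum_distrib_left)
  have posG: "G u x > 0" if "u \<in> J" "x \<noteq> 0" for u x
    unfolding G_def by (rule branch_norm_sum_pos) (use that J JU in auto)
  have cH: "continuous_on J (\<lambda>u. H i (p (\<gamma> u)) $ k $ l)" for k l
    unfolding continuous_on_eq_continuous_within
  proof
    fix u assume u: "u \<in> J"
    have "continuous (at u within {0..1}) (\<lambda>u. H i (p (\<gamma> u)) $ k $ l)"
      by (rule has_vector_derivative_continuous[OF H'(1)]) (use u J JU in auto)
    then show "continuous (at u within J) (\<lambda>u. H i (p (\<gamma> u)) $ k $ l)"
      by (rule continuous_within_subset[OF _ J(1)])
  qed
  have csp: "continuous_on J (speed i)"
    by (rule continuous_on_subset[OF speed(2)[of u0]]) (use u0 JU J d in \<open>auto simp: J_def\<close>)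
  have cA: "continuous_on J (\<lambda>u. A i (p (\<gamma> u)) $ k $ l)" for k l
  proof -
    have "continuous_on J (\<lambda>u. A i (coord_inv i (z i (p (\<gamma> u)))) $ k $ l)"
      by (rule continuous_on_compose2[OF holomorphic_on_imp_continuous_on[OF matrix_holomorphic(2)]
            coord_path_continuous[OF J(1) JU]]) (use JU in auto)
    then show ?thesis by (rule continuous_on_eq) (use JU in auto)
  qed
  have lift: "continuous_on (J \<times> UNIV) (\<lambda>q. f (fst q))" if "continuous_on J f" for f :: "real \<Rightarrow> complex"
    by (rule continuous_on_compose2[OF that continuous_on_fst[OF continuous_on_id]]) auto
  have csnd: "continuous_on (J \<times> UNIV) (\<lambda>q. snd q $ a)" for a :: 'r
    by (intro continuous_intros)
  note cmv = matrix_vector_continuous_on[where S = "J \<times> UNIV"]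
  have cP: "continuous_on (J \<times> UNIV) (\<lambda>q. (branch_proj k i (fst q) *v snd q) $ a)" for k a
    by (intro cmv csnd lift P'(3))
  have cR: "continuous_on (J \<times> UNIV) (\<lambda>q. R k (fst q) (snd q) $ a)" for k a
    unfolding R_def vector_minus_component vector_smult_component
    by (intro continuous_on_diff continuous_on_mult cmv csnd lift P'(2,3) cA csp)
  have cF: "continuous_on (J \<times> UNIV) (\<lambda>(u, x). F k u x)" for k
    unfolding F_def case_prod_beta'
    by (intro continuous_on_Re continuous_on_add herm_continuous_on cP cR lift cH H'(2)[OF J(1) JU])
  have cG: "continuous_on (J \<times> UNIV) (\<lambda>(u, x). G u x)"
    unfolding G_def branch_norm_def case_prod_beta'
    by (intro continuous_on_sum continuous_on_Re herm_continuous_on cP lift cH)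
  have "\<exists>C\<ge>0. \<forall>u\<in>J. \<forall>x. \<bar>F k u x\<bar> \<le> C * G u x" for k
    by (rule homogeneous_bound[OF J(2) cF cG hF hG posG])
  then obtain Ck where Ck: "\<And>k. Ck k \<ge> 0" "\<And>k u x. u \<in> J \<Longrightarrow> \<bar>F k u x\<bar> \<le> Ck k * G u x" by metis
  have "growth_bound u (\<Sum>k\<in>UNIV. Ck k)" if u: "u \<in> {0..1}" "\<bar>u - u0\<bar> < d/2" for u
    unfolding growth_bound_def
  proof (intro allI impI)
    fix t s k assume s: "transported t s"
    have uJ: "u \<in> J" using u by (simp add: J_def dist_real_def abs_minus_commute)
    have uU: "p (\<gamma> u) \<in> U i" by (rule JU[OF uJ])
    let ?x = "s (\<gamma> u) i" and ?P = "branch_proj k i u" and ?H = "H i (p (\<gamma> u))"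
    let ?s' = "of_real t *s (path_matrix i u *v ?x) - speed i u *s (A i (p (\<gamma> u)) *v ?x)"
    have dX: "((\<lambda>u. (branch_proj k i u *v s (\<gamma> u) i) $ a) has_vector_derivative (?P *v ?s' + P' k u *v ?x) $ a)
        (at u within {0..1})" for a
      by (rule matrix_vector_has_vector_derivative[OF section_has_vector_derivative[OF s u(1) uU] P'(1)[OF uJ]])
    obtain v where v: "eigensystem (path_matrix i u) (\<lambda>k. \<beta> k u) v"
      using path_matrix_eigensystem[OF u(1) uU] by blast
    \<comment> \<open>The projection commutes with the path matrix, so all of the dependence on t
      collapses to the scalar t \<open>\<beta> k\<close>.\<close>
    have X': "?P *v ?s' + P' k u *v ?x = (of_real t * \<beta> k u) *s (?P *v ?x) + R k u ?x"
      using eig_proj_right_mult[OF v, of k ?x] unfolding R_def branch_proj_def[symmetric]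
      by (simp add: matrix_vector_mult_diff_distrib vec.scale)
    have "((\<lambda>u. herm (H i (p (\<gamma> u))) (branch_proj k i u *v s (\<gamma> u) i) (branch_proj k i u *v s (\<gamma> u) i))
        has_vector_derivative
        herm ?H ((of_real t * \<beta> k u) *s (?P *v ?x) + R k u ?x) (?P *v ?x) +
        herm ?H (?P *v ?x) ((of_real t * \<beta> k u) *s (?P *v ?x) + R k u ?x) +
        herm (H' u) (?P *v ?x) (?P *v ?x)) (at u within {0..1})"
      by (rule herm_has_vector_derivative[OF dX[unfolded X'] dX[unfolded X'] H'(1)[OF u(1) uU]])
    from bounded_linear.has_vector_derivative[OF bounded_linear_Re this]
    have dN: "((\<lambda>u. branch_norm k i u (s (\<gamma> u) i)) has_real_derivative
        Re (herm ?H ((of_real t * \<beta> k u) *s (?P *v ?x) + R k u ?x) (?P *v ?x) +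
        herm ?H (?P *v ?x) ((of_real t * \<beta> k u) *s (?P *v ?x) + R k u ?x) +
        herm (H' u) (?P *v ?x) (?P *v ?x))) (at u within {0..1})" (is "(_ has_real_derivative ?n') _")
      unfolding branch_norm_def has_real_derivative_iff_has_vector_derivative .
    have n': "?n' = 2 * t * Re (\<beta> k u) * branch_norm k i u ?x + F k u ?x"
    proof -
      have "herm ?H (?P *v ?x) (?P *v ?x) = of_real (branch_norm k i u ?x)"
        unfolding branch_norm_def by (rule pd_form_real[OF metric_pd[OF uU]])
      then show ?thesis unfolding F_def by (simp add: herm_simps algebra_simps)
    qed
    obtain e where e: "e > 0" "\<forall>u'\<in>{0..1}. dist u' u < e \<longrightarrow> p (\<gamma> u') \<in> U i"
      using path_near_base[OF open_U u(1) uU] by blast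
    have "(section_norm s k has_real_derivative ?n') (at u within {0..1})"
      unfolding has_real_derivative_iff_has_vector_derivative
    proof (rule has_vector_derivative_transform_within[OF dN[unfolded has_real_derivative_iff_has_vector_derivative] e(1) u(1)])
      fix u' assume "u' \<in> {0..1}" "dist u' u < e"
      then show "branch_norm k i u' (s (\<gamma> u') i) = section_norm s k u'"
        using section_norm_eq[OF s, of u' i k] e(2) by simp
    qed
    moreover have "\<bar>?n' - 2 * t * Re (\<beta> k u) * section_norm s k u\<bar> \<le> (\<Sum>k\<in>UNIV. Ck k) * (\<Sum>m\<in>UNIV. section_norm s m u)"
    proof -
      have GG: "(\<Sum>m\<in>UNIV. section_norm s m u) = G u ?x"
        unfolding G_def by (simp add: section_norm_eq[OF s u(1) uU])
      have "Ck k \<le> (\<Sum>k\<in>UNIV. Ck k)" by (rule member_le_sum) (use Ck in auto)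
      then have "Ck k * G u ?x \<le> (\<Sum>k\<in>UNIV. Ck k) * G u ?x"
        unfolding GG[symmetric] by (intro mult_right_mono sum_nonneg section_norm_nonneg)
      then have "\<bar>F k u ?x\<bar> \<le> (\<Sum>k\<in>UNIV. Ck k) * G u ?x" using Ck(2)[OF uJ, of k ?x] by linarith
      moreover have "section_norm s k u = branch_norm k i u ?x" by (rule section_norm_eq[OF s u(1) uU])
      ultimately show ?thesis unfolding n' GG by simp
    qed
    ultimately show "\<exists>n'. (section_norm s k has_real_derivative n') (at u within {0..1}) \<and>
        \<bar>n' - 2 * t * Re (\<beta> k u) * section_norm s k u\<bar> \<le> (\<Sum>k\<in>UNIV. Ck k) * (\<Sum>m\<in>UNIV. section_norm s m u)"
      by blast
  qed
  then show ?thesis using d2 by (intro exI[of _ "d/2"]) blast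
qed

lemma growth_bound_global: "\<exists>C\<ge>0. \<forall>u\<in>{0..1}. growth_bound u C"
proof -
  obtain C where C: "\<forall>u\<in>{0..1}. growth_bound u C"
    using unit_interval_bound[where P = growth_bound] growth_bound_local growth_bound_mono by blast
  then show ?thesis using growth_bound_mono[of _ C "max C 0"] by (intro exI[of _ "max C 0"]) auto
qed

text \<open>Each of the finitely many pairs has a positive minimum by continuity on the compact
  interval.\<close>

lemma spectral_gap: "\<exists>\<eta>>0. \<forall>u\<in>{0..1}. \<forall>k l. k < l \<longrightarrow> Re (\<beta> k u) - Re (\<beta> l u) \<ge> \<eta>"
proof -
  have "\<exists>e>0. \<forall>u\<in>{0..1}. Re (\<beta> k u) - Re (\<beta> l u) \<ge> e" if "k < l" for k l
  proof -
    have "continuous_on {0..1} (\<lambda>u. Re (\<beta> k u) - Re (\<beta> l u))"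
      by (intro continuous_intros \<beta>_continuous)
    from continuous_attains_inf[OF compact_Icc _ this]
    obtain u0 where "u0 \<in> {0..1}" "\<forall>u\<in>{0..1}. Re (\<beta> k u0) - Re (\<beta> l u0) \<le> Re (\<beta> k u) - Re (\<beta> l u)"
      by auto
    then show ?thesis using order that by (intro exI[of _ "Re (\<beta> k u0) - Re (\<beta> l u0)"]) auto
  qed
  then obtain e where e: "\<And>k l. k < l \<Longrightarrow> e k l > 0" "\<And>k l u. k < l \<Longrightarrow> u \<in> {0..1} \<Longrightarrow> Re (\<beta> k u) - Re (\<beta> l u) \<ge> e k l"
    by metis
  \<comment> \<open>The element 1 keeps the set nonempty in rank one, where there are no
    pairs.\<close>
  define E where "E = insert 1 ((\<lambda>(k, l). e k l) ` {(k, l). k < l})"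
  have fin: "finite E" unfolding E_def by (intro finite.insertI finite_imageI finite)
  have "Min E > 0" by (subst Min_gr_iff) (use fin e(1) in \<open>auto simp: E_def\<close>)
  moreover have "Re (\<beta> k u) - Re (\<beta> l u) \<ge> Min E" if "u \<in> {0..1}" "k < l" for u k l
  proof -
    have "e k l \<in> E" using that(2) by (auto simp: E_def)
    then have "Min E \<le> e k l" by (rule Min_le[OF fin])
    then show ?thesis using e(2)[OF that(2,1)] by linarith
  qed
  ultimately show ?thesis by blast
qed

end

section \<open>Asymptotics of the vector distance\<close>

lemma dim_preimage:
  fixes T :: "complex^'r::finite \<Rightarrow> complex^'r"
  assumes T: "Vector_Spaces.linear (*s) (*s) T" "inj T" "surj T" and S: "vec.subspace S"
  shows "vec.subspace (T -` S)" "vec.dim (T -` S) = vec.dim S"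
proof -
  interpret T: Vector_Spaces.linear "(*s)" "(*s)" T by (rule T(1))
  show "vec.subspace (T -` S)" using S unfolding vec.subspace_def by (simp add: T.zero T.add T.scale)
  have "vec.dim (T ` (T -` S)) = vec.dim (T -` S)"
    by (rule vec.dim_image_eq[OF T(1)]) (use T(2) in \<open>auto intro: inj_on_subset\<close>)
  then show "vec.dim (T -` S) = vec.dim S" using surj_image_vimage_eq[OF T(3)] by simp
qed

locale wkb_problem = wkb_path U z g \<Phi> A p H \<gamma> \<beta>
  for U :: "('i, 'a::t2_space) cover" and z :: "('i, 'a) coords"
    and g :: "('i, 'a, 'r::{finite,linorder}) transitions" and \<Phi> A :: "('i, 'a, 'r::{finite,linorder}) matrices"
    and p :: "'b::t2_space \<Rightarrow> 'a" and H and \<gamma> :: "real \<Rightarrow> 'b" and \<beta> +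
  fixes x0 :: 'b and i0 :: 'i
  assumes sc: "simply_connected (UNIV :: 'b set)" and x0: "p x0 \<in> U i0"
begin

abbreviation path_metric :: "real \<Rightarrow> real \<Rightarrow> (complex, 'r) vec \<Rightarrow> (complex, 'r) vec \<Rightarrow> complex" where
  "path_metric t u \<equiv> pulled_back_metric U z g A \<Phi> H p x0 i0 t (\<gamma> u)"

abbreviation path_transport :: "real \<Rightarrow> real \<Rightarrow> (complex, 'r) vec \<Rightarrow> (complex, 'r) vec" where
  "path_transport t u \<equiv> transport U z g A \<Phi> p x0 i0 t (\<gamma> u) (frame_at u)"

lemma path_metric_eq:
  "path_metric t u v w = herm (H (frame_at u) (p (\<gamma> u))) (path_transport t u v) (path_transport t u w)"
  by (simp add: pulled_back_metric_def frame_at_def Let_def)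

lemma path_metric_pd: "pd_form (path_metric t u)"
proof -
  have "pd_form (\<lambda>v w. herm (H (frame_at u) (p (\<gamma> u))) (path_transport t u v) (path_transport t u w))"
    by (rule pd_form_compose_linear[OF metric_pd[OF frame_at] transport_linear(1,2)[OF sc x0 frame_at]])
  then show ?thesis unfolding path_metric_eq[symmetric] .
qed

text \<open>At a fixed time both expressions are positive and homogeneous of degree 2, so each
  bounds the other. The parameter u' is a dummy, with {0} as the compact set.\<close>

lemma metric_comparison:
  assumes u: "u \<in> {0..1}"
  shows "\<exists>D\<ge>1. \<forall>x. Re (herm (H (frame_at u) (p (\<gamma> u))) x x) \<le> D * (\<Sum>k\<in>UNIV. branch_norm k (frame_at u) u x) \<and>
      (\<Sum>k\<in>UNIV. branch_norm k (frame_at u) u x) \<le> D * Re (herm (H (frame_at u) (p (\<gamma> u))) x x)"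
proof -
  let ?h = "herm (H (frame_at u) (p (\<gamma> u)))"
  define F where "F u' x = Re (?h x x)" for u' :: real and x
  define G where "G u' x = (\<Sum>k\<in>UNIV. branch_norm k (frame_at u) u x)" for u' :: real and x
  have hF: "F u' (c *\<^sub>R x) = c\<^sup>2 * F u' x" for u' c x
    unfolding F_def scaleR_eq_scalar by (simp add: herm_simps power2_eq_square mult.assoc)
  have hG: "G u' (c *\<^sub>R x) = c\<^sup>2 * G u' x" for u' c x
    unfolding G_def branch_norm_scale by (simp add: sum_distrib_left)
  have c1: "continuous_on ({0} \<times> UNIV) (\<lambda>q. snd q $ a)" for a :: 'r
    by (intro continuous_intros)
  have cF: "continuous_on ({0} \<times> UNIV) (\<lambda>(u', x). F u' x)"
    unfolding F_def case_prod_beta'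
    by (intro continuous_on_Re herm_continuous_on c1 continuous_on_const)
  have cG: "continuous_on ({0} \<times> UNIV) (\<lambda>(u', x). G u' x)"
    unfolding G_def branch_norm_def case_prod_beta'
    by (intro continuous_on_sum continuous_on_Re herm_continuous_on matrix_vector_continuous_on c1 continuous_on_const)
  have pF: "F u' x > 0" if "x \<noteq> 0" for u' x
    unfolding F_def by (rule pd_form_pos[OF metric_pd[OF frame_at] that])
  have pG: "G u' x > 0" if "x \<noteq> 0" for u' x
    unfolding G_def by (rule branch_norm_sum_pos[OF u frame_at that])
  obtain C1 where C1: "C1 \<ge> 0" "\<forall>u'\<in>{0}. \<forall>x. \<bar>F u' x\<bar> \<le> C1 * G u' x"
    using homogeneous_bound[of "{0}", OF _ cF cG hF hG pG] by auto
  obtain C2 where C2: "C2 \<ge> 0" "\<forall>u'\<in>{0}. \<forall>x. \<bar>G u' x\<bar> \<le> C2 * F u' x"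
    using homogeneous_bound[of "{0}", OF _ cG cF hG hF pF] by auto
  define D where "D = max 1 (max C1 C2)"
  have F0: "F 0 x \<ge> 0" for x unfolding F_def by (rule pd_form_nonneg[OF metric_pd[OF frame_at]])
  have G0: "G 0 x \<ge> 0" for x unfolding G_def by (intro sum_nonneg branch_norm_nonneg frame_at)
  have "F 0 x \<le> D * G 0 x \<and> G 0 x \<le> D * F 0 x" for x
  proof
    have "F 0 x \<le> C1 * G 0 x" using C1(2) abs_le_D1 by blast
    also have "\<dots> \<le> D * G 0 x" using G0 by (intro mult_right_mono) (auto simp: D_def)
    finally show "F 0 x \<le> D * G 0 x" .
    have "G 0 x \<le> C2 * F 0 x" using C2(2) abs_le_D1 by blast
    also have "\<dots> \<le> D * F 0 x" using F0 by (intro mult_right_mono) (auto simp: D_def)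
    finally show "G 0 x \<le> D * F 0 x" .
  qed
  moreover have "D \<ge> 1" by (simp add: D_def)
  ultimately show ?thesis unfolding F_def G_def by blast
qed

lemma section_growth:
  assumes C: "C \<ge> 0" "\<forall>u\<in>{0..1}. growth_bound u C"
    and \<eta>: "\<eta> > 0" "\<forall>u\<in>{0..1}. \<forall>k l. k < l \<longrightarrow> Re (\<beta> k u) - Re (\<beta> l u) \<ge> \<eta>"
    and t: "t \<ge> 0" "t * \<eta> \<ge> 2 * real CARD('r) * C"
    and s: "transported t s"
  shows "(\<And>l. l > k \<Longrightarrow> section_norm s l 0 = 0) \<Longrightarrow> (\<Sum>l\<in>UNIV. section_norm s l 1) \<ge>
      exp (2 * t * integral {0..1} (\<lambda>u. Re (\<beta> k u)) - 2 * real CARD('r) * C) * (\<Sum>l\<in>UNIV. section_norm s l 0)"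
    and "(\<And>l. l < k \<Longrightarrow> section_norm s l 1 = 0) \<Longrightarrow> (\<Sum>l\<in>UNIV. section_norm s l 1) \<le>
      exp (2 * t * integral {0..1} (\<lambda>u. Re (\<beta> k u)) + 2 * real CARD('r) * C) * (\<Sum>l\<in>UNIV. section_norm s l 0)"
proof -
  define N' where "N' k u = (SOME n'. (section_norm s k has_real_derivative n') (at u within {0..1}) \<and>
      \<bar>n' - 2 * t * Re (\<beta> k u) * section_norm s k u\<bar> \<le> C * (\<Sum>m\<in>UNIV. section_norm s m u))" for k u
  have N': "(section_norm s k has_real_derivative N' k u) (at u within {0..1})"
      "\<bar>N' k u - 2 * t * Re (\<beta> k u) * section_norm s k u\<bar> \<le> C * (\<Sum>m\<in>UNIV. section_norm s m u)"
    if "u \<in> {0..1}" for k u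
  proof -
    have "\<exists>n'. (section_norm s k has_real_derivative n') (at u within {0..1}) \<and>
      \<bar>n' - 2 * t * Re (\<beta> k u) * section_norm s k u\<bar> \<le> C * (\<Sum>m\<in>UNIV. section_norm s m u)"
      using C(2) that s unfolding growth_bound_def by blast
    from someI_ex[OF this] show "(section_norm s k has_real_derivative N' k u) (at u within {0..1})"
      "\<bar>N' k u - 2 * t * Re (\<beta> k u) * section_norm s k u\<bar> \<le> C * (\<Sum>m\<in>UNIV. section_norm s m u)"
      unfolding N'_def by blast+
  qed
  have gap: "Re (\<beta> k u) - Re (\<beta> l u) \<ge> \<eta>" if "u \<in> {0..1}" "k < l" for k l u using \<eta>(2) that by blast
  have b: "continuous_on {0..1} (\<lambda>u. Re (\<beta> k u))" for k by (intro continuous_on_Re \<beta>_continuous)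
  have \<eta>0: "\<eta> \<ge> 0" using \<eta>(1) by simp
  show "(\<And>l. l > k \<Longrightarrow> section_norm s l 0 = 0) \<Longrightarrow> (\<Sum>l\<in>UNIV. section_norm s l 1) \<ge>
      exp (2 * t * integral {0..1} (\<lambda>u. Re (\<beta> k u)) - 2 * real CARD('r) * C) * (\<Sum>l\<in>UNIV. section_norm s l 0)"
    by (rule signed_sum_lower[where b = "\<lambda>k u. Re (\<beta> k u)", OF section_norm_nonneg N'(1) N'(2) gap C(1) t \<eta>0 b])
  show "(\<And>l. l < k \<Longrightarrow> section_norm s l 1 = 0) \<Longrightarrow> (\<Sum>l\<in>UNIV. section_norm s l 1) \<le>
      exp (2 * t * integral {0..1} (\<lambda>u. Re (\<beta> k u)) + 2 * real CARD('r) * C) * (\<Sum>l\<in>UNIV. section_norm s l 0)"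
    by (rule signed_sum_upper[where b = "\<lambda>k u. Re (\<beta> k u)", OF section_norm_nonneg N'(1) N'(2) gap C(1) t \<eta>0 b])
qed

text \<open>The span of the eigenvectors chosen at time u is pulled back to the fibre over
  \<open>x0\<close> by the transport, which preserves its dimension. The subspace varies with t, but
  only its dimension enters the minimax principle.\<close>

lemma branch_subspace:
  assumes u: "u \<in> {0..1}"
  shows "\<exists>S. vec.subspace S \<and> vec.dim S = card K \<and>
    (\<forall>v\<in>S. \<forall>s. transported t s \<longrightarrow> s x0 i0 = v \<longrightarrow> (\<forall>l. l \<notin> K \<longrightarrow> section_norm s l u = 0))"
proof -
  obtain e where e: "eigensystem (path_matrix (frame_at u) u) (\<lambda>k. \<beta> k u) e"
    using path_matrix_eigensystem[OF u frame_at] by blast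
  note T = transport_linear[OF sc x0 frame_at, of t u]
  let ?S = "path_transport t u -` vec.span (e ` K)"
  have "vec.subspace ?S" "vec.dim ?S = card K"
    using dim_preimage[OF T vec.subspace_span, of "e ` K"] dim_span_indexed[OF eigensystem_span(1,2)[OF e], of K]
    by simp_all
  moreover have "section_norm s l u = 0"
    if v: "v \<in> ?S" and s: "transported t s" "s x0 i0 = v" and l: "l \<notin> K" for v s l
  proof -
    have "path_transport t u v = s (\<gamma> u) (frame_at u)"
      using transport_eq[OF sc x0 s(1) frame_at] s(2) by simp
    then have "s (\<gamma> u) (frame_at u) \<in> vec.span (e ` K)" using v by simp
    then have "branch_proj l (frame_at u) u *v s (\<gamma> u) (frame_at u) = 0"
      using eig_proj_eq_0_iff[OF e, of K] l unfolding branch_proj_def by blast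
    then show ?thesis unfolding section_norm_def branch_norm_def by (simp add: herm_def)
  qed
  ultimately show ?thesis by blast
qed

lemma vector_distance_bound:
  "\<exists>K t0. \<forall>t\<ge>t0. \<forall>k. \<bar>vector_distance (path_metric t 0) (path_metric t 1) $ k -
     t * integral {0..1} (\<lambda>u. Re (\<beta> k u))\<bar> \<le> K"
proof -
  obtain C where C: "C \<ge> 0" "\<forall>u\<in>{0..1}. growth_bound u C" using growth_bound_global by blast
  obtain \<eta> where \<eta>: "\<eta> > 0" "\<forall>u\<in>{0..1}. \<forall>k l. k < l \<longrightarrow> Re (\<beta> k u) - Re (\<beta> l u) \<ge> \<eta>"
    using spectral_gap by blast
  define S where "S u x = (\<Sum>k\<in>UNIV. branch_norm k (frame_at u) u x)" for u x
  define h where "h u x = Re (herm (H (frame_at u) (p (\<gamma> u))) x x)" for u x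
  obtain D0 where D0: "D0 \<ge> 1" "\<And>x. h 0 x \<le> D0 * S 0 x" "\<And>x. S 0 x \<le> D0 * h 0 x"
    using metric_comparison[of 0] unfolding S_def h_def by auto
  obtain D1 where D1: "D1 \<ge> 1" "\<And>x. h 1 x \<le> D1 * S 1 x" "\<And>x. S 1 x \<le> D1 * h 1 x"
    using metric_comparison[of 1] unfolding S_def h_def by auto
  define n where "n = real CARD('r)"
  define d where "d = (ln D0 + ln D1) / 2"
  have ed: "exp (2 * d) = D0 * D1"
  proof -
    have "2 * d = ln D0 + ln D1" by (simp add: d_def)
    then show ?thesis using D0(1) D1(1) by (simp add: exp_add)
  qed
  \<comment> \<open>For squared norms the growth estimate costs exp (2 n C), and passing between the
    metric and the sum of components at both ends costs D0 D1 = exp (2 d). The vector distance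
    compares norms, hence half of the exponent.\<close>
  define K where "K = n * C + d"
  have "\<bar>vector_distance (path_metric t 0) (path_metric t 1) $ k - t * integral {0..1} (\<lambda>u. Re (\<beta> k u))\<bar> \<le> K"
    if t0: "t \<ge> max 0 (2 * n * C / \<eta>)" for t k
  proof -
    define \<alpha> where "\<alpha> = integral {0..1} (\<lambda>u. Re (\<beta> k u))"
    \<comment> \<open>The threshold on t is the one at which the gap outweighs the error in the
      signed sums.\<close>
    have t: "t \<ge> 0" "t * \<eta> \<ge> 2 * real CARD('r) * C"
      using t0 \<eta>(1) by (simp_all add: n_def pos_divide_le_eq)
    have sec: "\<exists>s. transported t s \<and> s x0 i0 = v \<and>
        Re (path_metric t 0 v v) = h 0 (s (\<gamma> 0) (frame_at 0)) \<and>
        Re (path_metric t 1 v v) = h 1 (s (\<gamma> 1) (frame_at 1)) \<and>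
        (\<Sum>l\<in>UNIV. section_norm s l 0) = S 0 (s (\<gamma> 0) (frame_at 0)) \<and>
        (\<Sum>l\<in>UNIV. section_norm s l 1) = S 1 (s (\<gamma> 1) (frame_at 1))" for v
    proof -
      obtain s where s: "transported t s" "s x0 i0 = v"
        using transported_section_exists[OF sc x0] by blast
      have T: "path_transport t u v = s (\<gamma> u) (frame_at u)" for u
        using transport_eq[OF sc x0 s(1) frame_at] s(2) by simp
      show ?thesis
        by (rule exI[of _ s]) (simp add: s path_metric_eq T h_def S_def section_norm_def)
    qed
    have z01: "(0::real) \<in> {0..1}" "(1::real) \<in> {0..1}" by simp_all
    have "vector_distance (path_metric t 0) (path_metric t 1) $ k \<ge> t * \<alpha> - K"
    proof -
      obtain V where V: "vec.subspace V" "vec.dim V = card {..k}"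
        "\<forall>v\<in>V. \<forall>s. transported t s \<longrightarrow> s x0 i0 = v \<longrightarrow> (\<forall>l. l \<notin> {..k} \<longrightarrow> section_norm s l 0 = 0)"
        using branch_subspace[OF z01(1), of "{..k}" t] by (elim exE conjE) (rule that)
      show ?thesis
      proof (rule vector_distance_lower[OF path_metric_pd path_metric_pd V(1,2)])
        fix v assume v: "v \<in> V"
        obtain s where s: "transported t s" "s x0 i0 = v"
          and e: "Re (path_metric t 0 v v) = h 0 (s (\<gamma> 0) (frame_at 0))"
            "Re (path_metric t 1 v v) = h 1 (s (\<gamma> 1) (frame_at 1))"
            "(\<Sum>l\<in>UNIV. section_norm s l 0) = S 0 (s (\<gamma> 0) (frame_at 0))"
            "(\<Sum>l\<in>UNIV. section_norm s l 1) = S 1 (s (\<gamma> 1) (frame_at 1))"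
          using sec[of v] by (elim exE conjE) (rule that)
        have "section_norm s l 0 = 0" if "l > k" for l using V(3) v s that by simp
        from section_growth(1)[OF C \<eta> t s(1) this]
        have g: "S 1 (s (\<gamma> 1) (frame_at 1)) \<ge> exp (2 * t * \<alpha> - 2 * n * C) * S 0 (s (\<gamma> 0) (frame_at 0))"
          unfolding e \<alpha>_def n_def .
        have x: "exp (2 * (t * \<alpha> - K)) * (D0 * D1) = exp (2 * t * \<alpha> - 2 * n * C)"
          unfolding ed[symmetric] exp_add[symmetric] K_def by (simp add: algebra_simps)
        \<comment> \<open>The extra factor D1 on both sides prepares the final passage from
          components back to the metric at time 1; D0 is spent at time 0.\<close>
        have "D1 * (exp (2 * (t * \<alpha> - K)) * h 0 (s (\<gamma> 0) (frame_at 0)))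
            \<le> D1 * (exp (2 * (t * \<alpha> - K)) * (D0 * S 0 (s (\<gamma> 0) (frame_at 0))))"
          using D0(2) D1(1) by (intro mult_left_mono) auto
        also have "\<dots> = exp (2 * t * \<alpha> - 2 * n * C) * S 0 (s (\<gamma> 0) (frame_at 0))"
          unfolding x[symmetric] by (simp add: mult_ac)
        also have "\<dots> \<le> S 1 (s (\<gamma> 1) (frame_at 1))" by (rule g)
        also have "\<dots> \<le> D1 * h 1 (s (\<gamma> 1) (frame_at 1))" by (rule D1(3))
        finally show "Re (path_metric t 1 v v) \<ge> exp (2 * (t * \<alpha> - K)) * Re (path_metric t 0 v v)"
          unfolding e using D1(1) by simp
      qed
    qed
    moreover have "vector_distance (path_metric t 0) (path_metric t 1) $ k \<le> t * \<alpha> + K"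
    proof -
      obtain V where V: "vec.subspace V" "vec.dim V = card {k..}"
        "\<forall>v\<in>V. \<forall>s. transported t s \<longrightarrow> s x0 i0 = v \<longrightarrow> (\<forall>l. l \<notin> {k..} \<longrightarrow> section_norm s l 1 = 0)"
        using branch_subspace[OF z01(2), of "{k..}" t] by (elim exE conjE) (rule that)
      show ?thesis
      proof (rule vector_distance_upper[OF path_metric_pd path_metric_pd V(1,2)])
        fix v assume v: "v \<in> V"
        obtain s where s: "transported t s" "s x0 i0 = v"
          and e: "Re (path_metric t 0 v v) = h 0 (s (\<gamma> 0) (frame_at 0))"
            "Re (path_metric t 1 v v) = h 1 (s (\<gamma> 1) (frame_at 1))"
            "(\<Sum>l\<in>UNIV. section_norm s l 0) = S 0 (s (\<gamma> 0) (frame_at 0))"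
            "(\<Sum>l\<in>UNIV. section_norm s l 1) = S 1 (s (\<gamma> 1) (frame_at 1))"
          using sec[of v] by (elim exE conjE) (rule that)
        have "section_norm s l 1 = 0" if "l < k" for l using V(3) v s that by simp
        from section_growth(2)[OF C \<eta> t s(1) this]
        have g: "S 1 (s (\<gamma> 1) (frame_at 1)) \<le> exp (2 * t * \<alpha> + 2 * n * C) * S 0 (s (\<gamma> 0) (frame_at 0))"
          unfolding e \<alpha>_def n_def .
        have x: "exp (2 * (t * \<alpha> + K)) = exp (2 * t * \<alpha> + 2 * n * C) * (D0 * D1)"
          unfolding ed[symmetric] exp_add[symmetric] K_def by (simp add: algebra_simps)
        have "h 1 (s (\<gamma> 1) (frame_at 1)) \<le> D1 * S 1 (s (\<gamma> 1) (frame_at 1))" by (rule D1(2))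
        also have "\<dots> \<le> D1 * (exp (2 * t * \<alpha> + 2 * n * C) * S 0 (s (\<gamma> 0) (frame_at 0)))"
          using g D1(1) by (intro mult_left_mono) auto
        also have "\<dots> \<le> D1 * (exp (2 * t * \<alpha> + 2 * n * C) * (D0 * h 0 (s (\<gamma> 0) (frame_at 0))))"
          using D0(3) D1(1) by (intro mult_left_mono) auto
        also have "\<dots> = exp (2 * (t * \<alpha> + K)) * h 0 (s (\<gamma> 0) (frame_at 0))"
          unfolding x by (simp add: mult_ac)
        finally show "Re (path_metric t 1 v v) \<le> exp (2 * (t * \<alpha> + K)) * Re (path_metric t 0 v v)"
          unfolding e .
      qed
    qed
    ultimately show ?thesis unfolding \<alpha>_def by linarith
  qed
  then show ?thesis by blast
qed

lemma vector_distance_limit: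
  "((\<lambda>t. (1 / t) *\<^sub>R vector_distance (path_metric t 0) (path_metric t 1))
     \<longlongrightarrow> (\<chi> k. integral {0..1} (\<lambda>u. Re (\<beta> k u)))) at_top"
proof (rule vec_tendstoI)
  fix k
  let ?\<alpha> = "integral {0..1} (\<lambda>u. Re (\<beta> k u))"
  obtain K t0 where K: "\<forall>t\<ge>t0. \<forall>k. \<bar>vector_distance (path_metric t 0) (path_metric t 1) $ k -
     t * integral {0..1} (\<lambda>u. Re (\<beta> k u))\<bar> \<le> K" using vector_distance_bound by blast
  have "((\<lambda>t. ((1 / t) *\<^sub>R vector_distance (path_metric t 0) (path_metric t 1)) $ k - ?\<alpha>) \<longlongrightarrow> 0) at_top"
  proof (rule Lim_null_comparison)
    show "\<forall>\<^sub>F t in at_top. norm (((1 / t) *\<^sub>R vector_distance (path_metric t 0) (path_metric t 1)) $ k - ?\<alpha>) \<le> K * inverse t"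
      using eventually_ge_at_top[of t0] eventually_gt_at_top[of 0]
    proof eventually_elim
      case (elim t)
      let ?a = "vector_distance (path_metric t 0) (path_metric t 1) $ k"
      have "norm (((1 / t) *\<^sub>R vector_distance (path_metric t 0) (path_metric t 1)) $ k - ?\<alpha>) = \<bar>?a - t * ?\<alpha>\<bar> * inverse t"
      proof -
        have "?a / t - ?\<alpha> = (?a - t * ?\<alpha>) * inverse t" using elim(2) by (simp add: field_simps)
        then show ?thesis using elim(2) by (simp add: abs_mult)
      qed
      also have "\<dots> \<le> K * inverse t" using K elim by (intro mult_right_mono) auto
      finally show ?case .
    qed
    have "((\<lambda>t. K * inverse t) \<longlongrightarrow> K * 0) at_top"
      by (intro tendsto_mult tendsto_const tendsto_inverse_0_at_top filterlim_ident)
    then show "((\<lambda>t. K * inverse t) \<longlongrightarrow> 0) at_top" by simp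
  qed
  then show "((\<lambda>t. ((1 / t) *\<^sub>R vector_distance (path_metric t 0) (path_metric t 1)) $ k)
     \<longlongrightarrow> (\<chi> k. integral {0..1} (\<lambda>u. Re (\<beta> k u))) $ k) at_top"
    by (simp add: LIM_zero_iff)
qed

end

theorem theorem1p6:
  fixes U :: "'i \<Rightarrow> 'a::t2_space set"
    and z :: "'i \<Rightarrow> 'a \<Rightarrow> complex"
    and g :: "'i \<Rightarrow> 'i \<Rightarrow> 'a \<Rightarrow> complex^('r::{finite,linorder})^('r::{finite,linorder})"
    and \<delta> :: "'i \<Rightarrow> 'a \<Rightarrow> complex"
    and \<Phi> A H :: "'i \<Rightarrow> 'a \<Rightarrow> complex^('r::{finite,linorder})^('r::{finite,linorder})"
    and p :: "'b::t2_space \<Rightarrow> 'a"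
    and x0 :: 'b
    and i0 :: 'i
    and \<gamma> :: "real \<Rightarrow> 'b"
    and \<beta> :: "'r::{finite,linorder} \<Rightarrow> real \<Rightarrow> complex"
  assumes "riemann_surface U z"
    and "holomorphic_bundle U z g"
    and "det_trivialization U z g \<delta>"
    and "higgs_field U z g \<Phi>"
    and "\<forall>i. \<forall>x \<in> U i. trace (\<Phi> i x) = 0"
    and "reduced_spectral_curve U z \<Phi>"
    and "holomorphic_connection U z g A"
    and "trivial_det_connection U z \<delta> A"
    and "hermitian_metric U z g H"
    and "standard_on_det U \<delta> H"
    and "covering_space (UNIV :: 'b set) p (UNIV :: 'a set)"
    and "simply_connected (UNIV :: 'b set)"
    and "p x0 \<in> U i0"
    and "path \<gamma>"
    and "C1_path U z (p \<circ> \<gamma>)"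
    and "\<forall>u \<in> {0..1}. p (\<gamma> u) \<in> unbranched U \<Phi>"
    and "pullback_eigenforms U z \<Phi> (p \<circ> \<gamma>) \<beta>"
    and "\<forall>u \<in> {0..1}. \<forall>k l. k < l \<longrightarrow> Re (\<beta> k u) > Re (\<beta> l u)"
  shows "((\<lambda>t. (1 / t) *\<^sub>R vector_distance
              (pulled_back_metric U z g A \<Phi> H p x0 i0 t (\<gamma> 0))
              (pulled_back_metric U z g A \<Phi> H p x0 i0 t (\<gamma> 1)))
          \<longlongrightarrow> (\<chi> k. integral {0..1} (\<lambda>u. Re (\<beta> k u)))) at_top"
proof -
  interpret wkb_problem U z g \<Phi> A p H \<gamma> \<beta> x0 i0
    by unfold_locales (rule assms)+
  show ?thesis by (rule vector_distance_limit)
qed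

end
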